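(* Let $1\le p\le 2$ and $b>0$, and set $$A_{p,b}=\left(\frac{1+b+\sqrt{1+b^2+2b\cos\frac{2\pi}{p}}}{2b}\right)^{1/2}.$$ Then for every $f=g+\bar h\in\mathbf{h}^p$, with $g,h$ holomorphic in the unit disk $\mathbf{U}$ and $\Re(g(0)h(0))\le 0$, one has $$\left(\int_{\mathbf{T}}|g+\bar h|^p\,d\sigma\right)^{1/p}\le A_{p,b}\left(\int_{\mathbf{T}}\left(|g|^2+b|h|^2\right)^{p/2}d\sigma\right)^{1/p}.$$ The inequality is sharp, i.e. $A_{p,b}$ is the best possible constant. More precisely, the quotient of the left-hand integral expression $\left(\int_{\mathbf{T}}|g+\bar h|^p\,d\sigma\right)^{1/p}$ by $\left(\int_{\mathbf{T}}(|g|^2+b|h|^2)^{p/2}\,d\sigma\right)^{1/p}$ tends to $A_{p,b}$ as $c\uparrow 1/p$ along the following functions $f_c=g+\bar h$, $0<c<1/p$: (i) if $p<2$, $$f_c(z)=\left(\frac{1+z}{1-z}\right)^c-\bar r\left(\frac{1+\bar z}{1-\bar z}\right)^c,\qquad \bar r=\frac{\left(-1+b-\sqrt{1+b^2+2b\cos\frac{2\pi}{p}}\right)\sec\frac{\pi}{p}}{2b},$$ where $g(z)=\left(\frac{1+z}{1-z}\right)^c$ and $h(z)=-\bar r\left(\frac{1+z}{1-z}\right)^c$ ($\bar r$ is a real number); (ii) if $p=2$ and $b\le 1$, $f_c(z)=\left(\frac{1+\bar z}{1-\bar z}\right)^c$ (with $g=0$, $h(z)=\left(\frac{1+z}{1-z}\right)^c$);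 (iii) if $p=2$ and $b>1$, $f_c(z)=\left(\frac{1+z}{1-z}\right)^c$ (with $g(z)=\left(\frac{1+z}{1-z}\right)^c$, $h=0$).
   Context: $\mathbf{U}$ is the open unit disk and $\mathbf{T}$ the unit circle in $\mathbb{C}$; $d\sigma(e^{it})=\frac{dt}{2\pi}$ is normalized arc length on $\mathbf{T}$. The Hardy class $\mathbf{h}^p$ consists of the complex-valued harmonic functions $f=g+\bar h$ on $\mathbf{U}$, with $g,h$ holomorphic in $\mathbf{U}$, such that $$\sup_{0<r<1}\left(\int_{\mathbf{T}}|f(r\zeta)|^p\,d\sigma(\zeta)\right)^{1/p}<\infty.$$ In integrals over $\mathbf{T}$, the functions $f,g,h$ are understood through their radial boundary values $f(e^{it})=\lim_{r\to1}f(re^{it})$ (and likewise for $g$, $h$), which exist almost everywhere. The powers $\left(\frac{1+z}{1-z}\right)^c$ are taken with the principal branch, $\left|\arg\frac{1+z}{1-z}\right|\le\frac{\pi}{2}$. *)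

theory Defs
  imports "HOL-Complex_Analysis.Complex_Analysis"
begin

definition circle_measure :: "complex measure" where
  "circle_measure =
     distr (uniform_measure lborel {0..2 * pi}) (restrict_space borel (sphere 0 1)) cis"

lemma cis_measurable_circle: "cis \<in> borel \<rightarrow>\<^sub>M restrict_space borel (sphere 0 1)"
  by (intro measurable_restrict_space2 borel_measurable_continuous_onI continuous_intros) auto

lemma nn_integral_circle_measure:
  assumes "F \<in> borel_measurable (restrict_space borel (sphere 0 1))"
  shows "(\<integral>\<^sup>+\<zeta>. F \<zeta> \<partial>circle_measure) =
    (\<integral>\<^sup>+t. F (cis t) * indicator {0..2 * pi} t \<partial>lborel) / ennreal (2 * pi)"
proof -
  have cis: "cis \<in> uniform_measure lborel {0..2 * pi} \<rightarrow>\<^sub>M restrict_space borel (sphere 0 1)"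
    using cis_measurable_circle by simp
  have "(\<lambda>t. F (cis t)) \<in> borel_measurable lborel"
    using measurable_compose[OF cis_measurable_circle assms] by simp
  then show ?thesis
    unfolding circle_measure_def
    by (simp add: nn_integral_distr[OF cis] assms nn_integral_uniform_measure)
qed

text \<open>Powers of a nonnegative extended real with a positive exponent \<open>a\<close>.
  Integrals are kept in \<^typ>\<open>ennreal\<close> because for \<open>p = 1\<close> the boundary values of the holomorphic
  parts of \<open>f \<in> h\<^sup>1\<close> need not be integrable.\<close>

definition ennpowr :: "ennreal \<Rightarrow> real \<Rightarrow> ennreal" where
  "ennpowr x a = (if x = \<infinity> then \<infinity> else ennreal (enn2real x powr a))"

text \<open>At the points where the radial limit does not exist, the value is unspecified.\<close>

definition radial_limit :: "(complex \<Rightarrow> complex) \<Rightarrow> complex \<Rightarrow> complex" where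
  "radial_limit f \<zeta> = Lim (at_left (1::real)) (\<lambda>r. f (of_real r * \<zeta>))"

definition harmonic_decomp ::
    "(complex \<Rightarrow> complex) \<Rightarrow> (complex \<Rightarrow> complex) \<Rightarrow> (complex \<Rightarrow> complex) \<Rightarrow> bool" where
  "harmonic_decomp f g h \<longleftrightarrow>
     g holomorphic_on ball 0 1 \<and> h holomorphic_on ball 0 1 \<and>
     (\<forall>z\<in>ball 0 1. f z = g z + cnj (h z))"

definition harmonic_hardy :: "real \<Rightarrow> (complex \<Rightarrow> complex) set" where
  "harmonic_hardy p = {f. (\<exists>g h. harmonic_decomp f g h) \<and>
     (SUP r\<in>{0<..<1::real}.
        ennpowr (\<integral>\<^sup>+\<zeta>. ennreal (cmod (f (of_real r * \<zeta>)) powr p) \<partial>circle_measure) (1 / p)) < \<infinity>}"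

definition lhs_norm :: "real \<Rightarrow> (complex \<Rightarrow> complex) \<Rightarrow> (complex \<Rightarrow> complex) \<Rightarrow> ennreal" where
  "lhs_norm p g h =
     ennpowr (\<integral>\<^sup>+\<zeta>. ennreal (cmod (radial_limit g \<zeta> + cnj (radial_limit h \<zeta>)) powr p)
       \<partial>circle_measure) (1 / p)"

definition rhs_norm ::
    "real \<Rightarrow> real \<Rightarrow> (complex \<Rightarrow> complex) \<Rightarrow> (complex \<Rightarrow> complex) \<Rightarrow> ennreal" where
  "rhs_norm p b g h =
     ennpowr (\<integral>\<^sup>+\<zeta>. ennreal (((cmod (radial_limit g \<zeta>))\<^sup>2 + b * (cmod (radial_limit h \<zeta>))\<^sup>2) powr (p / 2))
       \<partial>circle_measure) (1 / p)"

definition admissible ::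
    "real \<Rightarrow> (complex \<Rightarrow> complex) \<Rightarrow> (complex \<Rightarrow> complex) \<Rightarrow> (complex \<Rightarrow> complex) \<Rightarrow> bool" where
  "admissible p f g h \<longleftrightarrow>
     f \<in> harmonic_hardy p \<and> harmonic_decomp f g h \<and> Re (g 0 * h 0) \<le> 0"

definition A_const :: "real \<Rightarrow> real \<Rightarrow> real" where
  "A_const p b =
     ((1 + b + sqrt (1 + b\<^sup>2 + 2 * b * cos (2 * pi / p))) / (2 * b)) powr (1 / 2)"

text \<open>The constant \<open>\<bar>r\<close>, with \<open>sec x\<close> written as \<open>1 / cos x\<close>; used only for \<open>1 \<le> p < 2\<close>,
  where \<open>cos (\<pi> / p) < 0\<close>.\<close>

definition r_const :: "real \<Rightarrow> real \<Rightarrow> real" where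
  "r_const p b =
     ((- 1 + b - sqrt (1 + b\<^sup>2 + 2 * b * cos (2 * pi / p))) * (1 / cos (pi / p))) / (2 * b)"

text \<open>\<^const>\<open>powr\<close> on complex numbers is the principal branch, and \<open>(1 + z) / (1 - z)\<close> lies in the
  right half-plane for \<open>z\<close> in the unit disk.\<close>

definition cayley_pow :: "real \<Rightarrow> complex \<Rightarrow> complex" where
  "cayley_pow c z = ((1 + z) / (1 - z)) powr of_real c"

definition extremal_family ::
    "real \<Rightarrow> real \<Rightarrow> (real \<Rightarrow> complex \<Rightarrow> complex) \<Rightarrow> (real \<Rightarrow> complex \<Rightarrow> complex)
      \<Rightarrow> (real \<Rightarrow> complex \<Rightarrow> complex) \<Rightarrow> bool" where
  "extremal_family p b f g h \<longleftrightarrow>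
     (\<forall>c. 0 < c \<and> c < 1 / p \<longrightarrow> admissible p (f c) (g c) (h c)) \<and>
     ((\<lambda>c. lhs_norm p (g c) (h c) / rhs_norm p b (g c) (h c)) \<longlongrightarrow> ennreal (A_const p b))
       (at_left (1 / p))"

end

theory Submission
  imports Defs
begin

text \<open>
  For \<open>q = p / 2\<close> there is a constant \<open>D \<ge> 0\<close> with
  \<open>|z + cnj w|^p + D \<Phi>(z w) \<le> A^p (|z|^2 + b |w|^2)^q\<close> for all complex \<open>z\<close>, \<open>w\<close>, where
  \<open>\<Phi>(\<zeta>) = |\<zeta>|^q cos (q (\<pi> - |arg \<zeta>|))\<close> is subharmonic. As \<open>\<Phi> \<ge> 0\<close> on the left half-plane, the mean of
  \<open>\<Phi>(g h)\<close> over circles is nonnegative when \<open>Re (g(0) h(0)) \<le> 0\<close>, which gives the inequality on smaller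
  circles. To pass to the boundary one needs Fatou's theorem and, since \<open>g\<close> and \<open>h\<close> need not be in the
  Hardy class for \<open>p = 1\<close>, multipliers that make \<open>g\<close> and \<open>h\<close> bounded; these come from a holomorphic
  function \<open>H\<close> with \<open>Re H \<ge> 1 + |f|\<close>. For the functions of the extremal family the quotient is a
  constant depending continuously on \<open>c\<close>, because \<open>(1 + z) / (1 - z)\<close> is imaginary on the circle.
\<close>


subsection \<open>Integration over the unit circle and the Poisson formula\<close>

text \<open>The constant is an eigenvalue. Let p < 2 and c = - cos (pi / p). If |arg (z w)| = pi -
  pi / p, then |z + cnj w|^2 = |z|^2 + |w|^2 + 2 c |z| |w|, and A^2 is the largest value of this
  form relative to |z|^2 + b |w|^2, attained at |w| / |z| = \<open>r_const p b\<close>. On these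
  rays \<Phi>(z w) = 0, because cos (q pi / p) = cos (pi / 2), and the pointwise inequality becomes
  an equality. The extremal functions have just this ratio, and on the circle the values of g h
  approach these rays as c tends to 1 / p. For p > 1 the term |z + cnj w|^p alone exceeds the right
  side for some z, w with z w > 0; there \<Phi> is negative, so the estimate can only hold after
  averaging. At the boundary the difficulty is the right-hand integral: for unbounded g and h its
  values over smaller circles are not directly controlled by its value over the unit circle. With
  the multipliers, boundary moduli only shrink, so the right side needs monotonicity and the left
  side Fatou's lemma.\<close>

lemma space_circle_measure [simp]: "space circle_measure = sphere 0 1"
  by (simp add: circle_measure_def space_restrict_space)

lemma sets_circle_measure [measurable_cong]: "sets circle_measure = sets (restrict_space borel (sphere 0 1))"
  by (simp add: circle_measure_def)

lemma cis_measurable_uniform: "cis \<in> uniform_measure lborel {0..2 * pi} \<rightarrow>\<^sub>M restrict_space borel (sphere 0 1)"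
  using cis_measurable_circle by simp

lemma emeasure_circle_measure_space: "emeasure circle_measure (sphere 0 1) = 1"
proof -
  have "emeasure circle_measure (space circle_measure) = (\<integral>\<^sup>+\<zeta>. 1 \<partial>circle_measure)"
    by simp
  also have "\<dots> = ennreal (2 * pi) / ennreal (2 * pi)"
    by (subst nn_integral_circle_measure) auto
  also have "\<dots> = 1" by (simp add: divide_ennreal)
  finally show ?thesis by simp
qed

lemma finite_measure_circle_measure: "finite_measure circle_measure"
  by (rule finite_measureI) (simp add: emeasure_circle_measure_space)

interpretation circle: finite_measure circle_measure
  by (rule finite_measure_circle_measure)

lemma measure_circle_measure_space [simp]: "measure circle_measure (sphere 0 1) = 1"
  by (simp add: measure_def emeasure_circle_measure_space)

lemma borel_measurable_circle_continuous:
  fixes F :: "complex \<Rightarrow> 'b::topological_space"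
  assumes "continuous_on (sphere 0 1) F"
  shows "F \<in> borel_measurable circle_measure"
  using borel_measurable_continuous_on_restrict[OF assms]
  by (simp add: circle_measure_def)

lemma integrable_circle_continuous:
  fixes F :: "complex \<Rightarrow> 'b::{banach, second_countable_topology}"
  assumes "continuous_on (sphere 0 1) F"
  shows "integrable circle_measure F"
proof -
  have "bounded (F ` sphere 0 1)"
    by (intro compact_imp_bounded compact_continuous_image assms) auto
  then obtain B where "\<forall>\<zeta>\<in>sphere 0 1. norm (F \<zeta>) \<le> B" by (auto simp: bounded_iff)
  then show ?thesis
    by (intro circle.integrable_const_bound[of _ B] borel_measurable_circle_continuous assms) (auto intro!: AE_I2)
qed

lemma integral_circle_measure:
  fixes F :: "complex \<Rightarrow> 'b::euclidean_space"
  assumes "continuous_on (sphere 0 1) F"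
  shows "(\<integral>\<zeta>. F \<zeta> \<partial>circle_measure) = integral {0..2 * pi} (\<lambda>t. F (cis t)) /\<^sub>R (2 * pi)"
proof -
  have F: "F \<in> borel_measurable (restrict_space borel (sphere 0 1))"
    by (rule borel_measurable_continuous_on_restrict[OF assms])
  have Fc: "(\<lambda>t. F (cis t)) \<in> borel_measurable lborel"
    using measurable_compose[OF cis_measurable_circle F] by simp
  have um: "uniform_measure lborel {0..2 * pi} = density lborel (\<lambda>t. ennreal (indicator {0..2 * pi} t / (2 * pi)))"
    unfolding uniform_measure_def
    by (intro density_cong AE_I2) (auto simp: divide_ennreal[symmetric] split: split_indicator)
  have "(\<integral>\<zeta>. F \<zeta> \<partial>circle_measure) = (\<integral>t. F (cis t) \<partial>uniform_measure lborel {0..2 * pi})"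
    unfolding circle_measure_def by (rule integral_distr[OF cis_measurable_uniform F])
  also have "\<dots> = (\<integral>t. (indicator {0..2 * pi} t / (2 * pi)) *\<^sub>R F (cis t) \<partial>lborel)"
    unfolding um by (rule integral_density[OF Fc]) auto
  also have "\<dots> = (LINT t:{0..2 * pi}|lborel. F (cis t)) /\<^sub>R (2 * pi)"
    unfolding set_lebesgue_integral_def by (subst integral_scaleR_right[symmetric]) (simp add: field_simps)
  also have "(LINT t:{0..2 * pi}|lborel. F (cis t)) = integral {0..2 * pi} (\<lambda>t. F (cis t))"
    by (intro set_borel_integral_eq_integral borel_integrable_atLeastAtMost' continuous_on_compose2[OF assms])
      (auto intro!: continuous_intros)
  finally show ?thesis .
qed

text \<open>The extra factor \<open>\<zeta>\<close> comes from integrating against arc length: on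
  the circle d\<zeta> = i \<zeta> dt.\<close>

lemma circle_cauchy_formula:
  assumes "continuous_on (cball 0 1) G" "G holomorphic_on ball 0 1" "cmod a < 1"
  shows "(\<integral>\<zeta>. G \<zeta> * \<zeta> / (\<zeta> - a) \<partial>circle_measure) = G a"
proof -
  have ne: "\<zeta> \<noteq> a" if "cmod \<zeta> = 1" for \<zeta> using that assms(3) by auto
  have "((\<lambda>u. G u / (u - a)) has_contour_integral (2 * of_real pi * \<i> * G a)) (circlepath 0 1)"
    by (rule Cauchy_integral_circlepath) (use assms in auto)
  then have "((\<lambda>t. G (0 + of_real 1 * cis t) / (0 + of_real 1 * cis t - a) * of_real 1 * \<i> * cis t) has_integral (2 * of_real pi * \<i> * G a)) {0..2 * pi}"
    unfolding circlepath_def by (subst (asm) has_contour_integral_part_circlepath_iff) auto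
  then have "integral {0..2 * pi} (\<lambda>t. \<i> * (G (cis t) * cis t / (cis t - a))) = 2 * of_real pi * \<i> * G a"
    by (intro integral_unique) (simp add: field_simps)
  then have "\<i> * integral {0..2 * pi} (\<lambda>t. G (cis t) * cis t / (cis t - a)) = \<i> * (2 * of_real pi * G a)"
    unfolding integral_mult_right by (simp only: mult_ac)
  then have "integral {0..2 * pi} (\<lambda>t. G (cis t) * cis t / (cis t - a)) = 2 * of_real pi * G a"
    by simp
  moreover have "continuous_on (sphere 0 1) (\<lambda>\<zeta>. G \<zeta> * \<zeta> / (\<zeta> - a))"
    using ne by (intro continuous_intros continuous_on_subset[OF assms(1)]) auto
  ultimately show ?thesis
    by (subst integral_circle_measure) (auto simp: scaleR_conv_of_real)
qed

lemma circle_mean_value: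
  assumes "continuous_on (cball 0 1) G" "G holomorphic_on ball 0 1"
  shows "(\<integral>\<zeta>. G \<zeta> \<partial>circle_measure) = G 0"
proof -
  have "(\<integral>\<zeta>. G \<zeta> \<partial>circle_measure) = (\<integral>\<zeta>. G \<zeta> * \<zeta> / (\<zeta> - 0) \<partial>circle_measure)"
    by (intro Bochner_Integration.integral_cong) auto
  also have "\<dots> = G 0" by (rule circle_cauchy_formula) (use assms in auto)
  finally show ?thesis .
qed

definition poisson :: "complex \<Rightarrow> complex \<Rightarrow> real" where
  "poisson a \<zeta> = (1 - (cmod a)\<^sup>2) / (cmod (\<zeta> - a))\<^sup>2"

text \<open>Cauchy's formula at \<open>a\<close>, applied to \<open>G\<close> divided by
  \<open>1 - cnj a * \<zeta>\<close> and normalised to agree with \<open>G\<close> at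
  \<open>a\<close>. On the circle \<open>1 - cnj a * \<zeta>\<close> equals
  \<open>\<zeta> * cnj (\<zeta> - a)\<close>, which turns the Cauchy kernel into the Poisson
  kernel.\<close>

lemma circle_poisson_formula:
  assumes "continuous_on (cball 0 1) G" "G holomorphic_on ball 0 1" "cmod a < 1"
  shows "(\<integral>\<zeta>. of_real (poisson a \<zeta>) * G \<zeta> \<partial>circle_measure) = G a"
proof -
  have nz: "1 - cnj a * \<zeta> \<noteq> 0" if "cmod \<zeta> \<le> 1" for \<zeta>
  proof
    assume "1 - cnj a * \<zeta> = 0"
    then have "cmod (cnj a * \<zeta>) = 1" by simp
    moreover have "cmod (cnj a * \<zeta>) < 1"
      using that assms(3) by (simp add: norm_mult) (metis mult_le_one mult_left_le norm_ge_zero order_le_less_trans)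
    ultimately show False by simp
  qed
  define H where "H \<zeta> = G \<zeta> * of_real (1 - (cmod a)\<^sup>2) / (1 - cnj a * \<zeta>)" for \<zeta>
  have "(\<integral>\<zeta>. of_real (poisson a \<zeta>) * G \<zeta> \<partial>circle_measure) = (\<integral>\<zeta>. H \<zeta> * \<zeta> / (\<zeta> - a) \<partial>circle_measure)"
  proof (intro Bochner_Integration.integral_cong refl)
    fix \<zeta> assume "\<zeta> \<in> space circle_measure"
    then have z: "cmod \<zeta> = 1" by simp
    then have z2: "\<zeta> * cnj \<zeta> = 1" by (simp add: complex_norm_square[symmetric])
    have "\<zeta> \<noteq> 0" "\<zeta> \<noteq> a" using z assms(3) by auto
    have "1 - cnj a * \<zeta> = \<zeta> * cnj (\<zeta> - a)" using z2 by (simp add: algebra_simps)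
    moreover have "of_real ((cmod (\<zeta> - a))\<^sup>2) = (\<zeta> - a) * cnj (\<zeta> - a)"
      by (rule complex_norm_square)
    ultimately show "of_real (poisson a \<zeta>) * G \<zeta> = H \<zeta> * \<zeta> / (\<zeta> - a)"
      using \<open>\<zeta> \<noteq> 0\<close> \<open>\<zeta> \<noteq> a\<close> by (simp add: poisson_def H_def of_real_divide del: of_real_power) (simp add: field_simps)
  qed
  also have "\<dots> = H a"
    unfolding H_def using nz assms by (intro circle_cauchy_formula) (auto intro!: continuous_intros holomorphic_intros)
  also have "\<dots> = G a"
  proof -
    have "1 - cnj a * a = of_real (1 - (cmod a)\<^sup>2)"
      using complex_norm_square[of a] by (simp add: mult.commute)
    then show ?thesis using nz[of a] assms(3) by (simp add: H_def)
  qed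
  finally show ?thesis .
qed

text \<open>The shift by two keeps \<open>radius 0\<close> positive.\<close>

definition radius :: "nat \<Rightarrow> real" where
  "radius n = 1 - inverse (real (Suc (Suc n)))"

lemma radius_bounds: "0 < radius n" "radius n < 1"
  by (auto simp: radius_def field_simps)

lemma radius_tendsto: "radius \<longlonglongrightarrow> 1"
proof -
  have "(\<lambda>n. 1 - inverse (real (Suc (Suc n)))) \<longlonglongrightarrow> 1 - 0"
    by (intro tendsto_diff tendsto_const LIMSEQ_Suc[OF LIMSEQ_inverse_real_of_nat])
  then show ?thesis by (simp add: radius_def[abs_def])
qed

lemma radius_at_left: "filterlim radius (at_left 1) sequentially"
  using radius_tendsto radius_bounds
  by (auto simp: filterlim_at intro!: always_eventually) (metis less_irrefl)

lemma scale_in_ball: "0 < r \<Longrightarrow> r < 1 \<Longrightarrow> cmod z \<le> 1 \<Longrightarrow> of_real r * z \<in> ball 0 1"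
  by (simp add: norm_mult) (metis mult.right_neutral mult_le_cancel_left_pos order_le_less_trans)

lemma cnj_sgn_mult: "cnj (sgn z) * z = of_real (cmod z)"
  using complex_norm_square[of z]
  by (cases "z = 0") (simp_all add: sgn_eq field_simps power2_eq_square)


subsection \<open>A holomorphic majorant\<close>

text \<open>Since \<open>\<zeta> * cnj \<zeta> = 1\<close> on the circle, the product is a
  trigonometric polynomial, and under the real part its negative frequencies can be conjugated into
  positive ones. This makes the real parts of polynomials an algebra of functions on the
  circle.\<close>

lemma Re_mult_cnj_poly_on_circle:
  "\<exists>s. \<forall>\<zeta>\<in>sphere 0 1. Re (poly p \<zeta> * cnj (poly q \<zeta>)) = Re (poly s \<zeta>)"
proof (induction p arbitrary: q)
  case 0
  show ?case by (rule exI[of _ 0]) simp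
next
  case (pCons a p)
  obtain b q' where q: "q = pCons b q'" by (cases q)
  obtain s where s: "\<forall>\<zeta>\<in>sphere 0 1. Re (poly p \<zeta> * cnj (poly q' \<zeta>)) = Re (poly s \<zeta>)"
    using pCons.IH by blast
  show ?case
  proof (intro exI ballI)
    fix \<zeta> :: complex assume "\<zeta> \<in> sphere 0 1"
    then have z2: "\<zeta> * cnj \<zeta> = 1" by (simp add: complex_norm_square[symmetric])
    have "poly (pCons a p) \<zeta> * cnj (poly q \<zeta>) =
      a * cnj b + a * cnj (\<zeta> * poly q' \<zeta>) + cnj b * (\<zeta> * poly p \<zeta>) + (\<zeta> * cnj \<zeta>) * (poly p \<zeta> * cnj (poly q' \<zeta>))"
      by (simp add: q algebra_simps)
    also have "\<dots> = a * cnj b + a * cnj (\<zeta> * poly q' \<zeta>) + cnj b * (\<zeta> * poly p \<zeta>) + poly p \<zeta> * cnj (poly q' \<zeta>)"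
      by (simp only: z2 mult_1)
    finally have "Re (poly (pCons a p) \<zeta> * cnj (poly q \<zeta>)) =
      Re (a * cnj b) + Re (a * cnj (\<zeta> * poly q' \<zeta>)) + Re (cnj b * (\<zeta> * poly p \<zeta>)) + Re (poly s \<zeta>)"
      using s \<open>\<zeta> \<in> sphere 0 1\<close> by simp
    also have "Re (a * cnj (\<zeta> * poly q' \<zeta>)) = Re (cnj a * (\<zeta> * poly q' \<zeta>))"
      by (simp add: algebra_simps)
    also have "Re (a * cnj b) + Re (cnj a * (\<zeta> * poly q' \<zeta>)) + Re (cnj b * (\<zeta> * poly p \<zeta>)) + Re (poly s \<zeta>) =
      Re (a * cnj b + cnj a * (\<zeta> * poly q' \<zeta>) + cnj b * (\<zeta> * poly p \<zeta>) + poly s \<zeta>)"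
      by (simp only: plus_complex.sel)
    also have "a * cnj b + cnj a * (\<zeta> * poly q' \<zeta>) + cnj b * (\<zeta> * poly p \<zeta>) + poly s \<zeta> =
      poly ([:a * cnj b:] + smult (cnj a) (pCons 0 q') + smult (cnj b) (pCons 0 p) + s) \<zeta>"
      unfolding poly_add poly_smult poly_pCons by (simp add: distrib_left)
    finally show "Re (poly (pCons a p) \<zeta> * cnj (poly q \<zeta>)) =
      Re (poly ([:a * cnj b:] + smult (cnj a) (pCons 0 q') + smult (cnj b) (pCons 0 p) + s) \<zeta>)" .
  qed
qed

text \<open>Stone-Weierstrass for the real parts of polynomials. It takes the place of solving a
  Dirichlet problem, since the approximants come with a holomorphic extension to the disk.\<close>

lemma Re_poly_dense_on_circle:
  fixes u :: "complex \<Rightarrow> real"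
  assumes "continuous_on (sphere 0 1) u" "0 < e"
  obtains P :: "complex poly" where "\<And>\<zeta>. cmod \<zeta> = 1 \<Longrightarrow> \<bar>u \<zeta> - Re (poly P \<zeta>)\<bar> < e"
proof -
  define R where "R = {v :: complex \<Rightarrow> real. continuous_on (sphere 0 1) v \<and> (\<exists>P. \<forall>\<zeta>\<in>sphere 0 1. v \<zeta> = Re (poly P \<zeta>))}"
  interpret function_ring_on R "sphere 0 1 :: complex set"
  proof
    fix f g assume "f \<in> R" "g \<in> R"
    then obtain P Q where fg: "continuous_on (sphere 0 1) f" "continuous_on (sphere 0 1) g"
      and P: "\<forall>\<zeta>\<in>sphere 0 1. f \<zeta> = Re (poly P \<zeta>)" and Q: "\<forall>\<zeta>\<in>sphere 0 1. g \<zeta> = Re (poly Q \<zeta>)"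
      by (auto simp: R_def)
    show "(\<lambda>x. f x + g x) \<in> R"
      unfolding R_def using fg P Q by (auto intro!: continuous_intros exI[of _ "P + Q"])
    obtain s where s: "\<forall>\<zeta>\<in>sphere 0 1. Re (poly P \<zeta> * cnj (poly Q \<zeta>)) = Re (poly s \<zeta>)"
      using Re_mult_cnj_poly_on_circle by blast
    \<comment> \<open>Re P times Re Q is half the real part of P Q + P cnj Q.\<close>
    have "f \<zeta> * g \<zeta> = Re (poly (smult (1 / 2) (P * Q + s)) \<zeta>)" if "\<zeta> \<in> sphere 0 1" for \<zeta>
      using s that P Q by (simp add: field_simps)
    then show "(\<lambda>x. f x * g x) \<in> R"
      unfolding R_def using fg by (blast intro: continuous_intros)
  next
    fix c :: real
    show "(\<lambda>_. c) \<in> R" unfolding R_def by (auto intro!: exI[of _ "[:of_real c:]"])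
  next
    fix x y :: complex assume "x \<in> sphere 0 1" "y \<in> sphere 0 1" "x \<noteq> y"
    moreover have "Re \<in> R"
      unfolding R_def by (auto intro!: continuous_intros exI[of _ "[:0, 1:]"])
    moreover have "(\<lambda>z. Re (- \<i> * z)) \<in> R"
      unfolding R_def by (auto intro!: continuous_intros exI[of _ "[:0, - \<i>:]"])
    ultimately show "\<exists>f\<in>R. f x \<noteq> f y" by (auto simp: complex_eq_iff)
  qed (auto simp: R_def)
  from Stone_Weierstrass_basic[OF assms] obtain g where "g \<in> R" "\<forall>x\<in>sphere 0 1. \<bar>u x - g x\<bar> < e" ..
  then obtain P where "\<forall>\<zeta>\<in>sphere 0 1. \<bar>u \<zeta> - Re (poly P \<zeta>)\<bar> < e" unfolding R_def by force
  then show ?thesis by (intro that[of P]) auto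
qed

lemma circle_mean_Re_poly: "(\<integral>\<zeta>. Re (poly P \<zeta>) \<partial>circle_measure) = Re (poly P 0)"
proof -
  have "(\<integral>\<zeta>. poly P \<zeta> \<partial>circle_measure) = poly P 0"
    by (rule circle_mean_value) (auto intro!: continuous_intros holomorphic_intros)
  moreover have "integrable circle_measure (poly P)"
    by (intro integrable_circle_continuous continuous_intros)
  ultimately show ?thesis by (metis integral_Re)
qed

text \<open>
  Polynomials \<open>P n\<close> with \<open>Re (P n)\<close> close to \<open>|f|\<close> on the circle of radius \<open>radius n\<close> majorize \<open>|f|\<close> inside
  it; the functions \<open>1 / (P n + 2)\<close> are a normal family, and Hurwitz's theorem allows inverting the limit.
\<close>

lemma harmonic_majorant:
  fixes g h :: "complex \<Rightarrow> complex"
  assumes g: "g holomorphic_on ball 0 1" and h: "h holomorphic_on ball 0 1"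
  assumes K: "\<And>r. 0 < r \<Longrightarrow> r < 1 \<Longrightarrow> (\<integral>\<zeta>. cmod (g (of_real r * \<zeta>) + cnj (h (of_real r * \<zeta>))) \<partial>circle_measure) \<le> K"
  obtains H where "H holomorphic_on ball 0 1"
    "\<And>z. cmod z < 1 \<Longrightarrow> 1 + cmod (g z + cnj (h z)) \<le> Re (H z)"
proof -
  define f where "f z = g z + cnj (h z)" for z
  define r where "r = radius"
  have r: "0 < r n" "r n < 1" for n by (auto simp: r_def radius_bounds)
  have "r \<longlonglongrightarrow> 1" unfolding r_def by (rule radius_tendsto)
  have rz: "of_real (r n) * z \<in> ball 0 1" if "cmod z \<le> 1" for n z
    using r that by (rule scale_in_ball)
  have cg: "continuous_on (ball 0 1) g" "continuous_on (ball 0 1) h"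
    using g h by (auto intro: holomorphic_on_imp_continuous_on)
  have contf: "continuous_on (ball 0 1) f"
    unfolding f_def by (intro continuous_intros cg)
  have cf: "continuous_on (cball 0 1) (\<lambda>z. f (of_real (r n) * z))" for n
    by (rule continuous_on_compose2[OF contf]) (use rz in \<open>auto intro!: continuous_intros\<close>)
  have "\<exists>P. (\<forall>\<zeta>. cmod \<zeta> = 1 \<longrightarrow> \<bar>cmod (f (of_real (r n) * \<zeta>)) - Re (poly P \<zeta>)\<bar> < 1) \<and> Im (poly P 0) = 0" for n
  proof -
    have "continuous_on (sphere 0 1) (\<lambda>\<zeta>. cmod (f (of_real (r n) * \<zeta>)))"
      by (intro continuous_intros continuous_on_subset[OF cf]) auto
    from Re_poly_dense_on_circle[OF this zero_less_one] obtain P :: "complex poly"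
      where P: "\<And>\<zeta>. cmod \<zeta> = 1 \<Longrightarrow> \<bar>cmod (f (of_real (r n) * \<zeta>)) - Re (poly P \<zeta>)\<bar> < 1"
      by blast
    \<comment> \<open>Subtracting an imaginary constant leaves Re P alone and makes P real at 0, so
      that |P(0) + 2| can be read off from the real part.\<close>
    show ?thesis
      by (rule exI[of _ "P - [:\<i> * of_real (Im (poly P 0)):]"]) (use P in simp)
  qed
  then obtain P where P: "\<And>n \<zeta>. cmod \<zeta> = 1 \<Longrightarrow> \<bar>cmod (f (of_real (r n) * \<zeta>)) - Re (poly (P n) \<zeta>)\<bar> < 1"
    and P0: "\<And>n. Im (poly (P n) 0) = 0" by metis
  have maj: "cmod (f (of_real (r n) * z)) \<le> Re (poly (P n) z) + 1" if "cmod z < 1" for n z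
  proof -
    \<comment> \<open>This rotation makes f nonnegative at the given point. As Re (c cnj h) = Re
      (cnj c h), the real part of the holomorphic \<open>F\<close> is Re (c f) - Re P, and the
      maximum principle bounds |f| at that point.\<close>
    define c where "c = cnj (sgn (f (of_real (r n) * z)))"
    have c1: "cmod c \<le> 1" by (simp add: c_def norm_sgn)
    define F where "F w = c * g (of_real (r n) * w) + cnj c * h (of_real (r n) * w) - poly (P n) w" for w
    have ReF: "Re (F w) = Re (c * f (of_real (r n) * w)) - Re (poly (P n) w)" for w
      by (simp add: F_def f_def algebra_simps)
    have hol: "(\<lambda>w. g (of_real (r n) * w)) holomorphic_on ball 0 1" "(\<lambda>w. h (of_real (r n) * w)) holomorphic_on ball 0 1"
      by (intro holomorphic_on_compose_gen[OF _ g, unfolded o_def] holomorphic_on_compose_gen[OF _ h, unfolded o_def]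
         holomorphic_intros; use rz in force)+
    have con: "continuous_on (cball 0 1) (\<lambda>w. g (of_real (r n) * w))" "continuous_on (cball 0 1) (\<lambda>w. h (of_real (r n) * w))"
      by (rule continuous_on_compose2[OF cg(1)] continuous_on_compose2[OF cg(2)]; use rz in \<open>auto intro!: continuous_intros\<close>)+
    have "Re (F z) \<le> 1"
    proof (rule maximum_real_frontier[of F "ball 0 1"])
      show "F holomorphic_on interior (ball 0 1)"
        unfolding F_def using hol by (auto intro!: holomorphic_intros)
      show "continuous_on (closure (ball 0 1)) F"
        unfolding F_def using con by (auto intro!: continuous_intros)
      show "Re (F w) \<le> 1" if "w \<in> frontier (ball 0 1)" for w
      proof -
        have w: "cmod w = 1" using that by simp
        have "Re (c * f (of_real (r n) * w)) \<le> cmod (c * f (of_real (r n) * w))" by (rule complex_Re_le_cmod)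
        also have "\<dots> \<le> cmod (f (of_real (r n) * w))" using c1 by (simp add: norm_mult mult_left_le_one_le)
        finally show ?thesis using P[OF w, of n] by (simp add: ReF abs_less_iff)
      qed
    qed (use that in auto)
    moreover have "c * f (of_real (r n) * z) = of_real (cmod (f (of_real (r n) * z)))"
      by (simp add: c_def cnj_sgn_mult)
    ultimately show ?thesis by (simp add: ReF)
  qed
  have P0K: "Re (poly (P n) 0) \<le> K + 1" for n
  proof -
    have int: "integrable circle_measure (\<lambda>\<zeta>. cmod (f (of_real (r n) * \<zeta>)))"
      by (intro integrable_circle_continuous continuous_intros continuous_on_subset[OF cf]) auto
    have "Re (poly (P n) 0) = (\<integral>\<zeta>. Re (poly (P n) \<zeta>) \<partial>circle_measure)"
      by (rule circle_mean_Re_poly[symmetric])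
    also have "\<dots> \<le> (\<integral>\<zeta>. cmod (f (of_real (r n) * \<zeta>)) + 1 \<partial>circle_measure)"
    proof (rule integral_mono)
      show "integrable circle_measure (\<lambda>\<zeta>. Re (poly (P n) \<zeta>))"
        by (intro integrable_circle_continuous continuous_intros)
      show "integrable circle_measure (\<lambda>\<zeta>. cmod (f (of_real (r n) * \<zeta>)) + 1)"
        using int by simp
      show "Re (poly (P n) \<zeta>) \<le> cmod (f (of_real (r n) * \<zeta>)) + 1" if "\<zeta> \<in> space circle_measure" for \<zeta>
        using P[of \<zeta> n] that by (simp add: abs_less_iff)
    qed
    also have "\<dots> = (\<integral>\<zeta>. cmod (f (of_real (r n) * \<zeta>)) \<partial>circle_measure) + 1"
      using int by simp
    also have "\<dots> \<le> K + 1" using K[OF r, of n] by (simp add: f_def)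
    finally show ?thesis .
  qed
  \<comment> \<open>Of the 2, one unit pays for the approximation error and the other is the 1 in
    the majorant.\<close>
  have Re1: "1 \<le> Re (poly (P n) z + 2)" if "cmod z < 1" for n z
    using maj[OF that, of n] order_trans[OF norm_ge_zero maj[OF that, of n]] by simp
  \<comment> \<open>The polynomials are controlled only through their values at 0, but these
    inverses are bounded by 1, so Montel's theorem applies to them.\<close>
  define w where "w n z = inverse (poly (P n) z + 2)" for n z
  have nz: "poly (P n) z + 2 \<noteq> 0" if "cmod z < 1" for n z
    using Re1[OF that, of n] by (auto simp: complex_eq_iff)
  have whol: "w n holomorphic_on ball 0 1" for n
    unfolding w_def using nz by (intro holomorphic_intros) auto
  have wle: "cmod (w n z) \<le> 1" if "cmod z < 1" for n z
  proof -
    have "1 \<le> cmod (poly (P n) z + 2)" using Re1[OF that, of n] complex_Re_le_cmod order_trans by blast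
    then show ?thesis by (simp add: w_def norm_inverse inverse_le_1_iff)
  qed
  obtain W s where W: "W holomorphic_on ball 0 1" "strict_mono s"
      "\<And>x. x \<in> ball 0 1 \<Longrightarrow> (\<lambda>n. w (s n) x) \<longlonglongrightarrow> W x"
      "\<And>K. \<lbrakk>compact K; K \<subseteq> ball 0 1\<rbrakk> \<Longrightarrow> uniform_limit K (w \<circ> s) W sequentially"
  proof (rule Montel[of "ball 0 1" "range w" w])
    show "\<exists>B. \<forall>h\<in>range w. \<forall>z\<in>K. cmod (h z) \<le> B" if "compact K" "K \<subseteq> ball 0 1" for K
      using that wle by (intro exI[of _ 1]) (auto simp: subset_iff)
  qed (use whol in auto)
  \<comment> \<open>Here the bound on the means enters: Re P(0) <= K + 1 keeps the inverses at 0
    away from 0, so the limit is not identically zero and Hurwitz's theorem excludes all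
    zeros.\<close>
  have W0: "W 0 \<noteq> 0"
  proof -
    have "inverse (K + 3) \<le> cmod (w n 0)" for n
    proof -
      have "poly (P n) 0 + 2 = of_real (Re (poly (P n) 0) + 2)"
        using P0[of n] by (simp add: complex_eq_iff)
      then have "cmod (poly (P n) 0 + 2) = \<bar>Re (poly (P n) 0) + 2\<bar>" by (metis norm_of_real)
      then show ?thesis using Re1[of 0 n] P0K[of n]
        by (simp add: w_def norm_inverse le_imp_inverse_le)
    qed
    then have "inverse (K + 3) \<le> cmod (W 0)"
      by (intro tendsto_lowerbound[OF tendsto_norm[OF W(3)]]) auto
    moreover have "0 < inverse (K + 3)" using Re1[of 0 0] P0K[of 0] by simp
    ultimately show ?thesis by auto
  qed
  have Wnz: "W z \<noteq> 0" if "z \<in> ball 0 1" for z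
  proof (cases "W constant_on ball 0 1")
    case True
    then show ?thesis using W0 that unfolding constant_on_def by (metis centre_in_ball zero_less_one)
  next
    case False
    show ?thesis
      by (rule Hurwitz_no_zeros[of "ball 0 1" "w \<circ> s" W])
        (use W whol nz that False in \<open>auto simp: w_def\<close>)
  qed
  show ?thesis
  proof (rule that[of "\<lambda>z. inverse (W z)"])
    show "(\<lambda>z. inverse (W z)) holomorphic_on ball 0 1"
      using W(1) Wnz by (intro holomorphic_intros) auto
    fix z :: complex assume z: "cmod z < 1"
    have "(\<lambda>n. inverse (w (s n) z)) \<longlonglongrightarrow> inverse (W z)"
      using W(3) Wnz z by (intro tendsto_inverse) auto
    then have l1: "(\<lambda>n. Re (poly (P (s n)) z + 2)) \<longlonglongrightarrow> Re (inverse (W z))"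
      by (intro tendsto_Re) (simp add: w_def)
    have "(\<lambda>n. r (s n)) \<longlonglongrightarrow> 1"
      using LIMSEQ_subseq_LIMSEQ[OF \<open>r \<longlonglongrightarrow> 1\<close> W(2)] by (simp add: o_def)
    then have "(\<lambda>n. of_real (r (s n)) * z) \<longlonglongrightarrow> of_real 1 * z"
      by (intro tendsto_intros)
    then have l2: "(\<lambda>n. f (of_real (r (s n)) * z)) \<longlonglongrightarrow> f z"
      using contf z by (intro isCont_tendsto_compose[where g = f]) (auto simp: continuous_on_eq_continuous_at)
    have "1 + cmod (f z) \<le> Re (inverse (W z))"
    proof (rule LIMSEQ_le)
      show "(\<lambda>n. 1 + cmod (f (of_real (r (s n)) * z))) \<longlonglongrightarrow> 1 + cmod (f z)"
        using l2 by (intro tendsto_intros)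
      show "\<exists>N. \<forall>n\<ge>N. 1 + cmod (f (of_real (r (s n)) * z)) \<le> Re (poly (P (s n)) z + 2)"
        using maj[OF z] by (auto simp: algebra_simps)
    qed (rule l1)
    then show "1 + cmod (g z + cnj (h z)) \<le> Re (inverse (W z))" by (simp add: f_def)
  qed
qed


subsection \<open>The pointwise inequality\<close>

lemma sinh_ge_self: "x \<le> sinh x" if "0 \<le> x" for x :: real
proof -
  have "(\<lambda>x. sinh x - x) 0 \<le> (\<lambda>x. sinh x - x) x"
  proof (rule DERIV_nonneg_imp_nondecreasing[OF that])
    fix y :: real
    show "\<exists>D. ((\<lambda>x. sinh x - x) has_real_derivative D) (at y) \<and> 0 \<le> D"
      by (rule exI[of _ "cosh y - 1"]) (auto intro!: derivative_eq_intros simp: cosh_real_ge_1)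
  qed
  then show ?thesis by simp
qed

lemma cosh_ge_quadratic: "1 + v\<^sup>2 / 2 \<le> cosh v" for v :: real
proof -
  have "\<bar>v / 2\<bar> \<le> sinh \<bar>v / 2\<bar>"
    by (rule sinh_ge_self) simp
  then have "(v / 2)\<^sup>2 \<le> (sinh \<bar>v / 2\<bar>)\<^sup>2"
    by (metis abs_ge_zero power2_abs power_mono)
  also have "(sinh \<bar>v / 2\<bar>)\<^sup>2 = (sinh (v / 2))\<^sup>2"
    by (metis power2_abs sinh_real_abs abs_abs)
  finally have "(v / 2)\<^sup>2 \<le> (sinh (v / 2))\<^sup>2" .
  moreover have "cosh v = 1 + 2 * (sinh (v / 2))\<^sup>2"
    using cosh_double[of "v / 2"] cosh_square_eq[of "v / 2"] by simp
  ultimately show ?thesis by (simp add: power_divide)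
qed

lemma mult_cos_le_sin: "x * cos x \<le> sin x" if "0 \<le> x" "x \<le> pi" for x :: real
proof -
  have "(\<lambda>x. sin x - x * cos x) 0 \<le> (\<lambda>x. sin x - x * cos x) x"
  proof (rule DERIV_nonneg_imp_nondecreasing[OF that(1)])
    fix y :: real assume "0 \<le> y" "y \<le> x"
    then show "\<exists>D. ((\<lambda>x. sin x - x * cos x) has_real_derivative D) (at y) \<and> 0 \<le> D"
      using that by (intro exI[of _ "y * sin y"]) (auto intro!: derivative_eq_intros sin_ge_zero mult_nonneg_nonneg)
  qed
  then show ?thesis by simp
qed

text \<open>This is the monotonicity of sin x / x, cleared of denominators so that
  \<open>y = 0\<close> is included.\<close>

lemma sin_mult_antimono: "y * sin x \<le> x * sin y" if "0 \<le> y" "y \<le> x" "x \<le> pi" for x y :: real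
proof (cases "y = 0")
  case False
  then have "0 < y" using that by simp
  have "(\<lambda>x. sin x / x) x \<le> (\<lambda>x. sin x / x) y"
  proof (rule DERIV_nonpos_imp_nonincreasing[OF that(2)])
    fix z assume z: "y \<le> z" "z \<le> x"
    then show "\<exists>D. ((\<lambda>x. sin x / x) has_real_derivative D) (at z) \<and> D \<le> 0"
      using that \<open>0 < y\<close> mult_cos_le_sin[of z]
      by (intro exI[of _ "(z * cos z - sin z) / z\<^sup>2"])
        (auto intro!: derivative_eq_intros divide_nonpos_nonneg simp: power2_eq_square field_simps)
  qed
  then show ?thesis using that \<open>0 < y\<close> by (simp add: field_simps)
qed auto

lemma mult_sin_le_sin_mult: "q * sin x \<le> sin (q * x)" if "0 \<le> q" "q \<le> 1" "0 \<le> x" "x \<le> pi" for q x :: real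
proof (cases "x = 0")
  case False
  have "q * x * sin x \<le> x * sin (q * x)"
    by (rule sin_mult_antimono) (use that in \<open>auto intro: mult_left_le_one_le\<close>)
  then have "x * (q * sin x) \<le> x * sin (q * x)" by (simp add: ac_simps)
  then show ?thesis using False that by simp
qed auto

text \<open>Concavity of the sine on [0, pi]: the graph lies below its tangent at
  \<open>d\<close>.\<close>

lemma sin_diff_le: "sin (d - x) \<le> sin d - x * cos d" if "0 \<le> x" "x \<le> d" "d \<le> pi" for d x :: real
proof -
  have "(\<lambda>x. sin d - x * cos d - sin (d - x)) 0 \<le> (\<lambda>x. sin d - x * cos d - sin (d - x)) x"
  proof (rule DERIV_nonneg_imp_nondecreasing[OF that(1)])
    fix y :: real assume "0 \<le> y" "y \<le> x"
    then show "\<exists>D. ((\<lambda>x. sin d - x * cos d - sin (d - x)) has_real_derivative D) (at y) \<and> 0 \<le> D"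
      using that by (intro exI[of _ "cos (d - y) - cos d"]) (auto intro!: derivative_eq_intros cos_monotone_0_pi_le)
  qed
  then show ?thesis by simp
qed

lemma pi_bounds: "3.14 < pi" "pi < 3.15"
  using pi_approx by (auto simp: abs_if split: if_splits)

text \<open>The difference \<open>f\<close> of the two sides vanishes at 0 and at pi / 2. Its
  derivative is cos times \<open>g\<close>, and since sin x / x decreases, \<open>g\<close> is first
  nonnegative and then nonpositive. So \<open>f\<close> rises, then falls, and stays above its end
  values.\<close>

lemma mult_sin_add_cos_le:
  assumes "0 \<le> x" "x \<le> pi / 2"
  shows "x * sin x + cos x \<le> pi / 2 - (pi / 2 - 1) * (cos x)\<^sup>2"
proof -
  define f where "f x = pi / 2 - (pi / 2 - 1) * (cos x)\<^sup>2 - x * sin x - cos x" for x :: real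
  define g where "g x = (pi - 2) * sin x - x" for x :: real
  have f': "(f has_real_derivative cos y * g y) (at y)" for y
    unfolding f_def g_def by (auto intro!: derivative_eq_intros simp: algebra_simps)
  have "0 \<le> f x"
  proof (cases "0 \<le> g x")
    case True
    have "f 0 \<le> f x"
    proof (rule DERIV_nonneg_imp_nondecreasing[OF assms(1)])
      fix y assume y: "0 \<le> y" "y \<le> x"
      have "0 \<le> g y"
      proof (cases "x = 0")
        case False
        have "y * x \<le> (pi - 2) * (y * sin x)"
          using True y mult_left_mono[of x "(pi - 2) * sin x" y] by (simp add: g_def algebra_simps)
        also have "\<dots> \<le> (pi - 2) * (x * sin y)"
          using y assms pi_bounds by (intro mult_left_mono sin_mult_antimono) auto
        finally have "x * y \<le> x * ((pi - 2) * sin y)" by (simp add: ac_simps)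
        then show ?thesis using False assms by (simp add: g_def)
      qed (use y in \<open>simp add: g_def\<close>)
      then show "\<exists>D. (f has_real_derivative D) (at y) \<and> 0 \<le> D"
        using f' y assms by (intro exI[of _ "cos y * g y"]) (auto intro!: mult_nonneg_nonneg cos_ge_zero)
    qed
    then show ?thesis by (simp add: f_def)
  next
    case False
    have "f (pi / 2) \<le> f x"
    proof (rule DERIV_nonpos_imp_nonincreasing[OF assms(2)])
      fix y assume y: "x \<le> y" "y \<le> pi / 2"
      have "g y \<le> 0"
      proof (cases "y = 0")
        case F: False
        have "x > 0" using False assms by (cases "x = 0") (auto simp: g_def)
        have "(pi - 2) * (x * sin y) \<le> (pi - 2) * (y * sin x)"
          using y assms pi_bounds by (intro mult_left_mono sin_mult_antimono) auto
        also have "\<dots> = y * ((pi - 2) * sin x)" by simp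
        also have "\<dots> \<le> y * x"
          using False y assms by (intro mult_left_mono) (auto simp: g_def)
        finally have "x * ((pi - 2) * sin y) \<le> x * y" by (simp add: ac_simps)
        then show ?thesis using \<open>x > 0\<close> by (simp add: g_def)
      qed (simp add: g_def)
      then show "\<exists>D. (f has_real_derivative D) (at y) \<and> D \<le> 0"
        using f' y assms by (intro exI[of _ "cos y * g y"]) (auto intro!: mult_nonneg_nonpos cos_ge_zero)
    qed
    then show ?thesis by (simp add: f_def)
  qed
  then show ?thesis by (simp add: f_def)
qed

text \<open>In terms of E = exp (v / 2) and y = cos x the preceding bound reduces this to pi / 4 (E
  - 1 / E)^2 + (pi / 2 - 1) y^2 >= 2 (E - 1) y. For E <= 2 this follows by completing the square,
  for E > 2 by monotonicity in y.\<close>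

lemma half_pi_cosh_ge:
  fixes v x :: real
  assumes "0 \<le> v" "0 \<le> x" "x \<le> pi / 2"
  shows "x * sin x + (2 * exp (v / 2) - 1) * cos x \<le> pi / 2 * cosh v"
proof -
  define E where "E = exp (v / 2)"
  define y where "y = cos x"
  have E: "1 \<le> E" using assms by (simp add: E_def)
  have y: "0 \<le> y" "y \<le> 1" using assms by (auto simp: y_def intro: cos_ge_zero)
  have "exp v = E\<^sup>2"
    by (simp add: E_def power2_eq_square mult_exp_exp)
  moreover from this have "exp (- v) = (1 / E)\<^sup>2"
    by (simp add: exp_minus power_one_over inverse_eq_divide)
  ultimately have ch: "cosh v = 1 + (E - 1 / E)\<^sup>2 / 2"
    using E by (simp add: cosh_def power2_diff add_divide_distrib diff_divide_distrib)
  have "0 \<le> pi / 4 * (E - 1 / E)\<^sup>2 + (pi / 2 - 1) * y\<^sup>2 - 2 * (E - 1) * y"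
  proof (cases "E \<le> 2")
    case True
    define w where "w = E - 1"
    have "E - 1 / E = w * (1 + 1 / E)" using E by (simp add: w_def field_simps)
    moreover have "3 / 2 \<le> 1 + 1 / E" using E True by (simp add: field_simps)
    ultimately have "w * (3 / 2) \<le> E - 1 / E" using E mult_left_mono[of "3 / 2" "1 + 1 / E" w] by (simp add: w_def)
    then have "(w * (3 / 2))\<^sup>2 \<le> (E - 1 / E)\<^sup>2" using E by (intro power_mono) (auto simp: w_def)
    then have "pi / 4 * (w * (3 / 2))\<^sup>2 \<le> pi / 4 * (E - 1 / E)\<^sup>2" by (intro mult_left_mono) auto
    \<comment> \<open>883/500 and 57/100 are rational lower bounds of 9 pi / 16 and pi / 2 - 1 whose
      product exceeds 1, as the inequality between the means requires.\<close>
    moreover have "(883 / 500) * w\<^sup>2 \<le> pi / 4 * (w * (3 / 2))\<^sup>2"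
      using pi_bounds mult_right_mono[of "(883 / 500)" "pi * 9/16" "w\<^sup>2"] by (simp add: power_mult_distrib power_divide)
    moreover have "(57 / 100) * y\<^sup>2 \<le> (pi / 2 - 1) * y\<^sup>2"
      using pi_bounds by (intro mult_right_mono) auto
    moreover have "0 \<le> (883 / 500) * (w - y / (883 / 500))\<^sup>2" by simp
    then have "2 * w * y \<le> (883 / 500) * w\<^sup>2 + 500 / 883 * y\<^sup>2"
      by (simp add: power2_eq_square algebra_simps)
    then have "2 * w * y \<le> (883 / 500) * w\<^sup>2 + (57 / 100) * y\<^sup>2"
      using zero_le_power2[of y] by linarith
    ultimately have "2 * w * y \<le> pi / 4 * (E - 1 / E)\<^sup>2 + (pi / 2 - 1) * y\<^sup>2" by linarith
    then show ?thesis by (simp add: w_def)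
  next
    case False
    have *: "E\<^sup>2 - 2 \<le> (E - 1 / E)\<^sup>2" using E by (simp add: power2_diff)
    have "(157 / 200) * (E\<^sup>2 - 2) \<le> pi / 4 * (E - 1 / E)\<^sup>2"
    proof -
      have "(157 / 200) * (E\<^sup>2 - 2) \<le> (157 / 200) * (E - 1 / E)\<^sup>2" using * by simp
      also have "\<dots> \<le> pi / 4 * (E - 1 / E)\<^sup>2" using pi_bounds by (intro mult_right_mono) auto
      finally show ?thesis .
    qed
    \<comment> \<open>For E > 2 this expression decreases in y, so y = 1 is the worst case; what
      remains is a quadratic polynomial in E.\<close>
    moreover have "(pi / 2 - 1) * y\<^sup>2 - 2 * (E - 1) * y \<ge> (57 / 100) - 2 * (E - 1)"
    proof -
      have "(1 - y) * (2 * (E - 1) - (pi / 2 - 1) * (1 + y)) \<ge> 0"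
      proof (intro mult_nonneg_nonneg)
        have "(pi / 2 - 1) * (1 + y) \<le> (58 / 100) * 2" using pi_bounds y by (intro mult_mono) auto
        also have "\<dots> \<le> 2 * (E - 1)" using False by simp
        finally show "0 \<le> 2 * (E - 1) - (pi / 2 - 1) * (1 + y)" by simp
      qed (use y in auto)
      moreover have "(1 - y) * (2 * (E - 1) - k * (1 + y)) = 2 * (E - 1) - k + k * y\<^sup>2 - 2 * (E - 1) * y" for k
        by (simp add: algebra_simps power2_eq_square)
      ultimately show ?thesis using pi_bounds by simp
    qed
    moreover have "0 \<le> (157 / 200) * (E\<^sup>2 - 2) + (57 / 100) - 2 * (E - 1)"
    proof -
      have "0 \<le> (E - 2) * (157 / 200 * E - 43 / 100)" using False by (intro mult_nonneg_nonneg) auto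
      moreover have "(157 / 200) * (E\<^sup>2 - 2) + 57 / 100 - 2 * (E - 1) = (E - 2) * (157 / 200 * E - 43 / 100) + 14 / 100"
        by (simp add: field_simps power2_eq_square)
      ultimately show ?thesis by simp
    qed
    ultimately show ?thesis by linarith
  qed
  moreover have "x * sin x + y \<le> pi / 2 - (pi / 2 - 1) * y\<^sup>2"
    using mult_sin_add_cos_le[OF assms(2,3)] by (simp add: y_def)
  ultimately show ?thesis unfolding ch E_def[symmetric] y_def[symmetric]
    by (simp add: algebra_simps)
qed

lemma exp_mult_le_chord:
  fixes b v :: real
  assumes "0 \<le> b" "b \<le> 1 / 2"
  shows "exp (b * v) \<le> 1 + 2 * b * (exp (v / 2) - 1)"
proof -
  have "exp ((1 - 2 * b) *\<^sub>R 0 + (2 * b) *\<^sub>R (v / 2)) \<le> (1 - 2 * b) * exp 0 + 2 * b * exp (v / 2)"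
    using assms by (intro convex_onD[OF exp_convex]) auto
  then show ?thesis by (simp add: algebra_simps)
qed

text \<open>
  After bounding \<open>exp ((1 - q) v)\<close> by its chord in \<open>q\<close>, both sides are compared as functions that are
  linear in \<open>1 - q\<close>, so only the extreme values of \<open>q\<close> matter.
\<close>

lemma sin_mult_exp_le:
  fixes q v d :: real
  assumes q: "1 / 2 \<le> q" "q \<le> 1" and "0 \<le> v" and d: "0 \<le> d" "q * d \<le> pi / 2"
  shows "sin (q * d) * exp ((1 - q) * v) \<le> pi / 2 * (1 - q) * (cosh v - cos d) + q * sin d"
proof -
  define b where "b = 1 - q"
  define E where "E = exp (v / 2)"
  have b: "0 \<le> b" "b \<le> 1 / 2" "q = 1 - b" using q by (auto simp: b_def)
  have E: "1 \<le> E" using assms by (simp add: E_def)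
  have ex: "exp (b * v) \<le> 1 + 2 * b * (E - 1)"
    unfolding E_def by (rule exp_mult_le_chord) (use b in auto)
  have qd: "0 \<le> q * d" using q d by simp
  have sqd: "0 \<le> sin (q * d)" using d qd by (intro sin_ge_zero) auto
  have "d \<le> pi"
    using mult_right_mono[OF q(1) d(1)] d(2) by simp
  show ?thesis
  proof (cases "d \<le> pi / 2")
    case True
    \<comment> \<open>With x = pi / 2 - d. Multiplied by b = 1 - q this is exactly the surplus
      needed after the sine is replaced by its tangent and the exponential by its chord.\<close>
    have I1: "(pi / 2 - d) * cos d + (2 * E - 1) * sin d \<le> pi / 2 * cosh v"
      using half_pi_cosh_ge[OF \<open>0 \<le> v\<close>, of "pi / 2 - d"] True d
      by (simp add: E_def sin_diff cos_diff)
    have "q * d = d - b * d" by (simp add: b_def algebra_simps)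
    then have s1: "sin (q * d) \<le> sin d - b * d * cos d"
      using sin_diff_le[of "b * d" d] b d \<open>d \<le> pi\<close> by (simp add: mult_left_le_one_le)
    have s2: "sin (q * d) \<le> sin d"
      using True qd q d pi_gt_zero by (intro sin_monotone_2pi_le) (linarith, auto intro: mult_left_le_one_le)
    have "sin (q * d) * exp (b * v) \<le> sin (q * d) * (1 + 2 * b * (E - 1))"
      using ex sqd by (rule mult_left_mono)
    also have "\<dots> = sin (q * d) + 2 * b * (E - 1) * sin (q * d)" by (simp add: algebra_simps)
    also have "\<dots> \<le> (sin d - b * d * cos d) + 2 * b * (E - 1) * sin d"
      using s1 s2 b E by (intro add_mono mult_left_mono) auto
    also have "\<dots> \<le> pi / 2 * b * (cosh v - cos d) + q * sin d"
      using mult_left_mono[OF I1 b(1)] unfolding b(3) by argo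
    finally show ?thesis by (simp add: b_def)
  next
    case False
    define a where "a = d - pi / 2"
    have a: "0 \<le> a" "a \<le> pi / 2" "d = pi / 2 + a" using False \<open>d \<le> pi\<close> by (auto simp: a_def)
    have cd: "cos d = - sin a" "sin d = cos a" by (auto simp: a(3) cos_add sin_add)
    have I2: "2 * E - 1 \<le> pi / 2 * cosh v"
      using half_pi_cosh_ge[OF \<open>0 \<le> v\<close>, of 0] by (simp add: E_def)
    have a1: "1 - cos a \<le> a * sin a"
    proof -
      have "(\<lambda>x. x * sin x + cos x) 0 \<le> (\<lambda>x. x * sin x + cos x) a"
      proof (rule DERIV_nonneg_imp_nondecreasing[OF a(1)])
        fix y :: real assume "0 \<le> y" "y \<le> a"
        then show "\<exists>D. ((\<lambda>x. x * sin x + cos x) has_real_derivative D) (at y) \<and> 0 \<le> D"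
          using a by (intro exI[of _ "y * cos y"]) (auto intro!: derivative_eq_intros cos_ge_zero mult_nonneg_nonneg)
      qed
      then show ?thesis by simp
    qed
    have sa: "0 \<le> sin a" using a by (intro sin_ge_zero) auto
    have ca: "0 \<le> cos a" using a by (intro cos_ge_zero) auto
    \<comment> \<open>For obtuse \<open>d\<close> the sine is simply bounded by 1, and
      \<open>f b\<close> is the right side minus the resulting bound of the left. It is affine in
      \<open>b\<close>, and \<open>q * d \<le> pi / 2\<close> says that \<open>b\<close> is at least
      \<open>a / d\<close>, so the endpoints \<open>a / d\<close> and 1 / 2 suffice.\<close>
    define f where "f b = pi / 2 * b * (cosh v + sin a) + (1 - b) * cos a - 1 - 2 * b * (E - 1)" for b
    have f_lin: "f b = (cos a - 1) + b * (pi / 2 * (cosh v + sin a) - cos a - 2 * (E - 1))" for b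
      by (simp add: f_def algebra_simps)
    have sc: "1 \<le> pi / 2 * sin a + cos a"
    proof -
      have "(sin a)\<^sup>2 + (cos a)\<^sup>2 \<le> sin a + cos a"
        using sa ca by (intro add_mono) (simp_all add: power2_eq_square mult_left_le)
      moreover have "sin a \<le> pi / 2 * sin a" using sa pi_bounds mult_right_mono[of 1 "pi / 2" "sin a"] by simp
      ultimately show ?thesis by simp
    qed
    have f1: "0 \<le> f (1 / 2)" using I2 sc unfolding f_def by argo
    have f2: "0 \<le> f (a / d)"
    proof -
      have "d > 0" using a by (simp add: add_pos_nonneg)
      have "d * f (a / d) = a * (pi / 2 * (cosh v + sin a)) + (d - a) * cos a - d - 2 * a * (E - 1)"
        using \<open>d > 0\<close> by (simp add: f_def field_simps)
      also have "\<dots> = a * (pi / 2 * cosh v + 1 - 2 * E) + pi / 2 * (a * sin a - (1 - cos a))"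
        by (simp add: a(3) algebra_simps)
      also have "\<dots> \<ge> 0" using I2 a1 a by (intro add_nonneg_nonneg mult_nonneg_nonneg) auto
      finally show ?thesis using \<open>d > 0\<close> by (simp add: zero_le_mult_iff)
    qed
    have ba: "a / d \<le> b"
    proof -
      have "(1 - b) * d \<le> pi / 2" using d b by simp
      then have "a \<le> b * d" by (simp add: a_def algebra_simps)
      then show ?thesis using a by (simp add: divide_le_eq add_pos_nonneg)
    qed
    have "0 \<le> f b"
    proof (cases "0 \<le> pi / 2 * (cosh v + sin a) - cos a - 2 * (E - 1)")
      case True
      from mult_right_mono[OF ba True] f2 show ?thesis unfolding f_lin by linarith
    next
      case F: False
      from F mult_right_mono_neg[OF b(2), of "pi / 2 * (cosh v + sin a) - cos a - 2 * (E - 1)"] f1 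
      show ?thesis unfolding f_lin by linarith
    qed
    moreover have "sin (q * d) * exp (b * v) \<le> 1 * (1 + 2 * b * (E - 1))"
      using ex sqd by (intro mult_mono) auto
    ultimately show ?thesis by (simp add: f_def b(3) cd algebra_simps)
  qed
qed

text \<open>This serves the angles s > s0, with n = s - s0. After multiplication by exp (- (1 - q)
  v) the loss is at most (1 - q) v sin n, because 1 - exp (- x) <= x. The inequality between the
  means gives v sin n <= (v^2 + (sin n)^2) / 2 <= cosh v - cos n, and q sin n <= sin (q n)
  finishes.\<close>

lemma mult_exp_le_sin:
  fixes q v n :: real
  assumes q: "0 \<le> q" "q \<le> 1" and "0 \<le> v" and n: "0 \<le> n" "n \<le> pi / 2"
  shows "(q * sin n - pi / 2 * (1 - q) * (cosh v - cos n)) * exp ((1 - q) * v) \<le> sin (q * n)"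
proof -
  define b where "b = 1 - q"
  have b: "0 \<le> b" using q by (simp add: b_def)
  have sn: "0 \<le> sin n" using n by (intro sin_ge_zero) auto
  have c1: "(sin n)\<^sup>2 / 2 \<le> 1 - cos n"
  proof -
    have "0 \<le> (1 - cos n)\<^sup>2" by simp
    then show ?thesis by (simp add: sin_squared_eq power2_diff)
  qed
  have "v * sin n \<le> v\<^sup>2 / 2 + (sin n)\<^sup>2 / 2"
    using zero_le_power2[of "v - sin n"] by (simp add: power2_diff)
  also have "\<dots> \<le> cosh v - cos n" using c1 cosh_ge_quadratic[of v] by simp
  finally have vs: "v * sin n \<le> cosh v - cos n" .
  have "q * sin n * (1 - exp (- (b * v))) \<le> 1 * sin n * (b * v)"
    using exp_ge_add_one_self[of "- (b * v)"] q sn b \<open>0 \<le> v\<close> by (intro mult_mono mult_nonneg_nonneg) auto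
  also have "\<dots> = b * (v * sin n)" by simp
  also have "\<dots> \<le> 1 * (b * (cosh v - cos n))" using vs b by (simp add: mult_left_mono)
  also have "\<dots> \<le> pi / 2 * (b * (cosh v - cos n))"
    using pi_bounds b order_trans[OF mult_nonneg_nonneg[OF \<open>0 \<le> v\<close> sn] vs]
    by (intro mult_right_mono mult_nonneg_nonneg) auto
  finally have "q * sin n - pi / 2 * b * (cosh v - cos n) \<le> q * sin n * exp (- (b * v))"
    by argo
  then have "(q * sin n - pi / 2 * b * (cosh v - cos n)) * exp (b * v) \<le> q * sin n * exp (- (b * v)) * exp (b * v)"
    by (rule mult_right_mono) simp
  also have "\<dots> = q * sin n" by (simp add: mult.assoc flip: exp_add)
  also have "\<dots> \<le> sin (q * n)" using q n pi_bounds by (intro mult_sin_le_sin_mult) auto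
  finally show ?thesis by (simp add: b_def)
qed

text \<open>Concavity of the power, by Young's inequality. The value x = 0 has to be covered, since
  the base t + 1 / t - 2 cos s, to which this is applied, vanishes at t = 1, s = 0.\<close>

lemma powr_le_tangent:
  fixes x y q :: real
  assumes "0 \<le> x" "0 < y" "0 < q" "q \<le> 1"
  shows "x powr q \<le> y powr q + q * y powr (q - 1) * (x - y)"
proof (cases "x = 0")
  case True
  have "y powr (q - 1) * y = y powr q" using assms by (simp add: powr_diff)
  then have "y powr q + q * y powr (q - 1) * (0 - y) = (1 - q) * y powr q"
    unfolding mult.assoc right_diff_distrib by (simp add: algebra_simps)
  also have "\<dots> \<ge> 0" using assms by (intro mult_nonneg_nonneg) auto
  finally show ?thesis unfolding True by simp
next
  case False
  have "x powr q * y powr (1 - q) \<le> q * x + (1 - q) * y"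
    using Youngs_inequality_0[of q "1 - q" x y] assms False by simp
  then have "x powr q * y powr (1 - q) * y powr (q - 1) \<le> (q * x + (1 - q) * y) * y powr (q - 1)"
    by (rule mult_right_mono) simp
  also have "x powr q * y powr (1 - q) * y powr (q - 1) = x powr q"
    using assms by (simp add: mult.assoc flip: powr_add)
  also have "(q * x + (1 - q) * y) * y powr (q - 1) = y * y powr (q - 1) + q * y powr (q - 1) * (x - y)"
    by (simp add: algebra_simps)
  also have "y * y powr (q - 1) = y powr q" using assms by (simp add: powr_diff)
  finally show ?thesis .
qed

text \<open>
  Here \<open>t = |w| / |z|\<close> and \<open>s = \<pi> - |arg (z w)|\<close>; equality holds at \<open>t = r\<close>, \<open>s = s0\<close>, and the factor of
  \<open>cos (q s)\<close> is the one for which the derivative in \<open>s\<close> vanishes there. With \<open>t = r exp v\<close> the concave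
  power is replaced by its tangent, and the quotient of the bases at \<open>t\<close> and at \<open>r\<close> lies between
  \<open>exp (- |v|)\<close> and \<open>exp |v|\<close>.
\<close>

lemma ratio_inequality:
  fixes q r s t :: real
  defines "s0 \<equiv> pi / (2 * q)"
  defines "c \<equiv> - cos s0" and "S \<equiv> sin s0"
  assumes q: "1 / 2 \<le> q" "q < 1" and r: "0 < r" and t: "0 < t" and s: "0 \<le> s" "s \<le> pi"
  shows "(t + 1 / t - 2 * cos s) powr q + 2 * S * (r + 1 / r + 2 * c) powr (q - 1) * cos (q * s)
    \<le> (t + 1 / t + c * (r / t + t / r)) powr q"
proof -
  define a where "a = s0 - pi / 2"
  define d where "d = s0 - s"
  define v where "v = ln (t / r)"
  define Y where "Y = t + 1 / t + c * (r / t + t / r)"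
  define Y0 where "Y0 = r + 1 / r + 2 * c"
  \<comment> \<open>With X the base on the left side, 2 e = q (Y - X); so 2 e Y^(q - 1) is what the
    tangent at Y subtracts from Y^q.\<close>
  define e where "e = q * (c * (cosh v - cos d) + S * sin d)"
  have s0: "pi / 2 < s0" "s0 \<le> pi" using q by (auto simp: s0_def field_simps)
  have a: "0 < a" "a \<le> pi / 2" using s0 by (auto simp: a_def)
  have qs0: "q * s0 = pi / 2" using q by (simp add: s0_def)
  have c: "c = sin a" and S: "S = cos a"
    by (auto simp: c_def S_def a_def sin_diff cos_diff)
  have c0: "0 < c" unfolding c using a by (intro sin_gt_zero) auto
  have S0: "0 \<le> S" unfolding S using a by (intro cos_ge_zero) auto
  have cS: "a * S \<le> c" unfolding c S using a by (intro mult_cos_le_sin) auto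
  \<comment> \<open>This converts the factor pi / 2 (1 - q) of the two trigonometric lemmas into q
    a; then a S <= c brings in the constant c of the claim.\<close>
  have qa: "q * a = pi / 2 * (1 - q)" using qs0 by (simp add: a_def algebra_simps)
  have cosh_le: "cos x \<le> cosh y" for x y :: real
    using cos_le_one[of x] cosh_real_ge_1[of y] by linarith
  have tr: "0 < t / r" using t r by simp
  have ev: "exp v = t / r" "exp (- v) = r / t"
    using tr by (simp_all add: v_def exp_minus)
  have ch: "r / t + t / r = 2 * cosh v" unfolding cosh_def ev by (simp add: field_simps)
  have Ypos: "0 < Y" and Y0pos: "0 < Y0" using t r c0 by (auto simp: Y_def Y0_def add_pos_pos)
  have eabs: "exp (- \<bar>v\<bar>) \<le> t / r" "t / r \<le> exp \<bar>v\<bar>" "exp (- \<bar>v\<bar>) \<le> r / t" "r / t \<le> exp \<bar>v\<bar>"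
    "exp (- \<bar>v\<bar>) \<le> 1" "1 \<le> exp \<bar>v\<bar>"
    by (auto simp flip: ev)
  have tY: "t + 1 / t = (t / r) * r + (r / t) * (1 / r)" using t r by simp
  have Yle: "Y \<le> exp \<bar>v\<bar> * Y0"
  proof -
    have "cosh v \<le> exp \<bar>v\<bar>" by (simp add: cosh_def abs_if)
    then have "(t / r) * r + (r / t) * (1 / r) + c * (2 * cosh v) \<le>
      exp \<bar>v\<bar> * r + exp \<bar>v\<bar> * (1 / r) + c * (2 * exp \<bar>v\<bar>)"
      using eabs r c0 by (intro add_mono mult_mono mult_left_mono mult_right_mono) auto
    then show ?thesis unfolding Y_def Y0_def tY ch by (simp add: algebra_simps)
  qed
  have Yge: "exp (- \<bar>v\<bar>) * Y0 \<le> Y"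
  proof -
    have "exp (- \<bar>v\<bar>) \<le> cosh v" using eabs(5) cosh_real_ge_1[of v] by linarith
    then have "exp (- \<bar>v\<bar>) * r + exp (- \<bar>v\<bar>) * (1 / r) + c * (2 * exp (- \<bar>v\<bar>)) \<le>
      (t / r) * r + (r / t) * (1 / r) + c * (2 * cosh v)"
      using eabs r c0 by (intro add_mono mult_mono mult_left_mono mult_right_mono) auto
    then show ?thesis unfolding Y_def Y0_def tY ch by (simp add: algebra_simps)
  qed
  have Yp1: "exp (- ((1 - q) * \<bar>v\<bar>)) * Y0 powr (q - 1) \<le> Y powr (q - 1)"
  proof -
    have "(exp \<bar>v\<bar> * Y0) powr (q - 1) \<le> Y powr (q - 1)"
      using Ypos Yle q by (intro powr_mono2') auto
    then show ?thesis using Y0pos by (simp add: powr_mult powr_def[of "exp _"] algebra_simps)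
  qed
  have Yp2: "Y powr (q - 1) \<le> exp ((1 - q) * \<bar>v\<bar>) * Y0 powr (q - 1)"
  proof -
    have "Y powr (q - 1) \<le> (exp (- \<bar>v\<bar>) * Y0) powr (q - 1)"
      using Y0pos Yge q by (intro powr_mono2') auto
    then show ?thesis using Y0pos by (simp add: powr_mult powr_def[of "exp _"] algebra_simps)
  qed
  \<comment> \<open>The exponent q - 1 is negative. For d >= 0 the left side is nonnegative and the
    lower bound of Y^(q - 1) is used. For d < 0 only a negative \<open>e\<close> is critical, and
    then the upper bound is used.\<close>
  have main: "S * sin (q * d) * Y0 powr (q - 1) \<le> e * Y powr (q - 1)"
  proof (cases "0 \<le> d")
    case True
    have qd: "q * d \<le> pi / 2" using qs0 s q by (simp add: d_def right_diff_distrib)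
    have "q * d \<le> pi" using qd pi_gt_zero by linarith
    then have "0 \<le> sin (q * d)" using True q by (intro sin_ge_zero) auto
    have "S * (sin (q * d) * exp ((1 - q) * \<bar>v\<bar>)) \<le> S * (pi / 2 * (1 - q) * (cosh \<bar>v\<bar> - cos d) + q * sin d)"
      using q qd True S0 by (intro mult_left_mono sin_mult_exp_le) auto
    also have "\<dots> = q * ((a * S) * (cosh v - cos d) + S * sin d)"
      unfolding qa[symmetric] by (simp add: algebra_simps)
    also have "\<dots> \<le> e"
      unfolding e_def using cS cosh_le[of d v] q by (intro mult_left_mono add_right_mono mult_right_mono) auto
    finally have *: "S * sin (q * d) * exp ((1 - q) * \<bar>v\<bar>) \<le> e" by (simp add: mult.assoc)
    have "S * sin (q * d) * exp ((1 - q) * \<bar>v\<bar>) * (exp (- ((1 - q) * \<bar>v\<bar>)) * Y0 powr (q - 1)) \<le> e * Y powr (q - 1)"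
      using * Yp1 by (rule mult_mono) (use S0 \<open>0 \<le> sin (q * d)\<close> in \<open>auto intro!: order_trans[OF _ *]\<close>)
    also have "exp ((1 - q) * \<bar>v\<bar>) * exp (- ((1 - q) * \<bar>v\<bar>)) = 1"
      by (simp add: mult_exp_exp)
    then have "S * sin (q * d) * exp ((1 - q) * \<bar>v\<bar>) * (exp (- ((1 - q) * \<bar>v\<bar>)) * Y0 powr (q - 1)) = S * sin (q * d) * Y0 powr (q - 1)"
      by (metis mult.assoc mult.right_neutral)
    finally show ?thesis .
  next
    case False
    define n where "n = - d"
    have n: "0 \<le> n" "n \<le> pi / 2" using False s s0 by (auto simp: n_def d_def)
    have "0 \<le> sin (q * n)" using n q mult_left_le_one_le[of n q] by (intro sin_ge_zero) auto
    show ?thesis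
    proof (cases "0 \<le> e")
      case True
      have "S * sin (q * d) * Y0 powr (q - 1) \<le> 0"
        using \<open>0 \<le> sin (q * n)\<close> S0 by (intro mult_nonpos_nonneg mult_nonneg_nonpos) (auto simp: n_def)
      also have "0 \<le> e * Y powr (q - 1)" using True by simp
      finally show ?thesis .
    next
      case F: False
      have "- e = q * (S * sin n - c * (cosh v - cos n))"
        by (simp add: e_def n_def algebra_simps)
      also have "\<dots> \<le> q * (S * sin n - (a * S) * (cosh v - cos n))"
        using cS cosh_le[of n v] q by (intro mult_left_mono diff_left_mono mult_right_mono) auto
      also have "\<dots> = S * (q * sin n - pi / 2 * (1 - q) * (cosh \<bar>v\<bar> - cos n))"
        unfolding qa[symmetric] by (simp add: algebra_simps)
      finally have "- e * exp ((1 - q) * \<bar>v\<bar>) \<le> S * (q * sin n - pi / 2 * (1 - q) * (cosh \<bar>v\<bar> - cos n)) * exp ((1 - q) * \<bar>v\<bar>)"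
        by (rule mult_right_mono) simp
      also have "\<dots> \<le> S * sin (q * n)"
        using mult_left_mono[OF mult_exp_le_sin[of q "\<bar>v\<bar>" n] S0] q n by (simp only: mult.assoc)
      finally have *: "- e * exp ((1 - q) * \<bar>v\<bar>) \<le> S * sin (q * n)" .
      have "- e * Y powr (q - 1) \<le> - e * (exp ((1 - q) * \<bar>v\<bar>) * Y0 powr (q - 1))"
        using Yp2 F by (intro mult_left_mono) auto
      also have "\<dots> \<le> S * sin (q * n) * Y0 powr (q - 1)"
        unfolding mult.assoc[symmetric] using * by (rule mult_right_mono) simp
      finally show ?thesis by (simp add: n_def)
    qed
  qed
  have cs: "cos s = - c * cos d + S * sin d"
    using cos_diff[of s0 d] by (simp add: c_def S_def d_def)
  have "q * s = pi / 2 - q * d" using qs0 by (simp add: d_def algebra_simps)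
  then have cqs: "cos (q * s) = sin (q * d)" by (simp add: cos_diff)
  have X: "t + 1 / t - 2 * cos s = Y - 2 * (c * cosh v + cos s)"
    by (simp add: Y_def ch algebra_simps)
  have ee: "q * (2 * (c * cosh v + cos s)) = 2 * e" by (simp add: e_def cs algebra_simps)
  have "0 \<le> t + 1 / t - 2 * cos s"
  proof -
    have "2 \<le> t + 1 / t" using t zero_le_power2[of "t - 1"] by (simp add: field_simps power2_eq_square)
    then show ?thesis using cos_le_one[of s] by linarith
  qed
  then have "(t + 1 / t - 2 * cos s) powr q \<le> Y powr q + q * Y powr (q - 1) * ((t + 1 / t - 2 * cos s) - Y)"
    using Ypos q by (intro powr_le_tangent) auto
  also have "\<dots> = Y powr q - (q * (2 * (c * cosh v + cos s))) * Y powr (q - 1)"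
    unfolding X by (simp add: algebra_simps)
  also have "\<dots> = Y powr q - 2 * (e * Y powr (q - 1))" unfolding ee by simp
  also have "\<dots> \<le> Y powr q - 2 * (S * sin (q * d) * Y0 powr (q - 1))" using main by simp
  finally show ?thesis by (simp add: cqs Y_def Y0_def algebra_simps)
qed

text \<open>This is \<open>|z|^q cos (q (\<pi> - |arg z|))\<close>, which is subharmonic for \<open>0 < q \<le> 1\<close>.\<close>

definition sub_pow :: "real \<Rightarrow> complex \<Rightarrow> real" where
  "sub_pow q z = Re ((- z) powr of_real q)"

lemma sub_pow_eq: "sub_pow q z = cmod z powr q * cos (q * \<bar>Arg (- z)\<bar>)"
proof (cases "z = 0")
  case False
  then have "sub_pow q z = exp (q * ln (cmod z)) * cos (q * Arg (- z))"
    by (simp add: sub_pow_def powr_def Re_exp Arg_eq_Im_Ln)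
  also have "cos (q * Arg (- z)) = cos (q * \<bar>Arg (- z)\<bar>)"
    by (cases "0 \<le> Arg (- z)") auto
  finally show ?thesis using False by (simp add: powr_def)
qed (simp add: sub_pow_def)

section \<open>The eigenvalue equations and the reduction to a ratio and an angle\<close>

lemma cmod_add_cnj_sq: "(cmod (z + cnj w))\<^sup>2 = (cmod z)\<^sup>2 + (cmod w)\<^sup>2 + 2 * Re (z * w)"
  unfolding cmod_power2 by (simp add: power2_eq_square algebra_simps)

lemma cos_Arg: "z \<noteq> 0 \<Longrightarrow> cmod z * cos (Arg z) = Re z"
  by (metis Re_rcis rcis_cmod_Arg)

text \<open>Written with the square of cos (pi / p), the radicand is visibly nonnegative, so the
  square root in \<open>A_const\<close> is a genuine one.\<close>

lemma A_const_sq: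
  assumes "0 < b"
  shows "(A_const p b)\<^sup>2 = (1 + b + sqrt ((1 - b)\<^sup>2 + 4 * b * (cos (pi / p))\<^sup>2)) / (2 * b)"
    "0 < A_const p b"
proof -
  have cos2: "cos (2 * pi / p) = 2 * (cos (pi / p))\<^sup>2 - 1"
    using cos_double_cos[of "pi / p"] by simp
  have "1 + b\<^sup>2 + 2 * b * cos (2 * pi / p) = (1 - b)\<^sup>2 + 4 * b * (cos (pi / p))\<^sup>2"
    unfolding cos2 by (simp add: power2_eq_square algebra_simps)
  moreover have "0 \<le> sqrt ((1 - b)\<^sup>2 + 4 * b * (cos (pi / p))\<^sup>2)"
    using assms by simp
  ultimately show "(A_const p b)\<^sup>2 = (1 + b + sqrt ((1 - b)\<^sup>2 + 4 * b * (cos (pi / p))\<^sup>2)) / (2 * b)"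
    "0 < A_const p b"
    using assms by (simp_all add: A_const_def powr_half_sqrt add_pos_nonneg)
qed

text \<open>The last two equations say that (1, r) is an eigenvector, for the eigenvalue A^2, of the
  form x^2 + y^2 + 2 c x y relative to x^2 + b y^2. This is the origin of \<open>A_const\<close> and
  \<open>r_const\<close>: A^2 is the larger root of the characteristic equation (1 - x) (1 - b x) =
  c^2.\<close>

lemma A_const_eigen:
  assumes p: "1 \<le> p" "p < 2" and b: "0 < b"
  defines "c \<equiv> - cos (pi / p)" and "r \<equiv> r_const p b"
  shows "0 < c" "0 < r" "(A_const p b)\<^sup>2 = 1 + r * c" "(A_const p b)\<^sup>2 * b = 1 + c / r"
proof -
  define R where "R = sqrt ((1 - b)\<^sup>2 + 4 * b * c\<^sup>2)"
  have "pi / 2 < pi / p" "pi / p \<le> pi" using p by (auto simp: field_simps)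
  then have "cos (pi / p) < cos (pi / 2)" by (intro cos_monotone_0_pi) auto
  then show c: "0 < c" by (simp add: c_def)
  have cos2: "cos (2 * pi / p) = 2 * (cos (pi / p))\<^sup>2 - 1"
    using cos_double_cos[of "pi / p"] by simp
  have "1 + b\<^sup>2 + 2 * b * cos (2 * pi / p) = (1 - b)\<^sup>2 + 4 * b * c\<^sup>2"
    unfolding cos2 by (simp add: c_def power2_eq_square algebra_simps)
  then have r_eq: "r = (1 - b + R) / (2 * b * c)"
    using c b by (simp add: r_def r_const_def c_def R_def field_simps)
  have "\<bar>1 - b\<bar> < R"
    unfolding R_def using b c by (intro real_less_rsqrt) auto
  then have R: "0 < 1 - b + R" "0 < R" by linarith+
  then show r: "0 < r" using c b by (simp add: r_eq)
  have A: "(A_const p b)\<^sup>2 = (1 + b + R) / (2 * b)"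
    using A_const_sq(1)[OF b] by (simp add: R_def c_def)
  show "(A_const p b)\<^sup>2 = 1 + r * c"
    unfolding A r_eq using c b by (simp add: field_simps)
  have "R\<^sup>2 = (1 - b)\<^sup>2 + 4 * b * c\<^sup>2" using b by (simp add: R_def)
  then have "(1 - b + R) * (R + b - 1) = c * (4 * b * c)"
    by (simp add: power2_eq_square algebra_simps)
  then have c_r: "c / r = (R + b - 1) / 2"
    unfolding r_eq using c b R by (simp add: field_simps)
  show "(A_const p b)\<^sup>2 * b = 1 + c / r"
    unfolding A c_r using b by (simp add: field_simps)
qed

text \<open>Both sides are homogeneous. Division by (|z| |w|)^(p / 2) leaves the ratio
  \<open>t\<close> and the angle \<open>s\<close>, and the eigenvalue equations give the right side
  the shape it has in \<open>ratio_inequality\<close>. If z w = 0 one cannot divide, but then the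
  correction is 0, and A^2 and A^2 b are at least 1.\<close>

lemma pointwise_lt_2:
  fixes p b :: real and z w :: complex
  assumes p: "1 \<le> p" "p < 2" and b: "0 < b"
  defines "c \<equiv> - cos (pi / p)" and "r \<equiv> r_const p b"
  defines "D \<equiv> 2 * sin (pi / p) * (r + 1 / r + 2 * c) powr (p / 2 - 1)"
  shows "cmod (z + cnj w) powr p + D * sub_pow (p / 2) (z * w)
    \<le> A_const p b powr p * ((cmod z)\<^sup>2 + b * (cmod w)\<^sup>2) powr (p / 2)"
proof -
  define A where "A = A_const p b"
  define q where "q = p / 2"
  note eig = A_const_eigen[OF p b, folded c_def r_def, folded A_def]
  have A0: "0 < A" using A_const_sq(2)[OF b] by (simp add: A_def)
  have q: "1 / 2 \<le> q" "q < 1" using p by (auto simp: q_def)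
  have rhs: "A powr p * ((cmod z)\<^sup>2 + b * (cmod w)\<^sup>2) powr q = (A\<^sup>2 * (cmod z)\<^sup>2 + A\<^sup>2 * b * (cmod w)\<^sup>2) powr q"
  proof -
    have "A powr p = (A\<^sup>2) powr q" using A0 by (simp add: q_def powr_powr flip: powr_numeral)
    then show ?thesis using A0 b by (simp add: algebra_simps flip: powr_mult)
  qed
  have lhs: "cmod u powr p = ((cmod u)\<^sup>2) powr q" for u :: complex
    by (cases "u = 0") (simp_all add: q_def powr_powr flip: powr_numeral)
  have "cmod (z + cnj w) powr p + D * sub_pow q (z * w) \<le> (A\<^sup>2 * (cmod z)\<^sup>2 + A\<^sup>2 * b * (cmod w)\<^sup>2) powr q"
  proof (cases "z = 0 \<or> w = 0")
    case True
    have "1 \<le> A\<^sup>2" "1 \<le> A\<^sup>2 * b" using eig by simp_all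
    then have "(cmod (z + cnj w))\<^sup>2 \<le> A\<^sup>2 * (cmod z)\<^sup>2 + A\<^sup>2 * b * (cmod w)\<^sup>2"
      using True mult_right_mono[of 1 "A\<^sup>2" "(cmod z)\<^sup>2"] mult_right_mono[of 1 "A\<^sup>2 * b" "(cmod w)\<^sup>2"] by auto
    moreover have "sub_pow q (z * w) = 0" using True by (auto simp: sub_pow_def)
    ultimately show ?thesis unfolding lhs using q by (simp add: powr_mono2)
  next
    case False
    define x where "x = cmod z"
    define y where "y = cmod w"
    define t where "t = y / x"
    define s where "s = \<bar>Arg (- (z * w))\<bar>"
    have xy: "0 < x" "0 < y" using False by (auto simp: x_def y_def)
    then have t: "0 < t" by (simp add: t_def)
    have s: "0 \<le> s" "s \<le> pi" using Arg_le_pi[of "- (z * w)"] mpi_less_Arg[of "- (z * w)"]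
      by (auto simp: s_def abs_if)
    have xyc: "x * y * cos s = - Re (z * w)"
      using cos_Arg[of "- (z * w)"] False by (simp add: s_def x_def y_def norm_mult)
    have "(cmod (z + cnj w))\<^sup>2 = x\<^sup>2 + y\<^sup>2 - 2 * (x * y * cos s)"
      unfolding xyc by (simp add: cmod_add_cnj_sq x_def y_def)
    also have "\<dots> = (x * y) * (t + 1 / t - 2 * cos s)"
      using xy by (simp add: t_def power2_eq_square field_simps)
    finally have N: "(cmod (z + cnj w))\<^sup>2 = (x * y) * (t + 1 / t - 2 * cos s)" .
    have V: "A\<^sup>2 * x\<^sup>2 + A\<^sup>2 * b * y\<^sup>2 = (x * y) * (t + 1 / t + c * (r / t + t / r))"
      unfolding eig(4) unfolding eig(3) using xy eig(2) by (simp add: t_def power2_eq_square field_simps)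
    have sp: "sub_pow q (z * w) = (x * y) powr q * cos (q * s)"
      by (simp add: sub_pow_eq s_def norm_mult x_def y_def)
    have Nq: "(x * y * (t + 1 / t - 2 * cos s)) powr q = (x * y) powr q * (t + 1 / t - 2 * cos s) powr q"
      by (rule powr_mult)
    have "pi / (2 * q) = pi / p" by (simp add: q_def)
    then have "(t + 1 / t - 2 * cos s) powr q + D * cos (q * s) \<le> (t + 1 / t + c * (r / t + t / r)) powr q"
      using ratio_inequality[OF q eig(2) t s] by (simp add: c_def D_def q_def)
    then have "(x * y) powr q * ((t + 1 / t - 2 * cos s) powr q + D * cos (q * s)) \<le>
        (x * y) powr q * (t + 1 / t + c * (r / t + t / r)) powr q"
      by (rule mult_left_mono) simp
    also have "\<dots> = (A\<^sup>2 * x\<^sup>2 + A\<^sup>2 * b * y\<^sup>2) powr q"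
      unfolding V using xy t eig by (simp add: powr_mult)
    also have "(x * y) powr q * ((t + 1 / t - 2 * cos s) powr q + D * cos (q * s)) =
      ((cmod (z + cnj w))\<^sup>2) powr q + D * sub_pow q (z * w)"
      unfolding N sp Nq by (simp add: distrib_left)
    finally show ?thesis unfolding lhs by (simp add: x_def y_def)
  qed
  then show ?thesis unfolding A_def[symmetric] q_def[symmetric] rhs .
qed

text \<open>At p = 2 the cosine of pi / p is 0 and \<open>r_const\<close> loses its meaning. Here
  \<open>sub_pow 1\<close> is - Re, so the factor 2 removes the cross term of |z + cnj w|^2 exactly,
  and the square of \<open>A_const 2 b\<close> is the maximum of 1 and 1 / b.\<close>

lemma pointwise_2:
  fixes b :: real and z w :: complex
  assumes "0 < b"
  shows "(cmod (z + cnj w))\<^sup>2 + 2 * sub_pow 1 (z * w) \<le> (A_const 2 b)\<^sup>2 * ((cmod z)\<^sup>2 + b * (cmod w)\<^sup>2)"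
proof -
  have "1 \<le> (A_const 2 b)\<^sup>2" "1 \<le> (A_const 2 b)\<^sup>2 * b"
    unfolding A_const_sq(1)[OF assms] using assms by (auto simp: field_simps abs_if)
  from mult_right_mono[OF this(1) zero_le_power2, of "cmod z"] mult_right_mono[OF this(2) zero_le_power2, of "cmod w"]
  have "(cmod z)\<^sup>2 + (cmod w)\<^sup>2 \<le> (A_const 2 b)\<^sup>2 * ((cmod z)\<^sup>2 + b * (cmod w)\<^sup>2)"
    by (simp only: distrib_left mult_1 mult.assoc add_mono)
  moreover have "sub_pow 1 (z * w) = - Re (z * w)"
    by (cases "z * w = 0") (auto simp: sub_pow_def)
  ultimately show ?thesis by (simp add: cmod_add_cnj_sq)
qed

lemma pointwise_inequality:
  fixes p b :: real
  assumes p: "1 \<le> p" "p \<le> 2" and b: "0 < b"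
  obtains D where "0 \<le> D" "\<And>z w. cmod (z + cnj w) powr p + D * sub_pow (p / 2) (z * w)
    \<le> A_const p b powr p * ((cmod z)\<^sup>2 + b * (cmod w)\<^sup>2) powr (p / 2)"
proof (cases "p = 2")
  case True
  have "0 < A_const 2 b" using A_const_sq(2)[OF b] .
  then show ?thesis
    using pointwise_2[OF b] b by (intro that[of 2]) (simp_all add: True)
next
  case False
  then have "p < 2" using p by simp
  then show ?thesis
    using pointwise_lt_2[OF p(1) _ b] p
    by (intro that[of "2 * sin (pi / p) * (r_const p b + 1 / r_const p b + 2 * - cos (pi / p)) powr (p / 2 - 1)"])
      (auto intro!: mult_nonneg_nonneg sin_ge_zero simp: field_simps)
qed


subsection \<open>Subharmonicity of the correction term\<close>

text \<open>Among the branches of \<open>w powr q\<close> reachable from a given point, the principal one has the largest real part.\<close>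

lemma cos_mult_branch_le:
  fixes q \<theta> \<phi> :: real
  assumes q: "0 \<le> q" "q \<le> 1" and \<phi>: "- pi \<le> \<phi>" "\<phi> \<le> pi" and \<theta>: "\<bar>\<theta>\<bar> \<le> 2 * pi" and eq: "cis \<theta> = cis \<phi>"
  shows "cos (q * \<theta>) \<le> cos (q * \<phi>)"
proof -
  \<comment> \<open>The two cosines are cos (u + v) and cos (u - v) with u = q pi and v = q (pi -
    x), and both u and v have nonnegative sine.\<close>
  have key: "cos (q * (2 * pi - x)) \<le> cos (q * x)" if "0 \<le> x" "x \<le> pi" for x
  proof -
    have "q * pi \<le> pi" "q * (pi - x) \<le> pi"
      using q that mult_mono[of q 1 "pi - x" pi] by (auto simp: mult_left_le_one_le)
    then have "0 \<le> sin (q * pi) * sin (q * (pi - x))"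
      using q that by (intro mult_nonneg_nonneg sin_ge_zero) auto
    moreover have "cos (q * (2 * pi - x)) = cos (q * pi + q * (pi - x))" "cos (q * x) = cos (q * pi - q * (pi - x))"
      by (simp_all add: algebra_simps)
    ultimately show ?thesis by (simp add: cos_add cos_diff)
  qed
  have "cis (\<theta> - \<phi>) = 1" using eq by (simp add: cis_divide[symmetric])
  then have "cos (\<theta> - \<phi>) = 1" by (simp add: complex_eq_iff)
  then obtain k :: int where k: "\<theta> - \<phi> = of_int k * 2 * pi" by (auto simp: cos_one_2pi_int)
  \<comment> \<open>The two angles differ by at most 3 pi, which leaves only three branches.\<close>
  have "\<bar>of_int k :: real\<bar> * (2 * pi) < 2 * (2 * pi)"
  proof -
    have "\<bar>of_int k :: real\<bar> * (2 * pi) = \<bar>\<theta> - \<phi>\<bar>" by (simp add: k abs_mult)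
    also have "\<dots> < 2 * (2 * pi)" using \<phi> \<theta> pi_gt_zero by linarith
    finally show ?thesis .
  qed
  then have "\<bar>of_int k :: real\<bar> < 2" by (simp only: mult_less_cancel_right) auto
  then have "k = 0 \<or> k = 1 \<or> k = -1" by linarith
  then show ?thesis
  proof (elim disjE)
    assume "k = 0" then show ?thesis using k by simp
  next
    assume "k = 1"
    then have "\<theta> = 2 * pi - (- \<phi>)" "\<phi> \<le> 0" using k \<theta> by auto
    then show ?thesis using key[of "- \<phi>"] \<phi> by simp
  next
    assume "k = -1"
    then have "\<theta> = - (2 * pi - \<phi>)" "0 \<le> \<phi>" using k \<theta> by auto
    then show ?thesis using key[of "\<phi>"] \<phi> by (simp only: mult_minus_right cos_minus)
  qed
qed

text \<open>\<open>G\<close> continues the branch of (- w)^q from \<open>w1\<close> over the largest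
  ball that avoids 0. It leaves the principal branch only by crossing the positive axis, and there
  the principal branch has the larger real part. A harmonic function touching from below at every
  nonzero point is the form of subharmonicity that the maximum principle uses.\<close>

lemma sub_pow_harmonic_support:
  assumes q: "0 \<le> q" "q \<le> 1" and w1: "w1 \<noteq> 0"
  obtains G where "G holomorphic_on ball w1 (cmod w1)" "Re (G w1) = sub_pow q w1"
    "\<And>w. w \<in> ball w1 (cmod w1) \<Longrightarrow> Re (G w) \<le> sub_pow q w"
proof
  define G where "G w = (w / w1) powr of_real q * (- w1) powr of_real q" for w
  have Re_pos: "0 < Re (w / w1)" if "w \<in> ball w1 (cmod w1)" for w
  proof -
    have "cmod (w / w1 - 1) = cmod (w - w1) / cmod w1"
      using w1 by (simp add: divide_diff_eq_iff norm_divide)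
    also have "\<dots> < 1" using that w1 by (simp add: dist_norm norm_minus_commute)
    finally have "cmod (1 - w / w1) < 1" by (simp add: norm_minus_commute)
    then show ?thesis using complex_Re_le_cmod[of "1 - w / w1"] by simp
  qed
  have ndom: "w / w1 \<notin> \<real>\<^sub>\<le>\<^sub>0" if "w \<in> ball w1 (cmod w1)" for w
    using Re_pos[OF that] by (auto simp: complex_nonpos_Reals_iff)
  show "G holomorphic_on ball w1 (cmod w1)"
    unfolding G_def using w1 ndom by (intro holomorphic_intros) auto
  show "Re (G w1) = sub_pow q w1" using w1 by (simp add: G_def sub_pow_def)
  fix w assume w: "w \<in> ball w1 (cmod w1)"
  then have w0: "w \<noteq> 0" by (auto simp: dist_norm)
  define \<tau> where "\<tau> = Arg (w / w1)"
  define \<omega> where "\<omega> = Arg (- w1)"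
  define \<phi> where "\<phi> = Arg (- w)"
  have nz: "w / w1 \<noteq> 0" "- w1 \<noteq> 0" "- w \<noteq> 0" using w0 w1 by auto
  have "\<bar>\<tau>\<bar> < pi / 2"
    using Arg_Re_pos[of "w / w1"] Re_pos[OF w] nz by (simp add: \<tau>_def)
  moreover have "\<bar>\<omega>\<bar> \<le> pi" "- pi \<le> \<phi>" "\<phi> \<le> pi"
    using Arg_bounded[of "- w1"] Arg_bounded[of "- w"] by (auto simp: \<omega>_def \<phi>_def)
  moreover have "cis (\<tau> + \<omega>) = cis \<phi>"
  proof -
    have "cis (\<tau> + \<omega>) = sgn (w / w1) * sgn (- w1)"
      using nz by (simp add: \<tau>_def \<omega>_def cis_Arg flip: cis_mult)
    also have "\<dots> = sgn (w / w1 * - w1)" by (rule sgn_mult[symmetric])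
    also have "w / w1 * - w1 = - w" using w1 by simp
    also have "sgn (- w) = cis \<phi>" using nz by (simp add: \<phi>_def cis_Arg)
    finally show ?thesis .
  qed
  ultimately have "cos (q * (\<tau> + \<omega>)) \<le> cos (q * \<phi>)"
    using q by (intro cos_mult_branch_le) auto
  moreover have "G w = exp (of_real q * (Ln (w / w1) + Ln (- w1)))"
    using nz by (simp add: G_def powr_def distrib_left exp_add)
  then have "Re (G w) = exp (q * (ln (cmod (w / w1)) + ln (cmod (- w1)))) * cos (q * (\<tau> + \<omega>))"
    using nz by (simp add: Re_exp \<tau>_def \<omega>_def Arg_eq_Im_Ln)
  moreover have "ln (cmod (w / w1)) + ln (cmod (- w1)) = ln (cmod w)"
    using w0 w1 by (simp add: norm_divide ln_div)
  moreover have "sub_pow q w = exp (q * ln (cmod w)) * cos (q * \<phi>)"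
    using w0 nz by (simp add: sub_pow_def powr_def Re_exp \<phi>_def Arg_eq_Im_Ln)
  ultimately show "Re (G w) \<le> sub_pow q w" by simp
qed

lemma abs_sub_pow_le: "\<bar>sub_pow q z\<bar> \<le> cmod z powr q"
  unfolding sub_pow_eq by (simp add: abs_mult mult_left_le)

text \<open>The principal power jumps across its cut, but its real part involves only |Arg|, which
  off 0 is an arccosine and hence continuous; at 0 the modulus tends to 0.\<close>

lemma isCont_sub_pow:
  assumes "0 < q"
  shows "isCont (sub_pow q) z"
proof (cases "z = 0")
  case True
  have "(sub_pow q \<longlongrightarrow> 0) (at 0)"
  proof (rule Lim_null_comparison)
    show "\<forall>\<^sub>F z in at 0. norm (sub_pow q z) \<le> cmod z powr q"
      using abs_sub_pow_le by (auto intro!: always_eventually)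
    have "((\<lambda>z. cmod z powr q) \<longlongrightarrow> 0 powr q) (at 0)"
      using assms by (intro tendsto_powr' tendsto_norm_zero tendsto_const tendsto_ident_at) auto
    then show "((\<lambda>z. cmod z powr q) \<longlongrightarrow> 0) (at 0)" by simp
  qed
  then show ?thesis by (simp add: True isCont_def sub_pow_def)
next
  case False
  \<comment> \<open>Clamping to [-1, 1] changes no value off 0 and makes the continuity of arccos
    applicable.\<close>
  define F where "F z = cmod z powr q * cos (q * arccos (max (-1) (min 1 (- Re z / cmod z))))" for z
  have eq: "sub_pow q w = F w" if "w \<noteq> 0" for w
  proof -
    have "\<bar>Arg (- w)\<bar> = arccos (- Re w / cmod w)"
    proof -
      have "cos \<bar>Arg (- w)\<bar> = - Re w / cmod w"
        using cos_Arg[of "- w"] that by (simp add: field_simps)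
      then show ?thesis
        using Arg_bounded[of "- w"] by (metis arccos_cos abs_ge_zero abs_le_iff minus_le_iff less_imp_le)
    qed
    moreover have "\<bar>- Re w / cmod w\<bar> \<le> 1"
      using abs_Re_le_cmod[of w] that by (simp add: divide_le_eq)
    then have "max (-1) (min 1 (- Re w / cmod w)) = - Re w / cmod w" by linarith
    ultimately show ?thesis by (simp only: sub_pow_eq F_def)
  qed
  have "continuous_on (- {0}) F"
    unfolding F_def by (intro continuous_intros) auto
  then have "isCont F z" using False by (simp add: continuous_on_eq_continuous_at open_Compl)
  moreover have "\<forall>\<^sub>F w in nhds z. F w = sub_pow q w"
    using t1_space_nhds[OF False] by eventually_elim (simp add: eq)
  ultimately show ?thesis using isCont_cong by blast
qed

lemma continuous_on_sub_pow [continuous_intros]: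
  "0 < q \<Longrightarrow> continuous_on S f \<Longrightarrow> continuous_on S (\<lambda>x. sub_pow q (f x))"
  using continuous_on_compose2[OF continuous_at_imp_continuous_on[of UNIV "sub_pow q"]] isCont_sub_pow by blast

text \<open>
  Maximum principle for \<open>sub_pow q (k z) + \<eta> ln |k z| - Re (P z)\<close> with \<open>P\<close> a polynomial approximating the
  boundary values: the term with \<open>\<eta>\<close> keeps the maximum away from the zeros of \<open>k\<close>, where
  there is no harmonic support from below. At the point of the maximum set farthest from the origin the support
  function is constant, which contradicts the choice of that point unless it lies on the circle.
\<close>

lemma sub_pow_mean_nonneg_strict:
  assumes k: "continuous_on (cball 0 1) k" "k holomorphic_on ball 0 1" and q: "0 < q" "q \<le> 1"
    and k0: "Re (k 0) < 0"
  shows "0 \<le> (\<integral>\<zeta>. sub_pow q (k \<zeta>) \<partial>circle_measure)"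
proof -
  have "bounded (k ` cball 0 1)"
    by (intro compact_imp_bounded compact_continuous_image k) auto
  then obtain B where "\<forall>z\<in>cball 0 1. cmod (k z) \<le> B" by (auto simp: bounded_iff)
  then have B: "cmod (k z) \<le> B" if "cmod z \<le> 1" for z using that by auto
  have k0nz: "k 0 \<noteq> 0" using k0 by auto
  have csub: "continuous_on (cball 0 1) (\<lambda>z. sub_pow q (k z))"
    using q k by (intro continuous_intros) auto
  have isub: "integrable circle_measure (\<lambda>\<zeta>. sub_pow q (k \<zeta>))"
    by (intro integrable_circle_continuous continuous_on_subset[OF csub]) auto
  \<comment> \<open>As - k(0) lies in the right half-plane, its argument is below pi / 2 in modulus,
    and q <= 1 keeps the cosine nonnegative.\<close>
  have center: "0 \<le> sub_pow q (k 0)"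
  proof -
    have "\<bar>Arg (- k 0)\<bar> < pi / 2" using Arg_Re_pos[of "- k 0"] k0 k0nz by simp
    then have "q * \<bar>Arg (- k 0)\<bar> \<le> pi / 2"
      using q mult_mono[of q 1 "\<bar>Arg (- k 0)\<bar>" "pi / 2"] by simp
    then show ?thesis unfolding sub_pow_eq using q
      by (intro mult_nonneg_nonneg cos_ge_zero) (auto intro: order_trans[of _ 0])
  qed
  \<comment> \<open>One \<open>e\<close> is lost in the maximum principle, the other when the mean
    of Re P is compared with that of the boundary values.\<close>
  have "sub_pow q (k 0) \<le> (\<integral>\<zeta>. sub_pow q (k \<zeta>) \<partial>circle_measure) + 2 * e" if e: "0 < e" for e
  proof -
    have "continuous_on (sphere 0 1) (\<lambda>\<zeta>. sub_pow q (k \<zeta>))"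
      by (rule continuous_on_subset[OF csub]) auto
    from Re_poly_dense_on_circle[OF this e] obtain P :: "complex poly"
      where P: "\<And>\<zeta>. cmod \<zeta> = 1 \<Longrightarrow> \<bar>sub_pow q (k \<zeta>) - Re (poly P \<zeta>)\<bar> < e" by blast
    define u where "u z = sub_pow q (k z) - Re (poly P z)" for z
    have cu: "continuous_on (cball 0 1) u"
      unfolding u_def by (intro continuous_intros csub)
    then have "bounded (u ` cball 0 1)"
      by (intro compact_imp_bounded compact_continuous_image) auto
    then obtain C where "\<forall>z\<in>cball 0 1. \<bar>u z\<bar> \<le> C" by (auto simp: bounded_iff)
    then have C: "\<bar>u z\<bar> \<le> C" if "cmod z \<le> 1" for z using that by auto
    have v0: "u 0 + \<eta> * ln (cmod (k 0)) \<le> e + \<eta> * ln B" if \<eta>: "0 < \<eta>" for \<eta>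
    proof (rule ccontr)
      define v where "v z = u z + \<eta> * ln (cmod (k z))" for z
      assume "\<not> ?thesis"
      then have v0: "e + \<eta> * ln B < v 0" by (simp add: v_def)
      \<comment> \<open>The exponential gives C + \<eta> ln c <= v 0 - 1. Hence \<open>v\<close>
        lies below \<open>v 0\<close> wherever |k| = c, and its maximum over \<open>X\<close> is not
        attained there. The minimum with |k 0| keeps 0 in \<open>X\<close>.\<close>
      define c where "c = min (cmod (k 0)) (exp ((v 0 - C - 1) / \<eta>))"
      have c: "0 < c" "c \<le> cmod (k 0)" using k0nz by (auto simp: c_def)
      have "ln c \<le> ln (exp ((v 0 - C - 1) / \<eta>))"
        using c(1) by (intro ln_mono) (auto simp: c_def)
      then have lnc: "C + \<eta> * ln c < v 0" using \<eta> by (simp add: field_simps)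
      define X where "X = {z\<in>cball 0 1. c \<le> cmod (k z)}"
      have "compact X"
      proof -
        have "continuous_on (cball 0 1) (\<lambda>z. cmod (k z))" by (intro continuous_intros k)
        then have "closed (cball 0 1 \<inter> (\<lambda>z. cmod (k z)) -` {c..})"
          by (intro continuous_closed_preimage) auto
        then have "closed X" by (simp add: X_def vimage_def Int_def)
        moreover have "bounded X" by (rule bounded_subset[of "cball 0 1"]) (auto simp: X_def)
        ultimately show ?thesis by (simp add: compact_eq_bounded_closed)
      qed
      have "0 \<in> X" using c by (simp add: X_def)
      have cv: "continuous_on X v"
        unfolding v_def using c
        by (intro continuous_intros continuous_on_subset[OF cu] continuous_on_subset[OF k(1)]) (auto simp: X_def)
      obtain y where y: "y \<in> X" "\<And>z. z \<in> X \<Longrightarrow> v z \<le> v y"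
        using continuous_attains_sup[OF \<open>compact X\<close> _ cv] \<open>0 \<in> X\<close> by blast
      define M where "M = {z\<in>X. v z = v y}"
      have "compact M"
      proof -
        have "closed (X \<inter> v -` {v y})"
          by (intro continuous_closed_preimage cv compact_imp_closed \<open>compact X\<close>) auto
        then have "compact (X \<inter> (X \<inter> v -` {v y}))"
          by (intro compact_Int_closed \<open>compact X\<close>)
        moreover have "X \<inter> (X \<inter> v -` {v y}) = M" by (auto simp: M_def)
        ultimately show ?thesis by simp
      qed
      moreover have "M \<noteq> {}" using y by (auto simp: M_def)
      ultimately obtain z1 where z1: "z1 \<in> M" "\<And>z. z \<in> M \<Longrightarrow> cmod z \<le> cmod z1"
        using continuous_attains_sup[of M cmod] by (auto intro: continuous_intros)
      have vz1: "v 0 \<le> v z1" and vmax: "\<And>z. z \<in> X \<Longrightarrow> v z \<le> v z1"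
        using z1(1) y \<open>0 \<in> X\<close> by (auto simp: M_def)
      have z1X: "cmod z1 \<le> 1" "c \<le> cmod (k z1)" using z1(1) by (auto simp: M_def X_def)
      have "c < cmod (k z1)"
      proof (rule ccontr)
        assume "\<not> c < cmod (k z1)"
        then have "cmod (k z1) = c" using z1X by simp
        then have "v z1 \<le> C + \<eta> * ln c" using C[OF z1X(1)] by (simp add: v_def)
        then show False using lnc vz1 by simp
      qed
      have "cmod z1 \<noteq> 1"
      proof
        assume *: "cmod z1 = 1"
        have "0 < cmod (k z1)" using c z1X by linarith
        then have "ln (cmod (k z1)) \<le> ln B" using B[OF z1X(1)] by (intro ln_mono) auto
        then have "v z1 < e + \<eta> * ln B"
          using P[OF *] mult_left_mono[OF _ less_imp_le[OF \<eta>], of "ln (cmod (k z1))" "ln B"]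
          by (simp add: v_def u_def abs_less_iff)
        then show False using v0 vz1 by simp
      qed
      then have z1b: "z1 \<in> ball 0 1" using z1X by simp
      have kz1: "k z1 \<noteq> 0" using c z1X by auto
      obtain G where G: "G holomorphic_on ball (k z1) (cmod (k z1))" "Re (G (k z1)) = sub_pow q (k z1)"
          "\<And>w. w \<in> ball (k z1) (cmod (k z1)) \<Longrightarrow> Re (G w) \<le> sub_pow q w"
        using sub_pow_harmonic_support[of q "k z1"] q kz1 by auto
      have kc: "isCont k z1"
        using k(2) z1b by (meson continuous_on_eq_continuous_at holomorphic_on_imp_continuous_on open_ball)
      have "\<forall>\<^sub>F z in nhds z1. z \<in> ball 0 1 \<and> k z \<in> ball (k z1) (cmod (k z1)) \<and> c < cmod (k z)"
      proof (intro eventually_conj)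
        show "\<forall>\<^sub>F z in nhds z1. z \<in> ball 0 1" using z1b by (intro eventually_nhds_in_open) auto
        have "(k \<longlongrightarrow> k z1) (nhds z1)" using kc by (simp add: isCont_def tendsto_at_iff_tendsto_nhds)
        then show "\<forall>\<^sub>F z in nhds z1. k z \<in> ball (k z1) (cmod (k z1))"
          by (rule topological_tendstoD) (use kz1 in auto)
        have "((\<lambda>z. cmod (k z)) \<longlongrightarrow> cmod (k z1)) (nhds z1)"
          by (intro tendsto_intros) fact
        then show "\<forall>\<^sub>F z in nhds z1. c < cmod (k z)"
          using \<open>c < cmod (k z1)\<close> by (rule order_tendstoD(1))
      qed
      then obtain d where d: "0 < d" "\<And>z. z \<in> ball z1 d \<Longrightarrow> z \<in> ball 0 1 \<and> k z \<in> ball (k z1) (cmod (k z1)) \<and> c < cmod (k z)"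
        unfolding eventually_nhds_metric by (auto simp: dist_commute)
      have kquot: "k z / k z1 \<notin> \<real>\<^sub>\<le>\<^sub>0" "k z \<noteq> 0" if "z \<in> ball z1 d" for z
      proof -
        have "cmod (1 - k z / k z1) * cmod (k z1) = cmod (k z1 - k z)"
          using kz1 by (simp add: left_diff_distrib flip: norm_mult)
        also have "\<dots> < 1 * cmod (k z1)" using d(2)[OF that] by (simp add: dist_norm)
        finally have "cmod (1 - k z / k z1) < 1" using kz1 by (simp only: mult_less_cancel_right) auto
        then have "0 < Re (k z / k z1)" using complex_Re_le_cmod[of "1 - k z / k z1"] by simp
        then show "k z / k z1 \<notin> \<real>\<^sub>\<le>\<^sub>0" "k z \<noteq> 0" by (auto simp: complex_nonpos_Reals_iff)
      qed
      \<comment> \<open>Near \<open>z1\<close> the quotient k / k z1 has positive real part, so this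
        logarithm is holomorphic. Re W is at most \<open>v\<close> and equals it at
        \<open>z1\<close>.\<close>
      define W where "W z = G (k z) + of_real \<eta> * (Ln (k z / k z1) + of_real (ln (cmod (k z1)))) - poly P z" for z
      have khol: "k holomorphic_on ball z1 d" using d by (intro holomorphic_on_subset[OF k(2)]) auto
      have "W holomorphic_on ball z1 d"
        unfolding W_def using khol kquot kz1
        by (intro holomorphic_intros holomorphic_on_compose_gen[OF khol G(1), unfolded o_def]) (use d in auto)
      then have "(\<lambda>z. exp (W z)) holomorphic_on ball z1 d" by (intro holomorphic_intros)
      have ReW: "Re (W z) = Re (G (k z)) + \<eta> * ln (cmod (k z)) - Re (poly P z)" if "z \<in> ball z1 d" for z
        using kquot[OF that] kz1 by (simp add: W_def norm_divide ln_div)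
      have W_le: "Re (W z) \<le> v z" if "z \<in> ball z1 d" for z
        using ReW[OF that] G(3)[of "k z"] d(2)[OF that] by (simp add: v_def u_def)
      have inX: "z \<in> X" if "z \<in> ball z1 d" for z
        using d(2)[OF that] by (auto simp: X_def)
      have W1: "Re (W z1) = v z1" using ReW[of z1] d(1) G(2) by (simp add: v_def u_def)
      \<comment> \<open>Since Re W <= v <= v z1 = Re (W z1) on the ball, the modulus of exp W has an
        interior maximum. Constancy forces v = v z1 on the ball, so the ball lies in
        \<open>M\<close>, although it contains points farther from 0 than \<open>z1\<close>.\<close>
      have "(\<lambda>z. exp (W z)) constant_on ball z1 d"
      proof (rule maximum_modulus_principle[of _ _ "ball z1 d" z1])
        show "cmod (exp (W z)) \<le> cmod (exp (W z1))" if "z \<in> ball z1 d" for z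
          using W_le[OF that] vmax[OF inX[OF that]] by (simp add: W1)
      qed (use d \<open>(\<lambda>z. exp (W z)) holomorphic_on ball z1 d\<close> in auto)
      then obtain a where a: "\<And>z. z \<in> ball z1 d \<Longrightarrow> exp (W z) = a" by (auto simp: constant_on_def)
      have ReWc: "Re (W z) = v z1" if "z \<in> ball z1 d" for z
      proof -
        have "cmod (exp (W z)) = cmod (exp (W z1))" using a[OF that] a[of z1] d(1) by simp
        then show ?thesis by (simp add: W1)
      qed
      \<comment> \<open>The outward radial direction; from the origin any direction will do.\<close>
      define t where "t = (if z1 = 0 then 1 else sgn z1)"
      have t: "cmod t = 1" by (simp add: t_def norm_sgn)
      define z2 where "z2 = z1 + of_real (d / 2) * t"
      have z2: "z2 \<in> ball z1 d" using t d(1) by (simp add: z2_def dist_norm norm_mult)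
      have "z1 = of_real (cmod z1) * t" by (simp add: t_def sgn_eq)
      then have "z2 = of_real (cmod z1 + d / 2) * t" by (simp add: z2_def algebra_simps)
      then have "cmod z2 = \<bar>cmod z1 + d / 2\<bar>" using t by (simp only: norm_mult norm_of_real) simp
      then have "cmod z1 < cmod z2" using d(1) by simp
      moreover have "z2 \<in> M"
        using inX[OF z2] W_le[OF z2] ReWc[OF z2] vmax[OF inX[OF z2]] z1(1) by (simp add: M_def)
      ultimately show False using z1(2)[of z2] by simp
    qed
    \<comment> \<open>Letting \<eta> tend to 0 removes both logarithms; the one at the origin is a
      finite number because k does not vanish there.\<close>
    have "u 0 \<le> e"
    proof (rule tendsto_lowerbound)
      show "((\<lambda>\<eta>. e + \<eta> * ln B - \<eta> * ln (cmod (k 0))) \<longlongrightarrow> e) (at_right 0)"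
        by (auto intro!: tendsto_eq_intros)
      show "\<forall>\<^sub>F \<eta> in at_right 0. u 0 \<le> e + \<eta> * ln B - \<eta> * ln (cmod (k 0))"
        using eventually_at_right_less[of 0] by eventually_elim (use v0 in \<open>simp add: algebra_simps\<close>)
    qed simp
    then have "sub_pow q (k 0) \<le> Re (poly P 0) + e" by (simp add: u_def)
    also have "Re (poly P 0) = (\<integral>\<zeta>. Re (poly P \<zeta>) \<partial>circle_measure)" by (rule circle_mean_Re_poly[symmetric])
    also have "\<dots> \<le> (\<integral>\<zeta>. sub_pow q (k \<zeta>) + e \<partial>circle_measure)"
    proof (rule integral_mono)
      show "integrable circle_measure (\<lambda>\<zeta>. Re (poly P \<zeta>))"
        by (intro integrable_circle_continuous continuous_intros)
      show "integrable circle_measure (\<lambda>\<zeta>. sub_pow q (k \<zeta>) + e)" using isub by simp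
      show "Re (poly P \<zeta>) \<le> sub_pow q (k \<zeta>) + e" if "\<zeta> \<in> space circle_measure" for \<zeta>
        using P[of \<zeta>] that by (simp add: abs_less_iff)
    qed
    also have "\<dots> = (\<integral>\<zeta>. sub_pow q (k \<zeta>) \<partial>circle_measure) + e" using isub by simp
    finally show ?thesis by simp
  qed
  then have "sub_pow q (k 0) \<le> (\<integral>\<zeta>. sub_pow q (k \<zeta>) \<partial>circle_measure) + e" if "0 < e" for e
    using that by (metis half_gt_zero mult_2 field_sum_of_halves)
  then have "sub_pow q (k 0) \<le> (\<integral>\<zeta>. sub_pow q (k \<zeta>) \<partial>circle_measure)" by (rule field_le_epsilon)
  then show ?thesis using center by simp
qed

text \<open>Subtracting 1 / (n + 1) from \<open>k\<close> makes the real part at 0 strictly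
  negative, in particular \<open>k 0\<close> nonzero, as the logarithmic term requires. The
  correction term is continuous and stays bounded along the sequence, so the means converge.\<close>

lemma sub_pow_mean_nonneg:
  assumes k: "continuous_on (cball 0 1) k" "k holomorphic_on ball 0 1" and q: "0 < q" "q \<le> 1"
    and k0: "Re (k 0) \<le> 0"
  shows "0 \<le> (\<integral>\<zeta>. sub_pow q (k \<zeta>) \<partial>circle_measure)"
proof -
  define K where "K n z = k z - of_real (inverse (real (Suc n)))" for n z
  have cK: "continuous_on (cball 0 1) (K n)" for n unfolding K_def by (intro continuous_intros k)
  have csub: "continuous_on (sphere 0 1) (\<lambda>z. sub_pow q (F z))" if "continuous_on (cball 0 1) F" for F
    by (rule continuous_on_subset[of "cball 0 1"]) (use q that in \<open>auto intro!: continuous_intros\<close>)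
  have "bounded (k ` cball 0 1)"
    by (intro compact_imp_bounded compact_continuous_image k) auto
  then obtain B where "\<forall>z\<in>cball 0 1. cmod (k z) \<le> B" by (auto simp: bounded_iff)
  then have B: "cmod (k z) \<le> B" if "cmod z \<le> 1" for z using that by auto
  have "(\<lambda>n. \<integral>\<zeta>. sub_pow q (K n \<zeta>) \<partial>circle_measure) \<longlonglongrightarrow> (\<integral>\<zeta>. sub_pow q (k \<zeta>) \<partial>circle_measure)"
  proof (rule integral_dominated_convergence[where w = "\<lambda>_. (B + 1) powr q"])
    show "AE \<zeta> in circle_measure. (\<lambda>n. sub_pow q (K n \<zeta>)) \<longlonglongrightarrow> sub_pow q (k \<zeta>)"
    proof (intro AE_I2)
      fix \<zeta>
      have "(\<lambda>n. of_real (inverse (real (Suc n))) :: complex) \<longlonglongrightarrow> of_real 0"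
        by (intro tendsto_of_real LIMSEQ_inverse_real_of_nat)
      then have "(\<lambda>n. K n \<zeta>) \<longlonglongrightarrow> k \<zeta> - of_real 0" unfolding K_def by (intro tendsto_diff tendsto_const)
      then show "(\<lambda>n. sub_pow q (K n \<zeta>)) \<longlonglongrightarrow> sub_pow q (k \<zeta>)"
        using isCont_tendsto_compose[OF isCont_sub_pow[OF q(1)]] by simp
    qed
    show "AE \<zeta> in circle_measure. norm (sub_pow q (K n \<zeta>)) \<le> (B + 1) powr q" for n
    proof (intro AE_I2)
      fix \<zeta> assume "\<zeta> \<in> space circle_measure"
      then have "cmod (k \<zeta>) \<le> B" using B by simp
      moreover have "cmod (of_real (inverse (real (Suc n))) :: complex) \<le> 1"
        unfolding norm_of_real by (simp add: field_simps)
      ultimately have "cmod (K n \<zeta>) \<le> B + 1"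
        unfolding K_def using norm_triangle_ineq4 order_trans add_mono by meson
      then have "cmod (K n \<zeta>) powr q \<le> (B + 1) powr q" using q by (intro powr_mono2) auto
      then show "norm (sub_pow q (K n \<zeta>)) \<le> (B + 1) powr q" using abs_sub_pow_le[of q "K n \<zeta>"] by simp
    qed
  qed (auto intro!: borel_measurable_circle_continuous csub cK k)
  moreover have "0 \<le> (\<integral>\<zeta>. sub_pow q (K n \<zeta>) \<partial>circle_measure)" for n
  proof (rule sub_pow_mean_nonneg_strict[OF cK _ q])
    show "K n holomorphic_on ball 0 1" unfolding K_def by (intro holomorphic_intros k)
    have "0 < inverse (real (Suc n))" by simp
    then show "Re (K n 0) < 0" using k0 unfolding K_def minus_complex.sel Re_complex_of_real by linarith
  qed
  ultimately show ?thesis by (intro LIMSEQ_le_const) auto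
qed


subsection \<open>The radial maximal function\<close>

lemma integral_circle_symmetric:
  fixes g :: "real \<Rightarrow> real"
  assumes "continuous_on {0..2 * pi} g"
  shows "integral {0..2 * pi} g = integral {0..pi} (\<lambda>t. g t + g (2 * pi - t))"
proof -
  have i: "g integrable_on {0..2 * pi}" using assms by (rule integrable_continuous_real)
  have i1: "g integrable_on {0..pi}" "g integrable_on {pi..2 * pi}"
    by (rule integrable_subinterval_real[OF i], simp)+
  have "((\<lambda>x. g (x + 2 * pi)) has_integral integral {pi..2 * pi} g) {pi - 2 * pi..2 * pi - 2 * pi}"
    by (intro has_integral_shift_real_ivl integrable_integral i1)
  then have "((\<lambda>x. g (x + 2 * pi)) has_integral integral {pi..2 * pi} g) {- pi..- 0}" by simp
  moreover have "(\<lambda>x. g (x + 2 * pi)) = (\<lambda>x. g (2 * pi - (- x)))" by (simp add: add.commute)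
  ultimately have *: "((\<lambda>x. g (2 * pi - x)) has_integral integral {pi..2 * pi} g) {0..pi}"
    by (simp only: has_integral_reflect_real[of "\<lambda>x. g (2 * pi - x)"])
  have "integral {0..2 * pi} g = integral {0..pi} g + integral {pi..2 * pi} g"
    using Henstock_Kurzweil_Integration.integral_combine[of 0 pi "2 * pi" g] i by simp
  also have "\<dots> = integral {0..pi} (\<lambda>t. g t + g (2 * pi - t))"
    using has_integral_add[OF integrable_integral[OF i1(1)] *] by (simp add: integral_unique)
  finally show ?thesis .
qed

lemma poisson_real_cis: "poisson (of_real r) (cis t) = (1 - r\<^sup>2) / (1 - 2 * r * cos t + r\<^sup>2)"
proof -
  have "(cmod (cis t - of_real r))\<^sup>2 = (cos t - r)\<^sup>2 + (sin t)\<^sup>2"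
    by (simp add: cmod_power2)
  also have "\<dots> = ((sin t)\<^sup>2 + (cos t)\<^sup>2) - 2 * r * cos t + r\<^sup>2"
    by (simp only: power2_diff) simp
  finally show ?thesis by (simp add: poisson_def)
qed

text \<open>The Poisson kernel is even and radially decreasing, so integration by parts turns it into a mixture of interval averages.\<close>

lemma poisson_le_interval_averages:
  fixes u :: "real \<Rightarrow> real"
  assumes u: "continuous_on UNIV u" "\<And>x. u (x + 2 * pi) = u x" and r: "0 \<le> r" "r < 1"
    and bound: "\<And>h. 0 < h \<Longrightarrow> h \<le> pi \<Longrightarrow> integral {\<theta> - h..\<theta> + h} u \<le> 2 * h * L"
  shows "integral {0..2 * pi} (\<lambda>t. poisson (of_real r) (cis t) * u (\<theta> + t)) \<le> 2 * pi * L"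
proof -
  define K where "K t = (1 - r\<^sup>2) / (1 - 2 * r * cos t + r\<^sup>2)" for t
  have den: "0 < 1 - 2 * r * cos t + r\<^sup>2" for t
  proof -
    have "2 * r * cos t \<le> 2 * r" using r cos_le_one[of t] by (simp add: mult_left_le)
    moreover have "0 < (1 - r)\<^sup>2" using r by simp
    ultimately show ?thesis by (simp add: power2_diff)
  qed
  have r1: "0 \<le> 1 - r\<^sup>2" using r by (simp add: power_le_one)
  define K' where "K' t = - ((1 - r\<^sup>2) * (2 * r * sin t)) / (1 - 2 * r * cos t + r\<^sup>2)\<^sup>2" for t
  have dK: "(K has_real_derivative K' t) (at t within S)" for t S
    unfolding K_def K'_def using den[of t]
    by (auto intro!: derivative_eq_intros simp: power2_eq_square)
  have K0: "0 \<le> K t" for t using den[of t] r1 by (simp add: K_def)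
  have K'0: "K' t \<le> 0" if "0 \<le> t" "t \<le> pi" for t
    unfolding K'_def using that r r1 by (intro divide_nonpos_nonneg) (auto intro!: mult_nonneg_nonneg sin_ge_zero)
  have cK: "continuous_on S K" "continuous_on S K'" for S
    unfolding K_def K'_def using den by (auto intro!: continuous_intros simp: less_imp_neq[symmetric])
  have Ksym: "K (2 * pi - t) = K t" for t by (simp add: K_def cos_diff)
  have cu: "continuous_on S (\<lambda>t. u (f t))" if "continuous_on S f" for S and f :: "real \<Rightarrow> real"
    by (rule continuous_on_compose2[OF u(1) that]) auto
  have usym: "u (\<theta> + (2 * pi - t)) = u (\<theta> - t)" for t
    using u(2)[of "\<theta> - t"] by (simp add: algebra_simps)
  have J: "integral {0..2 * pi} (\<lambda>t. K t * u (\<theta> + t)) = integral {0..pi} (\<lambda>t. K t * (u (\<theta> + t) + u (\<theta> - t)))"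
    by (subst integral_circle_symmetric) (auto intro!: continuous_intros cK cu simp: Ksym usym distrib_left)
  have J1: "integral {0..pi} K = pi"
  proof -
    have "(\<integral>\<zeta>. complex_of_real (poisson (of_real r) \<zeta>) * 1 \<partial>circle_measure) = 1"
      using r by (intro circle_poisson_formula) auto
    then have "(\<integral>\<zeta>. poisson (of_real r) \<zeta> \<partial>circle_measure) = 1" by simp
    moreover have "continuous_on (sphere 0 1) (\<lambda>\<zeta>. poisson (of_real r) \<zeta>)"
      unfolding poisson_def using r by (auto intro!: continuous_intros)
    ultimately have "integral {0..2 * pi} (\<lambda>t. poisson (of_real r) (cis t)) /\<^sub>R (2 * pi) = 1"
      by (simp only: integral_circle_measure)
    then have "integral {0..2 * pi} K = 2 * pi"
      unfolding poisson_real_cis K_def[symmetric] by (simp add: field_simps)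
    moreover have "integral {0..2 * pi} K = integral {0..pi} (\<lambda>t. 2 * K t)"
      by (subst integral_circle_symmetric) (auto intro!: cK simp: Ksym)
    ultimately show ?thesis by simp
  qed
  \<comment> \<open>The half-length 4 exceeds pi, so the antiderivative has a two-sided derivative
    at every point within distance pi of \<theta>.\<close>
  obtain A where A: "\<And>x. x \<in> {\<theta> - 4..\<theta> + 4} \<Longrightarrow> (A has_vector_derivative u x) (at x within {\<theta> - 4..\<theta> + 4})"
    using antiderivative_continuous[OF continuous_on_subset[OF u(1)], of "\<theta> - 4" "\<theta> + 4"] by auto
  have A': "(A has_real_derivative u x) (at x)" if "\<bar>x - \<theta>\<bar> \<le> pi" for x
  proof -
    have "x \<in> {\<theta> - 4<..<\<theta> + 4}" using that pi_less_4 by auto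
    then have "at x within {\<theta> - 4..\<theta> + 4} = at x" by (intro at_within_interior) simp
    then show ?thesis using A[of x] that pi_less_4 
      by (simp add: has_real_derivative_iff_has_vector_derivative abs_le_iff)
  qed
  \<comment> \<open>The excess of the integral of u over [\<theta> - s, \<theta> + s] above its
    bound, nonpositive by hypothesis. Since K' <= 0 and the product of K and \<Psi> is 0 at 0 and
    nonpositive at pi, integrating the derivative of this product shows that K times \<psi> has
    nonpositive integral.\<close>
  define \<Psi> where "\<Psi> s = A (\<theta> + s) - A (\<theta> - s) - 2 * s * L" for s
  define \<psi> where "\<psi> s = u (\<theta> + s) + u (\<theta> - s) - 2 * L" for s
  have d\<Psi>: "(\<Psi> has_real_derivative \<psi> s) (at s)" if "0 \<le> s" "s \<le> pi" for s
    unfolding \<Psi>_def \<psi>_def using that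
    by (auto intro!: derivative_eq_intros DERIV_chain2[OF A'])
  have \<Psi>0: "\<Psi> s \<le> 0" if "0 \<le> s" "s \<le> pi" for s
  proof (cases "s = 0")
    case False
    have "(u has_integral (A (\<theta> + s) - A (\<theta> - s))) {\<theta> - s..\<theta> + s}"
    proof (rule fundamental_theorem_of_calculus)
      fix x assume "x \<in> {\<theta> - s..\<theta> + s}"
      then have "\<bar>x - \<theta>\<bar> \<le> pi" using that by (auto simp: abs_le_iff)
      from has_field_derivative_at_within[OF A'[OF this]]
      show "(A has_vector_derivative u x) (at x within {\<theta> - s..\<theta> + s})"
        by (simp add: has_real_derivative_iff_has_vector_derivative)
    qed (use that in simp)
    then have "A (\<theta> + s) - A (\<theta> - s) = integral {\<theta> - s..\<theta> + s} u" by (simp add: integral_unique)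
    then show ?thesis using bound[of s] that False by (simp add: \<Psi>_def)
  qed (simp add: \<Psi>_def)
  have "((\<lambda>s. K' s * \<Psi> s + K s * \<psi> s) has_integral (K pi * \<Psi> pi - K 0 * \<Psi> 0)) {0..pi}"
  proof (intro fundamental_theorem_of_calculus)
    fix s assume s: "s \<in> {0..pi}"
    have "((\<lambda>s. K s * \<Psi> s) has_real_derivative (K' s * \<Psi> s + K s * \<psi> s)) (at s)"
      using DERIV_mult[OF dK d\<Psi>, of s] s by (simp add: algebra_simps)
    then show "((\<lambda>s. K s * \<Psi> s) has_vector_derivative (K' s * \<Psi> s + K s * \<psi> s)) (at s within {0..pi})"
      by (simp add: has_real_derivative_iff_has_vector_derivative[symmetric] has_field_derivative_at_within)
  qed simp
  moreover have "\<Psi> 0 = 0" by (simp add: \<Psi>_def)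
  ultimately have I1: "((\<lambda>s. K' s * \<Psi> s + K s * \<psi> s) has_integral (K pi * \<Psi> pi)) {0..pi}" by simp
  have c\<Psi>: "continuous_on {0..pi} \<Psi>"
    using d\<Psi> by (intro DERIV_continuous_on) (auto intro: has_field_derivative_at_within)
  have c\<psi>: "continuous_on {0..pi} \<psi>"
    unfolding \<psi>_def by (intro continuous_intros cu)
  have i\<Psi>: "(\<lambda>s. K' s * \<Psi> s) integrable_on {0..pi}" "(\<lambda>s. K s * \<psi> s) integrable_on {0..pi}"
    by (intro integrable_continuous_real continuous_intros cK c\<Psi> c\<psi>)+
  have "integral {0..pi} (\<lambda>s. K' s * \<Psi> s) + integral {0..pi} (\<lambda>s. K s * \<psi> s) = K pi * \<Psi> pi"
    using I1 i\<Psi> by (metis Henstock_Kurzweil_Integration.integral_add integral_unique)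
  moreover have "0 \<le> integral {0..pi} (\<lambda>s. K' s * \<Psi> s)"
    using K'0 \<Psi>0 i\<Psi> by (intro Henstock_Kurzweil_Integration.integral_nonneg) (auto intro: mult_nonpos_nonpos)
  moreover have "K pi * \<Psi> pi \<le> 0" using K0 \<Psi>0 by (intro mult_nonneg_nonpos) auto
  ultimately have "integral {0..pi} (\<lambda>s. K s * \<psi> s) \<le> 0" by linarith
  moreover have "integral {0..pi} (\<lambda>s. K s * \<psi> s) =
    integral {0..pi} (\<lambda>t. K t * (u (\<theta> + t) + u (\<theta> - t))) - integral {0..pi} (\<lambda>t. 2 * L * K t)"
  proof -
    have "(\<lambda>s. K s * \<psi> s) = (\<lambda>t. K t * (u (\<theta> + t) + u (\<theta> - t)) - 2 * L * K t)"
      by (auto simp: \<psi>_def algebra_simps)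
    then show ?thesis
      by (simp only:) (intro Henstock_Kurzweil_Integration.integral_diff integrable_continuous_real continuous_intros cK cu)
  qed
  moreover have "integral {0..pi} (\<lambda>t. 2 * L * K t) = 2 * pi * L" by (simp add: J1)
  ultimately have "integral {0..pi} (\<lambda>t. K t * (u (\<theta> + t) + u (\<theta> - t))) \<le> 2 * pi * L" by linarith
  then show ?thesis unfolding poisson_real_cis K_def[symmetric] J .
qed

text \<open>After a rotation, |F| on the radius is bounded by the Poisson integral of |F|. Hence the
  radial maximal function is dominated by the maximal function of interval averages of the boundary
  values.\<close>

lemma radial_le_interval_averages:
  assumes F: "continuous_on (cball 0 1) F" "F holomorphic_on ball 0 1" and r: "0 \<le> r" "r < 1"
    and bound: "\<And>h. 0 < h \<Longrightarrow> h \<le> pi \<Longrightarrow> integral {\<theta> - h..\<theta> + h} (\<lambda>t. cmod (F (cis t))) \<le> 2 * h * L"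
  shows "cmod (F (of_real r * cis \<theta>)) \<le> L"
proof -
  define G where "G z = F (cis \<theta> * z)" for z
  have c: "cmod (cis \<theta> * z) = cmod z" for z by (simp add: norm_mult)
  have G: "continuous_on (cball 0 1) G" "G holomorphic_on ball 0 1"
    unfolding G_def
     apply (rule continuous_on_compose2[OF F(1)]; auto intro!: continuous_intros simp: c)
    apply (rule holomorphic_on_compose_gen[OF _ F(2), unfolded o_def]; auto intro!: holomorphic_intros simp: c)
    done
  have Gs: "continuous_on (sphere 0 1) G" by (rule continuous_on_subset[OF G(1)]) auto
  have ps: "continuous_on (sphere 0 1) (\<lambda>\<zeta>. poisson (of_real r) \<zeta>)"
    unfolding poisson_def using r by (auto intro!: continuous_intros)
  have p0: "0 \<le> poisson (of_real r) \<zeta>" for \<zeta>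
    using r by (simp add: poisson_def power_le_one)
  have "F (of_real r * cis \<theta>) = (\<integral>\<zeta>. of_real (poisson (of_real r) \<zeta>) * G \<zeta> \<partial>circle_measure)"
    using circle_poisson_formula[OF G, of "of_real r"] r by (simp add: G_def mult.commute)
  also have "cmod \<dots> \<le> (\<integral>\<zeta>. cmod (of_real (poisson (of_real r) \<zeta>) * G \<zeta>) \<partial>circle_measure)"
    by (rule integral_norm_bound)
  also have "\<dots> = (\<integral>\<zeta>. poisson (of_real r) \<zeta> * cmod (G \<zeta>) \<partial>circle_measure)"
    using p0 by (simp add: norm_mult)
  also have "\<dots> = integral {0..2 * pi} (\<lambda>t. poisson (of_real r) (cis t) * cmod (G (cis t))) /\<^sub>R (2 * pi)"
    by (rule integral_circle_measure) (intro continuous_intros ps Gs)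
  also have "\<dots> \<le> L"
  proof -
    have "continuous_on UNIV (\<lambda>t. cmod (F (cis t)))"
      by (intro continuous_intros continuous_on_compose2[OF F(1)]) auto
    moreover have "cis (x + 2 * pi) = cis x" for x by (simp flip: cis_mult)
    ultimately have "integral {0..2 * pi} (\<lambda>t. poisson (of_real r) (cis t) * cmod (F (cis (\<theta> + t)))) \<le> 2 * pi * L"
      by (intro poisson_le_interval_averages r bound) auto
    then show ?thesis by (simp add: G_def cis_mult field_simps)
  qed
  finally show ?thesis .
qed

text \<open>Intervals with centre in [0, 2 pi] and half-length at most pi may leave the period, but
  three periods contain them all.\<close>

lemma nn_integral_periodic_three_periods:
  fixes u :: "real \<Rightarrow> real"
  assumes u: "continuous_on UNIV u" "\<And>x. u (x + 2 * pi) = u x"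
  shows "(\<integral>\<^sup>+x. ennreal (u x) * indicator {- 2 * pi..4 * pi} x \<partial>lborel) \<le>
    3 * (\<integral>\<^sup>+x. ennreal (u x) * indicator {0..2 * pi} x \<partial>lborel)"
proof -
  have [measurable]: "u \<in> borel_measurable borel"
    using u(1) by (rule borel_measurable_continuous_onI)
  define I where "I = (\<integral>\<^sup>+x. ennreal (u x) * indicator {0..2 * pi} x \<partial>lborel)"
  have shift: "(\<integral>\<^sup>+x. ennreal (u x) * indicator {c..c + 2 * pi} x \<partial>lborel) = I" if c: "\<And>x. u (c + x) = u x" for c
  proof -
    have "(\<integral>\<^sup>+x. ennreal (u x) * indicator {c..c + 2 * pi} x \<partial>lborel) =
      (\<integral>\<^sup>+x. ennreal (u (c + 1 * x)) * indicator {c..c + 2 * pi} (c + 1 * x) \<partial>lborel)"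
      by (subst nn_integral_real_affine[where c = 1 and t = c]) auto
    also have "\<dots> = I" unfolding I_def
      by (intro nn_integral_cong) (auto simp: c split: split_indicator)
    finally show ?thesis .
  qed
  have u': "u (- 2 * pi + x) = u x" for x using u(2)[of "- 2 * pi + x"] by simp
  have u'': "u (2 * pi + x) = u x" for x using u(2)[of x] by (simp add: add.commute)
  have "(\<integral>\<^sup>+x. ennreal (u x) * indicator {- 2 * pi..4 * pi} x \<partial>lborel) \<le>
    (\<integral>\<^sup>+x. ennreal (u x) * indicator {- 2 * pi..- 2 * pi + 2 * pi} x + (ennreal (u x) * indicator {0..0 + 2 * pi} x +
      ennreal (u x) * indicator {2 * pi..2 * pi + 2 * pi} x) \<partial>lborel)"
    by (intro nn_integral_mono) (auto split: split_indicator)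
  also have "\<dots> = I + (I + I)"
    using shift[of "- 2 * pi"] shift[of 0] shift[of "2 * pi"] u' u''
    by (simp add: nn_integral_add)
  also have "\<dots> = (1 + (1 + 1)) * I" by (simp only: distrib_right mult_1)
  also have "\<dots> = 3 * I" by simp
  finally show ?thesis by (simp add: I_def)
qed

lemma emeasure_UN_ball_le:
  fixes a :: "'i \<Rightarrow> real" and r :: "'i \<Rightarrow> real"
  assumes C: "countable C" and r: "\<And>i. i \<in> C \<Longrightarrow> 0 < r i"
  shows "emeasure lborel (\<Union>i\<in>C. ball (a i) (5 * r i)) \<le> (\<integral>\<^sup>+i. ennreal (10 * r i) \<partial>count_space C)"
proof -
  have "emeasure lborel (\<Union>i\<in>C. ball (a i) (5 * r i)) = (\<integral>\<^sup>+x. indicator (\<Union>i\<in>C. ball (a i) (5 * r i)) x \<partial>lborel)"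
    by (subst nn_integral_indicator) (auto intro!: sets.countable_UN'' C)
  also have "\<dots> \<le> (\<integral>\<^sup>+x. \<integral>\<^sup>+i. indicator (ball (a i) (5 * r i)) x \<partial>count_space C \<partial>lborel)"
  proof (intro nn_integral_mono)
    fix x :: real
    show "indicator (\<Union>i\<in>C. ball (a i) (5 * r i)) x \<le> (\<integral>\<^sup>+i. (indicator (ball (a i) (5 * r i)) x :: ennreal) \<partial>count_space C)"
    proof (cases "x \<in> (\<Union>i\<in>C. ball (a i) (5 * r i))")
      case True
      then obtain j where j: "j \<in> C" "x \<in> ball (a j) (5 * r j)" by auto
      have "(1 :: ennreal) = (\<integral>\<^sup>+i. indicator {j} i \<partial>count_space C)" using j by simp
      also have "\<dots> \<le> (\<integral>\<^sup>+i. indicator (ball (a i) (5 * r i)) x \<partial>count_space C)"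
        using j by (intro nn_integral_mono) (auto split: split_indicator)
      finally show ?thesis using True by simp
    qed simp
  qed
  also have "\<dots> = (\<integral>\<^sup>+i. \<integral>\<^sup>+x. indicator (ball (a i) (5 * r i)) x \<partial>lborel \<partial>count_space C)"
    by (intro nn_integral_count_space_nn_integral C borel_measurable_indicator) auto
  also have "\<dots> \<le> (\<integral>\<^sup>+i. ennreal (10 * r i) \<partial>count_space C)"
  proof (intro nn_integral_mono)
    fix i assume "i \<in> space (count_space C)"
    then have "0 < r i" using r by simp
    then show "(\<integral>\<^sup>+x. indicator (ball (a i) (5 * r i)) x \<partial>lborel) \<le> ennreal (10 * r i)"
      by (simp add: ball_eq_greaterThanLessThan)
  qed
  finally show ?thesis .
qed

text \<open>The Hardy-Littlewood weak-type inequality. By Vitali's lemma, \<open>S\<close> is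
  covered by the fivefold enlargements of disjoint balls; an enlarged ball has length 10 h, which is
  below 5 / L times the integral over the original ball. The overhang beyond one period costs a
  factor 3, hence 15.\<close>

lemma emeasure_large_averages_le:
  fixes u :: "real \<Rightarrow> real"
  assumes u: "continuous_on UNIV u" "\<And>x. u (x + 2 * pi) = u x" "\<And>x. 0 \<le> u x" and L: "0 < L"
    and S: "S \<in> sets lborel"
      "\<And>\<theta>. \<theta> \<in> S \<Longrightarrow> \<theta> \<in> {0..2 * pi} \<and> (\<exists>h. 0 < h \<and> h \<le> pi \<and> 2 * h * L < integral {\<theta> - h..\<theta> + h} u)"
  shows "emeasure lborel S \<le> ennreal (15 / L) * (\<integral>\<^sup>+x. ennreal (u x) * indicator {0..2 * pi} x \<partial>lborel)"
proof -
  have [measurable]: "u \<in> borel_measurable borel"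
    using u(1) by (rule borel_measurable_continuous_onI)
  from S(2) obtain h where h: "\<And>\<theta>. \<theta> \<in> S \<Longrightarrow> 0 < h \<theta>" "\<And>\<theta>. \<theta> \<in> S \<Longrightarrow> h \<theta> \<le> pi"
    "\<And>\<theta>. \<theta> \<in> S \<Longrightarrow> 2 * h \<theta> * L < integral {\<theta> - h \<theta>..\<theta> + h \<theta>} u"
    by metis
  obtain C where C: "countable C" "C \<subseteq> S" "pairwise (\<lambda>i j. disjnt (ball i (h i)) (ball j (h j))) C"
    "S \<subseteq> (\<Union>i\<in>C. ball i (5 * h i))"
    by (rule Vitali_covering_lemma_balls[where S = S and K = S and a = "\<lambda>x. x" and r = h and B = pi]) (use h in auto)
  have "emeasure lborel S \<le> emeasure lborel (\<Union>i\<in>C. ball i (5 * h i))"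
    by (intro emeasure_mono C) (auto intro!: sets.countable_UN'' C)
  also have "\<dots> \<le> (\<integral>\<^sup>+i. ennreal (10 * h i) \<partial>count_space C)"
    using C h by (intro emeasure_UN_ball_le) auto
  also have "\<dots> \<le> (\<integral>\<^sup>+i. ennreal (5 / L) * (\<integral>\<^sup>+x. ennreal (u x) * indicator (ball i (h i)) x \<partial>lborel) \<partial>count_space C)"
  proof (intro nn_integral_mono)
    fix i assume "i \<in> space (count_space C)"
    then have i: "i \<in> S" using C by auto
    have c: "continuous_on {i - h i..i + h i} u" by (rule continuous_on_subset[OF u(1)]) auto
    have "(\<integral>\<^sup>+x. ennreal (u x) * indicator (ball i (h i)) x \<partial>lborel) =
      (\<integral>\<^sup>+x. ennreal (u x) * indicator {i - h i..i + h i} x \<partial>lborel)"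
    proof (rule nn_integral_cong_AE)
      have "AE x in lborel. x \<noteq> i - h i \<and> x \<noteq> i + h i"
        using AE_lborel_singleton[of "i - h i"] AE_lborel_singleton[of "i + h i"] by eventually_elim auto
      then show "AE x in lborel. ennreal (u x) * indicator (ball i (h i)) x = ennreal (u x) * indicator {i - h i..i + h i} x"
        by eventually_elim (auto simp: ball_eq_greaterThanLessThan split: split_indicator)
    qed
    also have "\<dots> = ennreal (integral {i - h i..i + h i} u)"
    proof -
      have "set_integrable lborel {i - h i..i + h i} u" by (rule borel_integrable_atLeastAtMost'[OF c])
      then have "(\<integral>\<^sup>+x. ennreal (indicator {i - h i..i + h i} x *\<^sub>R u x) \<partial>lborel) = ennreal (integral {i - h i..i + h i} u)"
        using u(3) set_borel_integral_eq_integral(2)[of "{i - h i..i + h i}" u]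
        by (subst nn_integral_eq_integral) (auto simp: set_integrable_def set_lebesgue_integral_def)
      moreover have "(\<integral>\<^sup>+x. ennreal (indicator {i - h i..i + h i} x *\<^sub>R u x) \<partial>lborel) = (\<integral>\<^sup>+x. ennreal (u x) * indicator {i - h i..i + h i} x \<partial>lborel)"
        by (intro nn_integral_cong) (auto split: split_indicator)
      ultimately show ?thesis by simp
    qed
    finally have eq: "(\<integral>\<^sup>+x. ennreal (u x) * indicator (ball i (h i)) x \<partial>lborel) = ennreal (integral {i - h i..i + h i} u)" .
    have "10 * h i \<le> 5 / L * integral {i - h i..i + h i} u"
      using h(3)[OF i] L by (simp add: field_simps)
    then show "ennreal (10 * h i) \<le> ennreal (5 / L) * (\<integral>\<^sup>+x. ennreal (u x) * indicator (ball i (h i)) x \<partial>lborel)"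
      unfolding eq using L by (simp add: ennreal_mult'[symmetric] ennreal_leI)
  qed
  also have "\<dots> = ennreal (5 / L) * (\<integral>\<^sup>+i. (\<integral>\<^sup>+x. ennreal (u x) * indicator (ball i (h i)) x \<partial>lborel) \<partial>count_space C)"
    by (intro nn_integral_cmult) auto
  also have "(\<integral>\<^sup>+i. (\<integral>\<^sup>+x. ennreal (u x) * indicator (ball i (h i)) x \<partial>lborel) \<partial>count_space C) =
      (\<integral>\<^sup>+i. emeasure (density lborel u) (ball i (h i)) \<partial>count_space C)"
    by (intro nn_integral_cong) (simp add: emeasure_density)
  also have "\<dots> = emeasure (density lborel u) (\<Union>i\<in>C. ball i (h i))"
    using C by (intro emeasure_UN_countable[symmetric]) (auto simp: disjoint_family_on_def pairwise_def disjnt_def)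
  also have "\<dots> = (\<integral>\<^sup>+x. ennreal (u x) * indicator (\<Union>i\<in>C. ball i (h i)) x \<partial>lborel)"
    by (intro emeasure_density) (auto intro!: sets.countable_UN'' C)
  also have "\<dots> \<le> (\<integral>\<^sup>+x. ennreal (u x) * indicator {- 2 * pi..4 * pi} x \<partial>lborel)"
  proof (intro nn_integral_mono mult_left_mono)
    fix x :: real
    have "(\<Union>i\<in>C. ball i (h i)) \<subseteq> {- 2 * pi..4 * pi}"
    proof
      fix x assume "x \<in> (\<Union>i\<in>C. ball i (h i))"
      then obtain i where i: "i \<in> C" "x \<in> ball i (h i)" by auto
      then have "i \<in> S" using C by auto
      then have "0 \<le> i" "i \<le> 2 * pi" "h i \<le> pi" using S(2) h by auto
      then show "x \<in> {- 2 * pi..4 * pi}" using i(2) by (auto simp: dist_real_def abs_less_iff)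
    qed
    then show "(indicator (\<Union>i\<in>C. ball i (h i)) x :: ennreal) \<le> indicator {- 2 * pi..4 * pi} x"
      by (intro indicator_leI) blast
  qed auto
  also have "\<dots> \<le> 3 * (\<integral>\<^sup>+x. ennreal (u x) * indicator {0..2 * pi} x \<partial>lborel)"
    using u by (intro nn_integral_periodic_three_periods)
  finally have "emeasure lborel S \<le> ennreal (5 / L) * (3 * (\<integral>\<^sup>+x. ennreal (u x) * indicator {0..2 * pi} x \<partial>lborel))"
    by (simp add: mult_left_mono)
  also have "\<dots> = (ennreal (5 / L) * ennreal 3) * (\<integral>\<^sup>+x. ennreal (u x) * indicator {0..2 * pi} x \<partial>lborel)"
    by (simp add: mult.assoc)
  also have "ennreal (5 / L) * ennreal 3 = ennreal (15 / L)" using L by (subst ennreal_mult'[symmetric]) auto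
  finally show ?thesis .
qed

section \<open>The maximal inequality on the circle\<close>

lemma openin_circle_measurable:
  assumes "openin (top_of_set (sphere 0 1)) S"
  shows "S \<in> sets circle_measure"
proof -
  obtain T where "open T" "S = sphere 0 1 \<inter> T" using assms by (auto simp: openin_open)
  then show ?thesis
    unfolding sets_circle_measure by (auto simp: sets_restrict_space)
qed

text \<open>The set is an uncountable union over \<open>r\<close>, so its measurability is obtained
  from openness.\<close>

lemma openin_radial_sup:
  fixes F :: "complex \<Rightarrow> complex"
  assumes "continuous_on (ball 0 1) F"
  shows "openin (top_of_set (sphere 0 1)) {\<zeta>\<in>sphere 0 1. \<exists>r\<in>{0<..<1}. L < cmod (F (of_real r * \<zeta>))}"
proof -
  have "openin (top_of_set (sphere 0 1)) (sphere 0 1 \<inter> (\<lambda>\<zeta>. cmod (F (of_real r * \<zeta>))) -` {L<..})" if "r \<in> {0<..<1}" for r :: real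
    using that by (intro continuous_openin_preimage_gen continuous_intros continuous_on_compose2[OF assms])
      (auto intro: scale_in_ball simp: norm_mult)
  then have "openin (top_of_set (sphere 0 1)) (\<Union>r\<in>{0<..<1}. sphere 0 1 \<inter> (\<lambda>\<zeta>. cmod (F (of_real r * \<zeta>))) -` {L<..})"
    by (intro openin_Union) auto
  moreover have "(\<Union>r\<in>{0<..<1}. sphere 0 1 \<inter> (\<lambda>\<zeta>. cmod (F (of_real r * \<zeta>))) -` {L<..}) =
    {\<zeta>\<in>sphere 0 1. \<exists>r\<in>{0<..<1}. L < cmod (F (of_real r * \<zeta>))}" by auto
  ultimately show ?thesis by simp
qed

lemma radial_maximal_weak_type:
  assumes F: "continuous_on (cball 0 1) F" "F holomorphic_on ball 0 1" and L: "0 < L"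
  shows "emeasure circle_measure {\<zeta>\<in>sphere 0 1. \<exists>r\<in>{0<..<1}. L < cmod (F (of_real r * \<zeta>))}
    \<le> ennreal (15 / L * (\<integral>\<zeta>. cmod (F \<zeta>) \<partial>circle_measure))"
proof -
  define E where "E = {\<zeta>\<in>sphere 0 1. \<exists>r\<in>{0<..<1}. L < cmod (F (of_real r * \<zeta>))}"
  have E: "E \<in> sets circle_measure"
    unfolding E_def
    by (intro openin_circle_measurable openin_radial_sup continuous_on_subset[OF F(1)]) auto
  have Fs: "continuous_on (sphere 0 1) (\<lambda>\<zeta>. cmod (F \<zeta>))"
    by (intro continuous_intros continuous_on_subset[OF F(1)]) auto
  define u where "u t = cmod (F (cis t))" for t
  have cis_p: "cis (x + 2 * pi) = cis x" for x by (simp flip: cis_mult)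
  have u: "continuous_on UNIV u" "\<And>x. u (x + 2 * pi) = u x" "\<And>x. 0 \<le> u x"
    unfolding u_def cis_p by (auto intro!: continuous_intros continuous_on_compose2[OF F(1)])
  define S where "S = {t\<in>{0..2 * pi}. cis t \<in> E}"
  have S: "S \<in> sets lborel"
  proof -
    have "cis -` E \<inter> space borel \<in> sets borel"
      by (rule measurable_sets[OF cis_measurable_circle]) (use E sets_circle_measure in simp)
    then have "{0..2 * pi} \<inter> cis -` E \<in> sets borel" by (intro sets.Int) auto
    moreover have "S = {0..2 * pi} \<inter> cis -` E" by (auto simp: S_def)
    ultimately show ?thesis by simp
  qed
  have S': "\<theta> \<in> {0..2 * pi} \<and> (\<exists>h. 0 < h \<and> h \<le> pi \<and> 2 * h * L < integral {\<theta> - h..\<theta> + h} u)" if "\<theta> \<in> S" for \<theta>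
  proof (intro conjI)
    show "\<theta> \<in> {0..2 * pi}" using that by (simp add: S_def)
    from that obtain r where r: "0 < r" "r < 1" "L < cmod (F (of_real r * cis \<theta>))"
      by (auto simp: S_def E_def)
    show "\<exists>h. 0 < h \<and> h \<le> pi \<and> 2 * h * L < integral {\<theta> - h..\<theta> + h} u"
    proof (rule ccontr)
      assume "\<not> ?thesis"
      then have "cmod (F (of_real r * cis \<theta>)) \<le> L"
        using r by (intro radial_le_interval_averages F) (auto simp: u_def[symmetric] not_less)
      then show False using r by simp
    qed
  qed
  have nn: "(\<integral>\<^sup>+\<zeta>. ennreal (cmod (F \<zeta>)) \<partial>circle_measure) = (\<integral>\<^sup>+x. ennreal (u x) * indicator {0..2 * pi} x \<partial>lborel) / ennreal (2 * pi)"
    unfolding u_def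
    by (rule nn_integral_circle_measure) (use borel_measurable_continuous_on_restrict[OF Fs] in measurable)
  have "emeasure circle_measure E = (\<integral>\<^sup>+\<zeta>. indicator E \<zeta> \<partial>circle_measure)" using E by simp
  also have "\<dots> = (\<integral>\<^sup>+t. indicator E (cis t) * indicator {0..2 * pi} t \<partial>lborel) / ennreal (2 * pi)"
    by (rule nn_integral_circle_measure) (use E sets_circle_measure in simp)
  also have "(\<integral>\<^sup>+t. indicator E (cis t) * indicator {0..2 * pi} t \<partial>lborel) = (\<integral>\<^sup>+t. indicator S t \<partial>lborel)"
    by (intro nn_integral_cong) (auto simp: S_def split: split_indicator)
  also have "\<dots> = emeasure lborel S" using S by simp
  also have "emeasure lborel S / ennreal (2 * pi) \<le>
    (ennreal (15 / L) * (\<integral>\<^sup>+x. ennreal (u x) * indicator {0..2 * pi} x \<partial>lborel)) / ennreal (2 * pi)"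
    by (intro divide_right_mono_ennreal emeasure_large_averages_le u L S) (use S' in blast)
  also have "\<dots> = ennreal (15 / L) * (\<integral>\<^sup>+\<zeta>. ennreal (cmod (F \<zeta>)) \<partial>circle_measure)"
    unfolding nn by (simp add: ennreal_times_divide)
  also have "(\<integral>\<^sup>+\<zeta>. ennreal (cmod (F \<zeta>)) \<partial>circle_measure) = ennreal (\<integral>\<zeta>. cmod (F \<zeta>) \<partial>circle_measure)"
    by (intro nn_integral_eq_integral integrable_circle_continuous Fs) auto
  finally show ?thesis
    unfolding E_def[symmetric] using L by (simp add: ennreal_mult'[symmetric])
qed


subsection \<open>Radial limits of bounded holomorphic functions\<close>

lemma circle_parseval_polynomial:
  "(\<integral>\<zeta>. (cmod (\<Sum>n<N. c n * \<zeta> ^ n))\<^sup>2 \<partial>circle_measure) = (\<Sum>n<N. (cmod (c n))\<^sup>2)"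
proof (induction N)
  case (Suc N)
  define S where "S \<zeta> = (\<Sum>n<N. c n * \<zeta> ^ n)" for \<zeta>
  \<comment> \<open>On the circle this is the new term times the conjugate of the old sum, since
    \<zeta>^N cnj (\<zeta>^n) = \<zeta>^(N - n). It is holomorphic and vanishes at 0, so the cross
    term has mean 0.\<close>
  define Q where "Q \<zeta> = c N * (\<Sum>n<N. cnj (c n) * \<zeta> ^ (N - n))" for \<zeta>
  have cont: "continuous_on A S" "continuous_on A Q" for A
    unfolding S_def Q_def by (intro continuous_intros)+
  have "Q holomorphic_on ball 0 1" unfolding Q_def by (intro holomorphic_intros)
  moreover have "Q 0 = 0" unfolding Q_def by (auto intro!: sum.neutral)
  ultimately have "(\<integral>\<zeta>. Q \<zeta> \<partial>circle_measure) = 0" using circle_mean_value[of Q] cont by simp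
  then have "Re (\<integral>\<zeta>. Q \<zeta> \<partial>circle_measure) = 0" by simp
  moreover have "integrable circle_measure Q" by (intro integrable_circle_continuous cont)
  ultimately have ReQ: "(\<integral>\<zeta>. Re (Q \<zeta>) \<partial>circle_measure) = 0" by simp
  have iS: "integrable circle_measure (\<lambda>\<zeta>. (cmod (S \<zeta>))\<^sup>2)" "integrable circle_measure (\<lambda>\<zeta>. Re (Q \<zeta>))"
    by (intro integrable_circle_continuous continuous_intros cont)+
  have "(\<integral>\<zeta>. (cmod (\<Sum>n<Suc N. c n * \<zeta> ^ n))\<^sup>2 \<partial>circle_measure) =
    (\<integral>\<zeta>. (cmod (S \<zeta>))\<^sup>2 + (cmod (c N))\<^sup>2 + 2 * Re (Q \<zeta>) \<partial>circle_measure)"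
  proof (intro Bochner_Integration.integral_cong refl)
    fix \<zeta> assume "\<zeta> \<in> space circle_measure"
    then have z: "cmod \<zeta> = 1" by simp
    then have zz: "\<zeta> * cnj \<zeta> = 1" by (simp add: complex_norm_square[symmetric])
    have "\<zeta> ^ N * cnj (\<zeta> ^ n) = \<zeta> ^ (N - n)" if "n < N" for n
    proof -
      have "\<zeta> ^ N * cnj (\<zeta> ^ n) = \<zeta> ^ (N - n) * (\<zeta> ^ n * cnj (\<zeta> ^ n))"
        using that by (simp add: mult.assoc[symmetric] flip: power_add)
      also have "\<zeta> ^ n * cnj (\<zeta> ^ n) = 1" using zz by (simp flip: power_mult_distrib)
      finally show ?thesis by simp
    qed
    then have "Q \<zeta> = c N * \<zeta> ^ N * cnj (S \<zeta>)"
      by (simp add: Q_def S_def sum_distrib_left mult_ac)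
    moreover have "(cmod (a + b))\<^sup>2 = (cmod a)\<^sup>2 + (cmod b)\<^sup>2 + 2 * Re (b * cnj a)" for a b
      unfolding cmod_power2 by (simp add: power2_eq_square algebra_simps)
    ultimately show "(cmod (\<Sum>n<Suc N. c n * \<zeta> ^ n))\<^sup>2 = (cmod (S \<zeta>))\<^sup>2 + (cmod (c N))\<^sup>2 + 2 * Re (Q \<zeta>)"
      by (simp add: S_def[symmetric] norm_mult norm_power z)
  qed
  also have "\<dots> = (\<integral>\<zeta>. (cmod (S \<zeta>))\<^sup>2 \<partial>circle_measure) + (cmod (c N))\<^sup>2"
    using iS ReQ by simp
  also have "\<dots> = (\<Sum>n<Suc N. (cmod (c n))\<^sup>2)" using Suc by (simp add: S_def)
  finally show ?case .
qed simp

lemma circle_parseval_sums: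
  assumes a: "\<And>z. cmod z < 1 \<Longrightarrow> (\<lambda>n. a n * z ^ n) sums W z" and R: "0 < R" "R < 1"
  shows "(\<lambda>n. (cmod (a n))\<^sup>2 * R ^ (2 * n)) sums (\<integral>\<zeta>. (cmod (W (of_real R * \<zeta>)))\<^sup>2 \<partial>circle_measure)"
proof -
  define S where "S N \<zeta> = (\<Sum>n<N. (a n * of_real R ^ n) * \<zeta> ^ n)" for N \<zeta>
  define B where "B = (\<Sum>n. cmod (a n) * R ^ n)"
  \<comment> \<open>Convergence at a radius strictly between R and 1 gives absolute convergence at
    R, and with it the bound \<open>B\<close> for dominated convergence.\<close>
  define R' where "R' = (1 + R) / 2"
  have R': "R < R'" "R' < 1" using R by (auto simp: R'_def)
  have "summable (\<lambda>n. a n * of_real R' ^ n)" using a[of "of_real R'"] R' R by (auto simp: sums_iff)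
  then have sm: "summable (\<lambda>n. cmod (a n * of_real R ^ n))"
    by (rule powser_insidea) (use R R' in simp)
  then have sm': "summable (\<lambda>n. cmod (a n) * R ^ n)" using R by (simp add: norm_mult norm_power)
  have conv: "(\<lambda>N. S N \<zeta>) \<longlonglongrightarrow> W (of_real R * \<zeta>)" if "cmod \<zeta> = 1" for \<zeta>
    using a[of "of_real R * \<zeta>"] that R
    by (simp add: S_def sums_def norm_mult power_mult_distrib mult.assoc)
  have bd: "cmod (S N \<zeta>) \<le> B" if "cmod \<zeta> = 1" for N \<zeta>
  proof -
    have "cmod (S N \<zeta>) \<le> (\<Sum>n<N. cmod ((a n * of_real R ^ n) * \<zeta> ^ n))" unfolding S_def by (rule norm_sum)
    also have "\<dots> = (\<Sum>n<N. cmod (a n) * R ^ n)" using that R by (simp add: norm_mult norm_power)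
    also have "\<dots> \<le> B" unfolding B_def by (intro sum_le_suminf sm') (use R in auto)
    finally show ?thesis .
  qed
  have cS: "continuous_on (sphere 0 1) (\<lambda>\<zeta>. (cmod (S N \<zeta>))\<^sup>2)" for N
    unfolding S_def by (intro continuous_intros)
  have mW: "(\<lambda>\<zeta>. (cmod (W (of_real R * \<zeta>)))\<^sup>2) \<in> borel_measurable circle_measure"
    by (rule borel_measurable_LIMSEQ_real[where u = "\<lambda>N \<zeta>. (cmod (S N \<zeta>))\<^sup>2"])
      (auto intro!: tendsto_intros conv borel_measurable_circle_continuous cS)
  have "(\<lambda>N. \<integral>\<zeta>. (cmod (S N \<zeta>))\<^sup>2 \<partial>circle_measure) \<longlonglongrightarrow> (\<integral>\<zeta>. (cmod (W (of_real R * \<zeta>)))\<^sup>2 \<partial>circle_measure)"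
    using bd by (intro integral_dominated_convergence[where w = "\<lambda>_. B\<^sup>2"] mW)
      (auto intro!: AE_I2 tendsto_intros conv borel_measurable_circle_continuous cS power_mono)
  moreover have "(\<integral>\<zeta>. (cmod (S N \<zeta>))\<^sup>2 \<partial>circle_measure) = (\<Sum>n<N. (cmod (a n))\<^sup>2 * R ^ (2 * n))" for N
    unfolding S_def using R
    by (subst circle_parseval_polynomial) (simp add: norm_mult norm_power power_mult_distrib mult.commute flip: power_mult)
  ultimately show ?thesis by (simp add: sums_def)
qed

text \<open>By Parseval the Taylor coefficients are square summable, so the remainder T after a long
  Taylor polynomial has small mean square on all circles. The weak-type bound is applied to T^2,
  whose modulus has just this mean.\<close>

lemma small_radial_deviation_from_polynomial:
  assumes w: "w holomorphic_on ball 0 1" and M: "\<And>z. cmod z < 1 \<Longrightarrow> cmod (w z) \<le> M" and \<epsilon>: "0 < \<epsilon>" "0 < \<delta>"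
  obtains P :: "complex poly"
    where "emeasure circle_measure {\<zeta>\<in>sphere 0 1. \<exists>r\<in>{0<..<1}. \<delta> < cmod (w (of_real r * \<zeta>) - poly P (of_real r * \<zeta>))} \<le> ennreal \<epsilon>"
proof -
  define a where "a n = (deriv ^^ n) w 0 / fact n" for n
  have a: "(\<lambda>n. a n * z ^ n) sums w z" if "cmod z < 1" for z
    using holomorphic_power_series[OF w, of z] that by (simp add: a_def)
  have part: "(\<Sum>n<N. (cmod (a n))\<^sup>2) \<le> M\<^sup>2" for N
  proof (rule tendsto_upperbound)
    show "((\<lambda>R. \<Sum>n<N. (cmod (a n))\<^sup>2 * R ^ (2 * n)) \<longlongrightarrow> (\<Sum>n<N. (cmod (a n))\<^sup>2)) (at_left 1)"
    proof -
      have "((\<lambda>R::real. \<Sum>n<N. (cmod (a n))\<^sup>2 * R ^ (2 * n)) \<longlongrightarrow> (\<Sum>n<N. (cmod (a n))\<^sup>2 * 1 ^ (2 * n))) (at_left 1)"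
        by (intro tendsto_sum tendsto_mult tendsto_power tendsto_const tendsto_ident_at)
      then show ?thesis by simp
    qed
    have "\<forall>\<^sub>F R in at_left (1::real). 0 < R \<and> R < 1"
      using eventually_at_left_real[of 0 1] by simp
    then show "\<forall>\<^sub>F R in at_left 1. (\<Sum>n<N. (cmod (a n))\<^sup>2 * R ^ (2 * n)) \<le> M\<^sup>2"
    proof eventually_elim
      case (elim R)
      have s: "(\<lambda>n. (cmod (a n))\<^sup>2 * R ^ (2 * n)) sums (\<integral>\<zeta>. (cmod (w (of_real R * \<zeta>)))\<^sup>2 \<partial>circle_measure)"
        using a elim by (intro circle_parseval_sums) auto
      have cw: "continuous_on (sphere 0 1) (\<lambda>\<zeta>. w (of_real R * \<zeta>))"
        by (rule continuous_on_compose2[OF holomorphic_on_imp_continuous_on[OF w]])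
          (use elim in \<open>auto intro!: continuous_intros simp: norm_mult\<close>)
      have "(\<Sum>n<N. (cmod (a n))\<^sup>2 * R ^ (2 * n)) \<le> (\<integral>\<zeta>. (cmod (w (of_real R * \<zeta>)))\<^sup>2 \<partial>circle_measure)"
        unfolding sums_unique[OF s] using s elim by (intro sum_le_suminf) (auto simp: sums_iff)
      also have "\<dots> \<le> (\<integral>\<zeta>. M\<^sup>2 \<partial>circle_measure)"
        using elim M by (intro integral_mono integrable_circle_continuous continuous_intros cw power_mono) (auto simp: norm_mult)
      also have "\<dots> = M\<^sup>2" by simp
      finally show ?case .
    qed
  qed simp
  have sm: "summable (\<lambda>n. (cmod (a n))\<^sup>2)"
    by (rule summableI_nonneg_bounded[where x = "M\<^sup>2"]) (use part in auto)
  \<comment> \<open>Chosen so that the weak-type bound 15 / \<delta>^2 times \<open>e\<close> is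
    \<epsilon>.\<close>
  define e where "e = \<epsilon> * \<delta>\<^sup>2 / 15"
  have e: "0 < e" using \<epsilon> by (simp add: e_def)
  obtain N where N: "norm (\<Sum>i. (cmod (a (i + N)))\<^sup>2) < e"
    using suminf_exist_split[OF e sm] by blast
  define P where "P = (\<Sum>n<N. monom (a n) n)"
  have P: "poly P z = (\<Sum>n<N. a n * z ^ n)" for z by (simp add: P_def poly_sum poly_monom)
  define T where "T z = w z - poly P z" for z
  define b where "b n = (if n < N then 0 else a n)" for n
  have b: "(\<lambda>n. b n * z ^ n) sums T z" if "cmod z < 1" for z
  proof -
    have "(\<lambda>n. if n \<in> {..<N} then a n * z ^ n else 0) sums poly P z"
      unfolding P by (rule sums_If_finite_set) simp
    from sums_diff[OF a[OF that] this] show ?thesis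
      unfolding T_def by (rule back_subst[of "\<lambda>f. f sums _"]) (auto simp: b_def)
  qed
  have smb: "summable (\<lambda>n. (cmod (b n))\<^sup>2)"
    by (rule summable_comparison_test'[OF sm, of 0]) (auto simp: b_def)
  have sb: "(\<Sum>n. (cmod (b n))\<^sup>2) \<le> e"
  proof -
    have "(\<Sum>n. (cmod (b n))\<^sup>2) = (\<Sum>n. (cmod (b (n + N)))\<^sup>2) + (\<Sum>n<N. (cmod (b n))\<^sup>2)"
      by (rule suminf_split_initial_segment[OF smb])
    also have "\<dots> = (\<Sum>i. (cmod (a (i + N)))\<^sup>2)" by (simp add: b_def)
    finally show ?thesis using N by simp
  qed
  have Tint: "(\<integral>\<zeta>. (cmod (T (of_real R * \<zeta>)))\<^sup>2 \<partial>circle_measure) \<le> e" if R: "0 < R" "R < 1" for R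
  proof -
    have s: "(\<lambda>n. (cmod (b n))\<^sup>2 * R ^ (2 * n)) sums (\<integral>\<zeta>. (cmod (T (of_real R * \<zeta>)))\<^sup>2 \<partial>circle_measure)"
      using b R by (intro circle_parseval_sums) auto
    have "(\<integral>\<zeta>. (cmod (T (of_real R * \<zeta>)))\<^sup>2 \<partial>circle_measure) \<le> (\<Sum>n. (cmod (b n))\<^sup>2)"
      unfolding sums_unique[OF s] using s R smb
      by (intro suminf_le) (auto simp: sums_iff mult_left_le power_le_one)
    then show ?thesis using sb by simp
  qed
  have Thol: "T holomorphic_on ball 0 1" unfolding T_def by (intro holomorphic_intros w)
  \<comment> \<open>The maximal inequality needs continuity up to the circle, hence the dilations by
    \<open>radius n\<close>. The sets increase with n and exhaust the one in the claim, so
    continuity of the measure from below preserves the bound.\<close>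
  define E where "E n = {\<zeta>\<in>sphere 0 1. \<exists>r\<in>{0<..<1}. \<delta>\<^sup>2 < cmod ((T (of_real (radius n) * (of_real r * \<zeta>)))\<^sup>2)}" for n
  have cT: "continuous_on (cball 0 1) (\<lambda>z. (T (of_real (radius n) * z))\<^sup>2)" "(\<lambda>z. (T (of_real (radius n) * z))\<^sup>2) holomorphic_on ball 0 1" for n
     apply (intro continuous_intros continuous_on_compose2[OF holomorphic_on_imp_continuous_on[OF Thol]]; use scale_in_ball[OF radius_bounds, of _ n] in force)
    apply (intro holomorphic_intros holomorphic_on_compose_gen[OF _ Thol, unfolded o_def]; use scale_in_ball[OF radius_bounds, of _ n] in force)
    done
  have E_le: "emeasure circle_measure (E n) \<le> ennreal \<epsilon>" for n
  proof -
    have "emeasure circle_measure (E n) \<le> ennreal (15 / \<delta>\<^sup>2 * (\<integral>\<zeta>. cmod ((T (of_real (radius n) * \<zeta>))\<^sup>2) \<partial>circle_measure))"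
      unfolding E_def using \<epsilon> by (intro radial_maximal_weak_type[where F = "\<lambda>z. (T (of_real (radius n) * z))\<^sup>2"] cT) auto
    also have "\<dots> \<le> ennreal (15 / \<delta>\<^sup>2 * e)"
      using Tint[OF radius_bounds, of n] \<epsilon> by (intro ennreal_leI mult_left_mono) (auto simp: norm_power)
    also have "15 / \<delta>\<^sup>2 * e = \<epsilon>" using \<epsilon> by (simp add: e_def)
    finally show ?thesis .
  qed
  have E_sets: "range E \<subseteq> sets circle_measure"
  proof clarify
    fix n
    show "E n \<in> sets circle_measure"
      unfolding E_def by (intro openin_circle_measurable openin_radial_sup continuous_on_subset[OF cT(1)]) auto
  qed
  have "incseq E"
  proof (rule incseq_SucI)
    fix n
    show "E n \<subseteq> E (Suc n)"
    proof
      fix \<zeta> assume "\<zeta> \<in> E n"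
      then obtain r where z: "\<zeta> \<in> sphere 0 1" and r: "0 < r" "r < 1" "\<delta>\<^sup>2 < cmod ((T (of_real (radius n) * (of_real r * \<zeta>)))\<^sup>2)"
        by (auto simp: E_def)
      define r' where "r' = radius n * r / radius (Suc n)"
      have le: "radius n \<le> radius (Suc n)" by (simp add: radius_def field_simps)
      have "radius n * r < radius (Suc n) * 1"
        using le r radius_bounds[of n] radius_bounds[of "Suc n"] by (intro mult_le_less_imp_less) auto
      then have "0 < r'" "r' < 1" using radius_bounds[of n] radius_bounds[of "Suc n"] r by (auto simp: r'_def)
      moreover have "radius (Suc n) * r' = radius n * r"
        using radius_bounds[of "Suc n"] by (simp add: r'_def)
      then have "of_real (radius (Suc n)) * (of_real r' * \<zeta>) = of_real (radius n) * (of_real r * \<zeta>)"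
        by (metis mult.assoc of_real_mult)
      then have "\<delta>\<^sup>2 < cmod ((T (of_real (radius (Suc n)) * (of_real r' * \<zeta>)))\<^sup>2)"
        using r(3) by (simp only:)
      ultimately show "\<zeta> \<in> E (Suc n)" using z by (auto simp: E_def intro!: bexI[of _ r'])
    qed
  qed
  then have "emeasure circle_measure (\<Union>n. E n) = (SUP n. emeasure circle_measure (E n))"
    using E_sets by (intro SUP_emeasure_incseq[symmetric])
  also have "\<dots> \<le> ennreal \<epsilon>" by (intro SUP_least E_le)
  also have "(\<Union>n. E n) = {\<zeta>\<in>sphere 0 1. \<exists>r\<in>{0<..<1}. \<delta> < cmod (T (of_real r * \<zeta>))}" (is "?L = ?R")
  proof (intro equalityI subsetI)
    fix \<zeta> assume "\<zeta> \<in> ?L"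
    then obtain n r where z: "\<zeta> \<in> sphere 0 1" and r: "0 < r" "r < 1" "\<delta>\<^sup>2 < (cmod (T (of_real (radius n) * (of_real r * \<zeta>))))\<^sup>2"
      by (auto simp: E_def norm_power)
    have "\<delta> < cmod (T (of_real (radius n) * (of_real r * \<zeta>)))" using r(3) by (rule power2_less_imp_less) simp
    then have "\<delta> < cmod (T (of_real (radius n * r) * \<zeta>))" by (simp add: mult.assoc)
    moreover have "0 < radius n * r" using r radius_bounds[of n] by simp
    moreover have "radius n * r < 1 * 1" using r radius_bounds[of n] by (intro mult_strict_mono) auto
    then have "radius n * r < 1" by simp
    ultimately show "\<zeta> \<in> ?R" using z by (auto intro!: bexI[of _ "radius n * r"])
  next
    fix \<zeta> assume "\<zeta> \<in> ?R"
    then obtain r where z: "\<zeta> \<in> sphere 0 1" and r: "0 < r" "r < 1" "\<delta> < cmod (T (of_real r * \<zeta>))" by auto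
    have "\<forall>\<^sub>F n in sequentially. r < radius n"
      using order_tendstoD(1)[OF radius_tendsto r(2)] .
    then obtain n where n: "r < radius n" by (auto simp: eventually_sequentially)
    define r' where "r' = r / radius n"
    have "0 < r'" "r' < 1" using n r radius_bounds[of n] by (auto simp: r'_def)
    moreover have "radius n * r' = r" using radius_bounds[of n] by (simp add: r'_def)
    then have "of_real (radius n) * (of_real r' * \<zeta>) = of_real r * \<zeta>"
      by (metis mult.assoc of_real_mult)
    moreover have "\<delta>\<^sup>2 < (cmod (T (of_real r * \<zeta>)))\<^sup>2" using r \<epsilon> by (intro power_strict_mono) auto
    ultimately have "\<delta>\<^sup>2 < cmod ((T (of_real (radius n) * (of_real r' * \<zeta>)))\<^sup>2)"
      by (simp only: norm_power)
    then have "\<zeta> \<in> E n" using z \<open>0 < r'\<close> \<open>r' < 1\<close> by (auto simp: E_def intro!: bexI[of _ r'])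
    then show "\<zeta> \<in> ?L" by auto
  qed
  finally show ?thesis unfolding T_def by (rule that)
qed

text \<open>A polynomial converges along every radius, and the deviation from it is small off a set
  of small measure. So for each k the set where the oscillation near the circle stays above 1 / (k +
  1) is null, and elsewhere the Cauchy criterion gives the limit.\<close>

lemma fatou_bounded:
  assumes w: "w holomorphic_on ball 0 1" and M: "\<And>z. cmod z < 1 \<Longrightarrow> cmod (w z) \<le> M"
  shows "AE \<zeta> in circle_measure. \<exists>l. ((\<lambda>r. w (of_real r * \<zeta>)) \<longlongrightarrow> l) (at_left 1)"
proof -
  have cw: "continuous_on (ball 0 1) w" using w by (rule holomorphic_on_imp_continuous_on)
  define D where "D k n = {\<zeta>\<in>sphere 0 1. \<exists>r\<in>{radius n<..<1}. \<exists>s\<in>{radius n<..<1}.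
    inverse (real (Suc k)) < cmod (w (of_real r * \<zeta>) - w (of_real s * \<zeta>))}" for k n
  have "openin (top_of_set (sphere 0 1)) (D k n)" for k n
  proof -
    define V where "V r s = sphere 0 1 \<inter> (\<lambda>\<zeta>. cmod (w (of_real r * \<zeta>) - w (of_real s * \<zeta>))) -` {inverse (real (Suc k))<..}" for r s :: real
    have "openin (top_of_set (sphere 0 1)) (V r s)" if "r \<in> {radius n<..<1}" "s \<in> {radius n<..<1}" for r s
      unfolding V_def using that radius_bounds[of n]
      by (intro continuous_openin_preimage_gen continuous_intros continuous_on_compose2[OF cw])
        (auto simp: norm_mult)
    then have "openin (top_of_set (sphere 0 1)) (\<Union>r\<in>{radius n<..<1}. \<Union>s\<in>{radius n<..<1}. V r s)"
      by (intro openin_Union) (auto intro!: openin_Union)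
    moreover have "(\<Union>r\<in>{radius n<..<1}. \<Union>s\<in>{radius n<..<1}. V r s) = D k n"
      by (auto simp: D_def V_def)
    ultimately show ?thesis by simp
  qed
  then have D_sets: "D k n \<in> sets circle_measure" for k n by (rule openin_circle_measurable)
  have "(\<Inter>n. D k n) \<in> null_sets circle_measure" for k
  proof -
    have "emeasure circle_measure (\<Inter>n. D k n) \<le> 0 + ennreal \<epsilon>" if \<epsilon>: "0 < \<epsilon>" for \<epsilon>
    proof -
      \<comment> \<open>A quarter, because the oscillation is split into two deviations from P and
        two deviations of P from its boundary value.\<close>
      define \<delta> where "\<delta> = inverse (real (Suc k)) / 4"
      have \<delta>: "0 < \<delta>" by (simp add: \<delta>_def)
      obtain P :: "complex poly" where P: "emeasure circle_measure {\<zeta>\<in>sphere 0 1. \<exists>r\<in>{0<..<1}. \<delta> < cmod (w (of_real r * \<zeta>) - poly P (of_real r * \<zeta>))} \<le> ennreal \<epsilon>"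
        using small_radial_deviation_from_polynomial[OF w M \<epsilon> \<delta>] by blast
      have "(\<Inter>n. D k n) \<subseteq> {\<zeta>\<in>sphere 0 1. \<exists>r\<in>{0<..<1}. \<delta> < cmod (w (of_real r * \<zeta>) - poly P (of_real r * \<zeta>))}"
      proof (rule ccontr)
        assume "\<not> ?thesis"
        then obtain \<zeta> where \<zeta>: "\<zeta> \<in> D k n" and nin: "\<zeta> \<notin> {\<zeta>\<in>sphere 0 1. \<exists>r\<in>{0<..<1}. \<delta> < cmod (w (of_real r * \<zeta>) - poly P (of_real r * \<zeta>))}" for n
          by blast
        have "\<zeta> \<in> sphere 0 1" using \<zeta>[of 0] by (simp add: D_def)
        then have le: "cmod (w (of_real r * \<zeta>) - poly P (of_real r * \<zeta>)) \<le> \<delta>" if "0 < r" "r < 1" for r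
          using nin that by (auto simp: not_less)
        have "((\<lambda>r. poly P (of_real r * \<zeta>)) \<longlongrightarrow> poly P (of_real 1 * \<zeta>)) (at_left 1)"
          by (intro tendsto_intros)
        then have "\<forall>\<^sub>F r in at_left 1. dist (poly P (of_real r * \<zeta>)) (poly P \<zeta>) < \<delta>"
          using \<delta> by (simp add: tendsto_iff)
        then obtain b where b: "b < 1" "\<And>r. b < r \<Longrightarrow> r < 1 \<Longrightarrow> dist (poly P (of_real r * \<zeta>)) (poly P \<zeta>) < \<delta>"
          unfolding eventually_at_left_field by blast
        obtain n where n: "b < radius n"
          using order_tendstoD(1)[OF radius_tendsto b(1)] by (auto simp: eventually_sequentially)
        obtain r s where r: "radius n < r" "r < 1" and s: "radius n < s" "s < 1"
          and gt: "inverse (real (Suc k)) < cmod (w (of_real r * \<zeta>) - w (of_real s * \<zeta>))"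
          using \<zeta>[of n] by (auto simp: D_def)
        have "cmod (w (of_real r * \<zeta>) - w (of_real s * \<zeta>)) \<le>
          cmod (w (of_real r * \<zeta>) - poly P (of_real r * \<zeta>)) + dist (poly P (of_real r * \<zeta>)) (poly P \<zeta>) +
          dist (poly P (of_real s * \<zeta>)) (poly P \<zeta>) + cmod (w (of_real s * \<zeta>) - poly P (of_real s * \<zeta>))"
          unfolding dist_norm by norm
        also have "\<dots> \<le> \<delta> + \<delta> + \<delta> + \<delta>"
          using le[of r] le[of s] b(2)[of r] b(2)[of s] n r s radius_bounds[of n] by (intro add_mono) auto
        finally show False using gt by (simp add: \<delta>_def)
      qed
      then have "emeasure circle_measure (\<Inter>n. D k n) \<le> emeasure circle_measure {\<zeta>\<in>sphere 0 1. \<exists>r\<in>{0<..<1}. \<delta> < cmod (w (of_real r * \<zeta>) - poly P (of_real r * \<zeta>))}"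
        by (intro emeasure_mono openin_circle_measurable openin_radial_sup[where F = "\<lambda>z. w z - poly P z"] continuous_intros cw)
      then show ?thesis using P by simp
    qed
    then have "emeasure circle_measure (\<Inter>n. D k n) \<le> 0" by (rule ennreal_le_epsilon)
    moreover have "(\<Inter>n. D k n) \<in> sets circle_measure" using D_sets by (intro sets.countable_INT) auto
    ultimately show ?thesis by (intro null_setsI) auto
  qed
  then have "AE \<zeta> in circle_measure. \<forall>k. \<zeta> \<notin> (\<Inter>n. D k n)"
    by (intro AE_all_countable[THEN iffD2] allI AE_not_in)
  then show ?thesis
    using AE_space
  proof eventually_elim
    case (elim \<zeta>)
    have "\<exists>b<1. \<forall>r s. b < r \<and> r < 1 \<and> b < s \<and> s < 1 \<longrightarrow> cmod (w (of_real r * \<zeta>) - w (of_real s * \<zeta>)) < e" if e: "0 < e" for e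
    proof -
      obtain k where k: "inverse (real (Suc k)) < e" using reals_Archimedean[OF e] by blast
      obtain n where "\<zeta> \<notin> D k n" using elim by blast
      then have "cmod (w (of_real r * \<zeta>) - w (of_real s * \<zeta>)) \<le> inverse (real (Suc k))"
        if "radius n < r" "r < 1" "radius n < s" "s < 1" for r s
        using that elim(2) by (auto simp: D_def not_less)
      then show ?thesis
        using k radius_bounds[of n] by (intro exI[of _ "radius n"]) (meson order_le_less_trans)
    qed
    note osc = this
    have "cauchy_filter (filtermap (\<lambda>r. w (of_real r * \<zeta>)) (at_left 1))"
      unfolding cauchy_filter_metric_filtermap
    proof (intro allI impI)
      fix e :: real assume "0 < e"
      from osc[OF this] obtain b where b: "b < 1"
        "\<forall>r s. b < r \<and> r < 1 \<and> b < s \<and> s < 1 \<longrightarrow> cmod (w (of_real r * \<zeta>) - w (of_real s * \<zeta>)) < e" by blast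
      have "\<forall>\<^sub>F r in at_left 1. b < r \<and> r < 1"
        using eventually_at_left_real[OF b(1)] by simp
      then show "\<exists>P. eventually P (at_left 1) \<and> (\<forall>x y. P x \<and> P y \<longrightarrow> dist (w (of_real x * \<zeta>)) (w (of_real y * \<zeta>)) < e)"
        using b(2) unfolding dist_norm by (intro exI[of _ "\<lambda>r. b < r \<and> r < 1"]) blast
    qed
    moreover have "filtermap (\<lambda>r. w (of_real r * \<zeta>)) (at_left (1::real)) \<noteq> bot"
      by (simp add: filtermap_bot_iff)
    ultimately obtain l where "filtermap (\<lambda>r. w (of_real r * \<zeta>)) (at_left 1) \<le> nhds l"
      using complete_UNIV[unfolded complete_uniform] by auto
    then show ?case by (auto simp: filterlim_def)
  qed
qed


subsection \<open>The norm inequality\<close>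

text \<open>A measurable substitute for \<^const>\<open>radial_limit\<close>; both agree wherever the radial limit exists.\<close>

definition seq_limit :: "(complex \<Rightarrow> complex) \<Rightarrow> complex \<Rightarrow> complex" where
  "seq_limit G \<zeta> = lim (\<lambda>n. G (of_real (radius n) * \<zeta>))"

lemma radial_tendsto_imp:
  assumes "((\<lambda>r. G (of_real r * \<zeta>)) \<longlongrightarrow> l) (at_left 1)"
  shows "(\<lambda>n. G (of_real (radius n) * \<zeta>)) \<longlonglongrightarrow> l" "seq_limit G \<zeta> = l" "radial_limit G \<zeta> = l"
proof -
  show "(\<lambda>n. G (of_real (radius n) * \<zeta>)) \<longlonglongrightarrow> l"
    by (rule filterlim_compose[OF assms radius_at_left])
  then show "seq_limit G \<zeta> = l" unfolding seq_limit_def by (rule limI)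
  show "radial_limit G \<zeta> = l" unfolding radial_limit_def by (rule tendsto_Lim[OF _ assms]) simp
qed

lemma continuous_on_radius_scaled:
  fixes G :: "complex \<Rightarrow> complex"
  assumes "continuous_on (ball 0 1) G"
  shows "continuous_on (cball 0 1) (\<lambda>z. G (of_real (radius n) * z))"
  by (rule continuous_on_compose2[OF assms]) (use scale_in_ball[OF radius_bounds] in \<open>auto intro!: continuous_intros\<close>)

lemma holomorphic_on_radius_scaled:
  assumes "G holomorphic_on ball 0 1"
  shows "(\<lambda>z. G (of_real (radius n) * z)) holomorphic_on ball 0 1"
  by (rule holomorphic_on_compose_gen[OF _ assms, unfolded o_def])
    (use scale_in_ball[OF radius_bounds, of _ n] in \<open>force intro!: holomorphic_intros\<close>)+

lemma borel_measurable_radius_scaled: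
  fixes G :: "complex \<Rightarrow> complex"
  assumes "continuous_on (ball 0 1) G"
  shows "(\<lambda>\<zeta>. G (of_real (radius n) * \<zeta>)) \<in> borel_measurable circle_measure"
  by (intro borel_measurable_circle_continuous continuous_on_subset[OF continuous_on_radius_scaled[OF assms]]) auto

lemma borel_measurable_seq_limit:
  assumes "continuous_on (ball 0 1) G"
  shows "seq_limit G \<in> borel_measurable circle_measure"
  unfolding seq_limit_def[abs_def]
  by (intro borel_measurable_lim_metric borel_measurable_radius_scaled assms)

lemma borel_measurable_cmod_add_cnj_powr:
  assumes [measurable]: "f \<in> borel_measurable M" "g \<in> borel_measurable M"
  shows "(\<lambda>x. cmod (f x + cnj (g x)) powr p) \<in> borel_measurable M"
proof -
  have [measurable]: "cnj \<in> borel_measurable borel"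
    by (intro borel_measurable_continuous_onI continuous_intros)
  show ?thesis by measurable
qed

text \<open>On a smaller circle the pointwise inequality is integrated and the correction is
  dropped, its mean being nonnegative for the product of \<open>G\<close> and \<open>H\<close>.
  Boundedness provides the dominating functions for the passage to the boundary on both
  sides.\<close>

lemma bounded_inequality:
  fixes p b :: real
  assumes p: "1 \<le> p" "p \<le> 2" and b: "0 < b"
    and G: "G holomorphic_on ball 0 1" "\<And>z. cmod z < 1 \<Longrightarrow> cmod (G z) \<le> M"
    and H: "H holomorphic_on ball 0 1" "\<And>z. cmod z < 1 \<Longrightarrow> cmod (H z) \<le> M"
    and 0: "Re (G 0 * H 0) \<le> 0"
  shows "(\<integral>\<^sup>+\<zeta>. ennreal (cmod (seq_limit G \<zeta> + cnj (seq_limit H \<zeta>)) powr p) \<partial>circle_measure) \<le>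
    ennreal (A_const p b powr p) * (\<integral>\<^sup>+\<zeta>. ennreal (((cmod (seq_limit G \<zeta>))\<^sup>2 + b * (cmod (seq_limit H \<zeta>))\<^sup>2) powr (p / 2)) \<partial>circle_measure)"
proof -
  define A where "A = A_const p b powr p"
  have A0: "0 \<le> A" by (simp add: A_def)
  obtain D where D: "0 \<le> D" "\<And>z w. cmod (z + cnj w) powr p + D * sub_pow (p / 2) (z * w)
    \<le> A * ((cmod z)\<^sup>2 + b * (cmod w)\<^sup>2) powr (p / 2)"
    using pointwise_inequality[OF p b] unfolding A_def by blast
  have M0: "0 \<le> M" using order_trans[OF norm_ge_zero G(2)[of 0]] by simp
  note cG = holomorphic_on_imp_continuous_on[OF G(1)] and cH = holomorphic_on_imp_continuous_on[OF H(1)]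
  define Gn where "Gn n \<zeta> = G (of_real (radius n) * \<zeta>)" for n \<zeta>
  define Hn where "Hn n \<zeta> = H (of_real (radius n) * \<zeta>)" for n \<zeta>
  have cGn: "continuous_on (cball 0 1) (Gn n)" "continuous_on (cball 0 1) (Hn n)" for n
    unfolding Gn_def Hn_def by (intro continuous_on_radius_scaled cG cH)+
  have cGs: "continuous_on (sphere 0 1) (Gn n)" "continuous_on (sphere 0 1) (Hn n)" for n
    by (rule continuous_on_subset[OF cGn(1)], simp) (rule continuous_on_subset[OF cGn(2)], simp)
  have bd: "cmod (Gn n \<zeta>) \<le> M" "cmod (Hn n \<zeta>) \<le> M" if "\<zeta> \<in> space circle_measure" for n \<zeta>
    using G(2) H(2) scale_in_ball[OF radius_bounds, of \<zeta> n] that by (auto simp: Gn_def Hn_def)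
  define u where "u z w = cmod (z + cnj w) powr p" for z w
  define v where "v z w = ((cmod z)\<^sup>2 + b * (cmod w)\<^sup>2) powr (p / 2)" for z w
  have cu: "continuous_on S (\<lambda>x. u (f x) (g x))" if "continuous_on S f" "continuous_on S g" for S f g
    unfolding u_def by (intro continuous_on_powr' continuous_intros that) (use p in auto)
  have cv: "continuous_on S (\<lambda>x. v (f x) (g x))" if "continuous_on S f" "continuous_on S g" for S f g
    unfolding v_def by (intro continuous_on_powr' continuous_intros that) (use p b in \<open>auto intro!: add_nonneg_nonneg\<close>)
  have tu: "(\<lambda>n. u (f n) (g n)) \<longlonglongrightarrow> u x y" if "f \<longlonglongrightarrow> x" "g \<longlonglongrightarrow> y" for f g x y
    unfolding u_def by (intro tendsto_powr' tendsto_intros that) (use p in auto)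
  have tv: "(\<lambda>n. v (f n) (g n)) \<longlonglongrightarrow> v x y" if "f \<longlonglongrightarrow> x" "g \<longlonglongrightarrow> y" for f g x y
    unfolding v_def by (intro tendsto_powr' tendsto_intros that) (use p b in \<open>auto intro!: add_nonneg_nonneg\<close>)
  have step: "(\<integral>\<zeta>. u (Gn n \<zeta>) (Hn n \<zeta>) \<partial>circle_measure) \<le> A * (\<integral>\<zeta>. v (Gn n \<zeta>) (Hn n \<zeta>) \<partial>circle_measure)" for n
  proof -
    have iu: "integrable circle_measure (\<lambda>\<zeta>. u (Gn n \<zeta>) (Hn n \<zeta>))" by (intro integrable_circle_continuous cu cGs)
    have iv: "integrable circle_measure (\<lambda>\<zeta>. v (Gn n \<zeta>) (Hn n \<zeta>))" by (intro integrable_circle_continuous cv cGs)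
    have isp: "integrable circle_measure (\<lambda>\<zeta>. sub_pow (p / 2) (Gn n \<zeta> * Hn n \<zeta>))"
      using p by (intro integrable_circle_continuous continuous_intros cGs) auto
    have "0 \<le> (\<integral>\<zeta>. sub_pow (p / 2) (Gn n \<zeta> * Hn n \<zeta>) \<partial>circle_measure)"
    proof (rule sub_pow_mean_nonneg)
      show "continuous_on (cball 0 1) (\<lambda>\<zeta>. Gn n \<zeta> * Hn n \<zeta>)" by (intro continuous_intros cGn)
      show "(\<lambda>\<zeta>. Gn n \<zeta> * Hn n \<zeta>) holomorphic_on ball 0 1"
        unfolding Gn_def Hn_def by (intro holomorphic_intros holomorphic_on_radius_scaled G H)
      show "Re (Gn n 0 * Hn n 0) \<le> 0" using 0 by (simp add: Gn_def Hn_def)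
    qed (use p in auto)
    then have "(\<integral>\<zeta>. u (Gn n \<zeta>) (Hn n \<zeta>) \<partial>circle_measure) \<le>
      (\<integral>\<zeta>. u (Gn n \<zeta>) (Hn n \<zeta>) \<partial>circle_measure) + D * (\<integral>\<zeta>. sub_pow (p / 2) (Gn n \<zeta> * Hn n \<zeta>) \<partial>circle_measure)"
      using D(1) by simp
    also have "\<dots> = (\<integral>\<zeta>. u (Gn n \<zeta>) (Hn n \<zeta>) + D * sub_pow (p / 2) (Gn n \<zeta> * Hn n \<zeta>) \<partial>circle_measure)"
      using iu isp by simp
    also have "\<dots> \<le> (\<integral>\<zeta>. A * v (Gn n \<zeta>) (Hn n \<zeta>) \<partial>circle_measure)"
      using iu isp iv D(2) by (intro integral_mono) (auto simp: u_def v_def)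
    finally show ?thesis by simp
  qed
  have ae: "AE \<zeta> in circle_measure. (\<lambda>n. Gn n \<zeta>) \<longlonglongrightarrow> seq_limit G \<zeta> \<and> (\<lambda>n. Hn n \<zeta>) \<longlonglongrightarrow> seq_limit H \<zeta>"
  proof -
    have "AE \<zeta> in circle_measure. \<exists>l. ((\<lambda>r. G (of_real r * \<zeta>)) \<longlongrightarrow> l) (at_left 1)"
      "AE \<zeta> in circle_measure. \<exists>l. ((\<lambda>r. H (of_real r * \<zeta>)) \<longlongrightarrow> l) (at_left 1)"
      by (rule fatou_bounded[OF G], assumption) (rule fatou_bounded[OF H], assumption)
    then show ?thesis
    proof eventually_elim
      case (elim \<zeta>)
      then obtain l l' where "((\<lambda>r. G (of_real r * \<zeta>)) \<longlongrightarrow> l) (at_left 1)" "((\<lambda>r. H (of_real r * \<zeta>)) \<longlongrightarrow> l') (at_left 1)" by blast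
      from radial_tendsto_imp[OF this(1)] radial_tendsto_imp[OF this(2)] show ?case
        by (simp add: Gn_def Hn_def)
    qed
  qed
  have mG[measurable]: "seq_limit G \<in> borel_measurable circle_measure" "seq_limit H \<in> borel_measurable circle_measure"
    by (intro borel_measurable_seq_limit cG cH)+
  have mu: "(\<lambda>\<zeta>. u (seq_limit G \<zeta>) (seq_limit H \<zeta>)) \<in> borel_measurable circle_measure"
    unfolding u_def by (intro borel_measurable_cmod_add_cnj_powr mG)
  have mv: "(\<lambda>\<zeta>. v (seq_limit G \<zeta>) (seq_limit H \<zeta>)) \<in> borel_measurable circle_measure"
    unfolding v_def by measurable
  have bu: "norm (u (Gn n \<zeta>) (Hn n \<zeta>)) \<le> (M + M) powr p" if "\<zeta> \<in> space circle_measure" for n \<zeta>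
  proof -
    have "cmod (Gn n \<zeta> + cnj (Hn n \<zeta>)) \<le> M + M"
      using bd[OF that, of n] norm_triangle_ineq[of "Gn n \<zeta>" "cnj (Hn n \<zeta>)"] by simp
    then show ?thesis unfolding u_def using p by (simp add: powr_mono2)
  qed
  have bv: "norm (v (Gn n \<zeta>) (Hn n \<zeta>)) \<le> (M\<^sup>2 + b * M\<^sup>2) powr (p / 2)" if "\<zeta> \<in> space circle_measure" for n \<zeta>
    unfolding v_def using p b bd[OF that, of n] M0
    by (auto intro!: powr_mono2 add_mono power_mono mult_left_mono add_nonneg_nonneg)
  have ae_u: "AE \<zeta> in circle_measure. (\<lambda>n. u (Gn n \<zeta>) (Hn n \<zeta>)) \<longlonglongrightarrow> u (seq_limit G \<zeta>) (seq_limit H \<zeta>)"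
    using ae by eventually_elim (intro tu; simp)
  have ae_v: "AE \<zeta> in circle_measure. (\<lambda>n. v (Gn n \<zeta>) (Hn n \<zeta>)) \<longlonglongrightarrow> v (seq_limit G \<zeta>) (seq_limit H \<zeta>)"
    using ae by eventually_elim (intro tv; simp)
  have lim_u: "(\<lambda>n. \<integral>\<zeta>. u (Gn n \<zeta>) (Hn n \<zeta>) \<partial>circle_measure) \<longlonglongrightarrow> (\<integral>\<zeta>. u (seq_limit G \<zeta>) (seq_limit H \<zeta>) \<partial>circle_measure)"
    by (rule integral_dominated_convergence[where w = "\<lambda>_. (M + M) powr p", OF mu])
      (intro ae_u AE_I2 bu borel_measurable_circle_continuous cu cGs circle.integrable_const | assumption)+
  have lim_v: "(\<lambda>n. \<integral>\<zeta>. v (Gn n \<zeta>) (Hn n \<zeta>) \<partial>circle_measure) \<longlonglongrightarrow> (\<integral>\<zeta>. v (seq_limit G \<zeta>) (seq_limit H \<zeta>) \<partial>circle_measure)"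
    by (rule integral_dominated_convergence[where w = "\<lambda>_. (M\<^sup>2 + b * M\<^sup>2) powr (p / 2)", OF mv])
      (intro ae_v AE_I2 bv borel_measurable_circle_continuous cv cGs circle.integrable_const | assumption)+
  have int_u: "integrable circle_measure (\<lambda>\<zeta>. u (seq_limit G \<zeta>) (seq_limit H \<zeta>))"
    by (rule integrable_dominated_convergence[where w = "\<lambda>_. (M + M) powr p" and s = "\<lambda>n \<zeta>. u (Gn n \<zeta>) (Hn n \<zeta>)", OF mu])
      (intro ae_u AE_I2 bu borel_measurable_circle_continuous cu cGs circle.integrable_const | assumption)+
  have int_v: "integrable circle_measure (\<lambda>\<zeta>. v (seq_limit G \<zeta>) (seq_limit H \<zeta>))"
    by (rule integrable_dominated_convergence[where w = "\<lambda>_. (M\<^sup>2 + b * M\<^sup>2) powr (p / 2)" and s = "\<lambda>n \<zeta>. v (Gn n \<zeta>) (Hn n \<zeta>)", OF mv])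
      (intro ae_v AE_I2 bv borel_measurable_circle_continuous cv cGs circle.integrable_const | assumption)+
  have "(\<integral>\<zeta>. u (seq_limit G \<zeta>) (seq_limit H \<zeta>) \<partial>circle_measure) \<le> A * (\<integral>\<zeta>. v (seq_limit G \<zeta>) (seq_limit H \<zeta>) \<partial>circle_measure)"
    using step by (intro LIMSEQ_le[OF lim_u tendsto_mult_left[OF lim_v]]) auto
  then have "ennreal (\<integral>\<zeta>. u (seq_limit G \<zeta>) (seq_limit H \<zeta>) \<partial>circle_measure) \<le> ennreal A * ennreal (\<integral>\<zeta>. v (seq_limit G \<zeta>) (seq_limit H \<zeta>) \<partial>circle_measure)"
    using A0 by (simp add: ennreal_mult'[symmetric] ennreal_leI)
  moreover have "(\<integral>\<^sup>+\<zeta>. ennreal (u (seq_limit G \<zeta>) (seq_limit H \<zeta>)) \<partial>circle_measure) = ennreal (\<integral>\<zeta>. u (seq_limit G \<zeta>) (seq_limit H \<zeta>) \<partial>circle_measure)"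
    by (rule nn_integral_eq_integral[OF int_u]) (simp add: u_def)
  moreover have "(\<integral>\<^sup>+\<zeta>. ennreal (v (seq_limit G \<zeta>) (seq_limit H \<zeta>)) \<partial>circle_measure) = ennreal (\<integral>\<zeta>. v (seq_limit G \<zeta>) (seq_limit H \<zeta>) \<partial>circle_measure)"
    by (rule nn_integral_eq_integral[OF int_v]) (simp add: v_def)
  ultimately show ?thesis unfolding u_def v_def A_def by simp
qed

text \<open>The bounded function 1 / k has radial limits almost everywhere, and it remains to see
  that they are nonzero. As the real part of the holomorphic Ln k, the nonnegative function ln |k|
  has the same mean ln |k 0| on all circles, so by Fatou's lemma its lower limit is finite almost
  everywhere.\<close>

lemma radial_limit_ae_Re_ge_1:
  assumes k: "k holomorphic_on ball 0 1" "\<And>z. cmod z < 1 \<Longrightarrow> 1 \<le> Re (k z)"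
  shows "AE \<zeta> in circle_measure. \<exists>l. ((\<lambda>r. k (of_real r * \<zeta>)) \<longlongrightarrow> l) (at_left 1)"
proof -
  note ck = holomorphic_on_imp_continuous_on[OF k(1)]
  have nz: "k z \<noteq> 0" and cm: "1 \<le> cmod (k z)" if "cmod z < 1" for z
    using k(2)[OF that] complex_Re_le_cmod[of "k z"] by auto
  have w: "(\<lambda>z. inverse (k z)) holomorphic_on ball 0 1"
    using nz by (intro holomorphic_intros k) auto
  have "cmod (inverse (k z)) \<le> 1" if "cmod z < 1" for z
    using cm[OF that] by (simp add: norm_inverse inverse_le_1_iff)
  from fatou_bounded[OF w this]
  have ae1: "AE \<zeta> in circle_measure. \<exists>l. ((\<lambda>r. inverse (k (of_real r * \<zeta>))) \<longlongrightarrow> l) (at_left 1)" .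
  define kn where "kn n \<zeta> = k (of_real (radius n) * \<zeta>)" for n \<zeta>
  have rz: "cmod (of_real (radius n) * \<zeta>) < 1" if "cmod \<zeta> \<le> 1" for n \<zeta>
    using scale_in_ball[OF radius_bounds that, of n] by simp
  have ckn: "continuous_on (cball 0 1) (kn n)" for n unfolding kn_def by (intro continuous_on_radius_scaled ck)
  have hkn: "kn n holomorphic_on ball 0 1" for n unfolding kn_def by (intro holomorphic_on_radius_scaled k)
  have Rekn: "1 \<le> Re (kn n \<zeta>)" if "cmod \<zeta> \<le> 1" for n \<zeta> using k(2)[OF rz[OF that]] by (simp add: kn_def)
  have nR: "kn n \<zeta> \<notin> \<real>\<^sub>\<le>\<^sub>0" "kn n \<zeta> \<noteq> 0" "1 \<le> cmod (kn n \<zeta>)" if "cmod \<zeta> \<le> 1" for n \<zeta>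
    using Rekn[OF that, of n] complex_Re_le_cmod[of "kn n \<zeta>"] by (auto simp: complex_nonpos_Reals_iff)
  have cLn: "continuous_on (cball 0 1) (\<lambda>\<zeta>. Ln (kn n \<zeta>))" for n
    by (intro continuous_intros ckn) (use nR in auto)
  have cln: "continuous_on (sphere 0 1) (\<lambda>\<zeta>. ln (cmod (kn n \<zeta>)))" for n
    by (intro continuous_intros continuous_on_subset[OF ckn]) (use nR in auto)
  have val: "(\<integral>\<^sup>+\<zeta>. ennreal (ln (cmod (kn n \<zeta>))) \<partial>circle_measure) = ennreal (ln (cmod (k 0)))" for n
  proof -
    have iL: "integrable circle_measure (\<lambda>\<zeta>. Ln (kn n \<zeta>))"
      by (intro integrable_circle_continuous continuous_on_subset[OF cLn]) auto
    have "(\<integral>\<zeta>. Ln (kn n \<zeta>) \<partial>circle_measure) = Ln (kn n 0)"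
      by (intro circle_mean_value cLn holomorphic_intros hkn) (use nR in auto)
    then have "Re (\<integral>\<zeta>. Ln (kn n \<zeta>) \<partial>circle_measure) = ln (cmod (k 0))"
      using nz[of 0] by (simp add: kn_def)
    then have "(\<integral>\<zeta>. Re (Ln (kn n \<zeta>)) \<partial>circle_measure) = ln (cmod (k 0))" using integral_Re[OF iL] by simp
    also have "(\<integral>\<zeta>. Re (Ln (kn n \<zeta>)) \<partial>circle_measure) = (\<integral>\<zeta>. ln (cmod (kn n \<zeta>)) \<partial>circle_measure)"
      by (intro Bochner_Integration.integral_cong refl) (use nR in auto)
    finally have "(\<integral>\<zeta>. ln (cmod (kn n \<zeta>)) \<partial>circle_measure) = ln (cmod (k 0))" .
    then show ?thesis
      using nR by (subst nn_integral_eq_integral) (auto intro!: integrable_circle_continuous cln AE_I2)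
  qed
  have mln: "(\<lambda>\<zeta>. ennreal (ln (cmod (kn n \<zeta>)))) \<in> borel_measurable circle_measure" for n
    using borel_measurable_circle_continuous[OF cln] by measurable
  have "(\<integral>\<^sup>+\<zeta>. liminf (\<lambda>n. ennreal (ln (cmod (kn n \<zeta>)))) \<partial>circle_measure) \<le>
    liminf (\<lambda>n. \<integral>\<^sup>+\<zeta>. ennreal (ln (cmod (kn n \<zeta>))) \<partial>circle_measure)"
    by (intro nn_integral_liminf mln)
  also have "\<dots> < \<infinity>" by (simp add: val Liminf_const)
  finally have "AE \<zeta> in circle_measure. liminf (\<lambda>n. ennreal (ln (cmod (kn n \<zeta>)))) \<noteq> \<infinity>"
    using mln by (intro nn_integral_PInf_AE) auto
  with ae1 AE_space show ?thesis
  proof eventually_elim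
    case (elim \<zeta>)
    then have z: "cmod \<zeta> \<le> 1" by simp
    from elim obtain l where l: "((\<lambda>r. inverse (k (of_real r * \<zeta>))) \<longlongrightarrow> l) (at_left 1)" by blast
    have "l \<noteq> 0"
    proof
      assume "l = 0"
      then have "(\<lambda>n. inverse (kn n \<zeta>)) \<longlonglongrightarrow> 0"
        using radial_tendsto_imp(1)[of "\<lambda>z. inverse (k z)", OF l] by (simp add: kn_def)
      then have "filterlim (\<lambda>n. inverse (kn n \<zeta>)) (at 0) sequentially"
        using nR[OF z] by (simp add: filterlim_at)
      then have "filterlim (\<lambda>n. kn n \<zeta>) at_infinity sequentially"
        by (simp only: filterlim_inverse_at_iff)
      then have "filterlim (\<lambda>n. cmod (kn n \<zeta>)) at_top sequentially"
        by (simp add: filterlim_at_infinity_conv_norm_at_top)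
      then have "filterlim (\<lambda>n. ln (cmod (kn n \<zeta>))) at_top sequentially"
        by (rule filterlim_compose[OF ln_at_top])
      then have "(\<lambda>n. ennreal (ln (cmod (kn n \<zeta>)))) \<longlonglongrightarrow> \<infinity>"
        by (simp add: ennreal_tendsto_top_eq_at_top)
      then have "liminf (\<lambda>n. ennreal (ln (cmod (kn n \<zeta>)))) = \<infinity>"
        by (intro lim_imp_Liminf) auto
      then show False using elim by simp
    qed
    then have "((\<lambda>r. inverse (inverse (k (of_real r * \<zeta>)))) \<longlongrightarrow> inverse l) (at_left 1)"
      by (intro tendsto_inverse l)
    then show ?case by auto
  qed
qed

text \<open>For Re k >= 0 the modulus of 1 + e k is at least 1 and at least e |k|: multiplying by
  the inverse enlarges nothing and makes k bounded.\<close>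

lemma norm_damping_factor:
  assumes "0 \<le> Re k" "0 < e"
  shows "cmod (inverse (1 + of_real e * k)) \<le> 1" "cmod (k * inverse (1 + of_real e * k)) \<le> 1 / e" "1 + of_real e * k \<noteq> 0"
proof -
  have Re: "1 \<le> Re (1 + of_real e * k)" using assms by simp
  then have 1: "1 \<le> cmod (1 + of_real e * k)" using complex_Re_le_cmod order_trans by blast
  then show nz: "1 + of_real e * k \<noteq> 0" by auto
  show "cmod (inverse (1 + of_real e * k)) \<le> 1" using 1 by (simp add: norm_inverse inverse_le_1_iff)
  have "(cmod (of_real e * k))\<^sup>2 \<le> (cmod (1 + of_real e * k))\<^sup>2"
    unfolding cmod_power2 using assms by (simp add: power2_sum)
  then have "cmod (of_real e * k) \<le> cmod (1 + of_real e * k)" by (rule power2_le_imp_le) simp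
  then have "e * cmod k \<le> cmod (1 + of_real e * k)" using assms by (simp add: norm_mult)
  then show "cmod (k * inverse (1 + of_real e * k)) \<le> 1 / e"
  proof -
    have "e * cmod k / cmod (1 + of_real e * k) \<le> 1"
      using \<open>e * cmod k \<le> _\<close> 1 by (simp add: divide_le_eq)
    then have "e * cmod (k * inverse (1 + of_real e * k)) \<le> 1"
      by (simp add: norm_mult norm_inverse divide_inverse mult.assoc)
    then show ?thesis using assms(2) by (simp add: field_simps del: norm_mult)
  qed
qed

text \<open>
  If \<open>Re H \<ge> 1 + |f|\<close>, then \<open>g\<close> and \<open>h\<close> are combinations of \<open>H\<close>, \<open>H + g + h\<close> and \<open>H + i (g - h)\<close>, whose real parts
  are at least 1. Multiplying by the product \<open>\<phi>\<close> of the factors \<open>1 / (1 + e k)\<close> makes \<open>g\<close> and \<open>h\<close> bounded and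
  does not increase their modulus; the unimodular constant \<open>\<gamma>\<close> makes the multiplier positive at the
  origin, which preserves the sign condition.
\<close>

lemma main_inequality:
  fixes p b :: real
  assumes p: "1 \<le> p" "p \<le> 2" and b: "0 < b"
    and g: "g holomorphic_on ball 0 1" and h: "h holomorphic_on ball 0 1" and 0: "Re (g 0 * h 0) \<le> 0"
    and K: "\<And>r. 0 < r \<Longrightarrow> r < 1 \<Longrightarrow> (\<integral>\<zeta>. cmod (g (of_real r * \<zeta>) + cnj (h (of_real r * \<zeta>))) \<partial>circle_measure) \<le> K"
  shows "(\<integral>\<^sup>+\<zeta>. ennreal (cmod (radial_limit g \<zeta> + cnj (radial_limit h \<zeta>)) powr p) \<partial>circle_measure) \<le>
    ennreal (A_const p b powr p) * (\<integral>\<^sup>+\<zeta>. ennreal (((cmod (radial_limit g \<zeta>))\<^sup>2 + b * (cmod (radial_limit h \<zeta>))\<^sup>2) powr (p / 2)) \<partial>circle_measure)"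
proof -
  define u where "u z w = cmod (z + cnj w) powr p" for z w
  define v where "v z w = ((cmod z)\<^sup>2 + b * (cmod w)\<^sup>2) powr (p / 2)" for z w
  obtain k0 where k0: "k0 holomorphic_on ball 0 1" "\<And>z. cmod z < 1 \<Longrightarrow> 1 + cmod (g z + cnj (h z)) \<le> Re (k0 z)"
    using harmonic_majorant[OF g h K] by blast
  define k1 where "k1 z = k0 z + g z + h z" for z
  define k2 where "k2 z = k0 z + \<i> * (g z - h z)" for z
  have k_hol: "k1 holomorphic_on ball 0 1" "k2 holomorphic_on ball 0 1"
    unfolding k1_def k2_def by (intro holomorphic_intros k0 g h)+
  \<comment> \<open>With f = g + cnj h one has Re (g + h) = Re f and Re (i (g - h)) = - Im f, and
    both are bounded by |f|.\<close>
  have Re_k: "1 \<le> Re (k0 z)" "1 \<le> Re (k1 z)" "1 \<le> Re (k2 z)" if "cmod z < 1" for z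
  proof -
    have "\<bar>Re (g z + cnj (h z))\<bar> \<le> cmod (g z + cnj (h z))" "\<bar>Im (g z + cnj (h z))\<bar> \<le> cmod (g z + cnj (h z))"
      by (rule abs_Re_le_cmod abs_Im_le_cmod)+
    then show "1 \<le> Re (k0 z)" "1 \<le> Re (k1 z)" "1 \<le> Re (k2 z)"
      using k0(2)[OF that] by (auto simp: k1_def k2_def abs_le_iff)
  qed
  have g_eq: "g z = ((k1 z - k0 z) - \<i> * (k2 z - k0 z)) / 2" and h_eq: "h z = ((k1 z - k0 z) + \<i> * (k2 z - k0 z)) / 2" for z
    by (simp_all add: k1_def k2_def field_simps)
  define e where "e m = inverse (real (Suc m))" for m
  have e: "0 < e m" for m by (simp add: e_def)
  define \<phi> where "\<phi> m z = inverse (1 + of_real (e m) * k0 z) * inverse (1 + of_real (e m) * k1 z) * inverse (1 + of_real (e m) * k2 z)" for m z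
  define \<gamma> where "\<gamma> m = cnj (sgn (\<phi> m 0))" for m
  have nz: "1 + of_real (e m) * k0 z \<noteq> 0" "1 + of_real (e m) * k1 z \<noteq> 0" "1 + of_real (e m) * k2 z \<noteq> 0" if "cmod z < 1" for m z
    by (intro norm_damping_factor(3) e order_trans[OF zero_le_one Re_k(1)[OF that]]
        order_trans[OF zero_le_one Re_k(2)[OF that]] order_trans[OF zero_le_one Re_k(3)[OF that]])+
  have \<phi>_hol: "\<phi> m holomorphic_on ball 0 1" for m
    unfolding \<phi>_def using nz by (intro holomorphic_intros k0 k_hol) auto
  have \<gamma>1: "cmod (\<gamma> m) = 1" for m
    using nz[of 0 m] by (simp add: \<gamma>_def norm_sgn \<phi>_def)
  define G where "G m z = \<gamma> m * \<phi> m z * g z" for m z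
  define H where "H m z = \<gamma> m * \<phi> m z * h z" for m z
  have hol: "G m holomorphic_on ball 0 1" "H m holomorphic_on ball 0 1" for m
    unfolding G_def H_def by (intro holomorphic_intros \<phi>_hol g h)+
  \<comment> \<open>One of the three factors absorbs the function, and the other two have modulus at
    most 1.\<close>
  have k\<phi>: "cmod (\<phi> m z * k0 z) \<le> 1 / e m" "cmod (\<phi> m z * k1 z) \<le> 1 / e m" "cmod (\<phi> m z * k2 z) \<le> 1 / e m" if z: "cmod z < 1" for m z
  proof -
    have R: "0 \<le> Re (k0 z)" "0 \<le> Re (k1 z)" "0 \<le> Re (k2 z)" using Re_k[OF z] by auto
    have prod_le: "cmod (a * b * c) \<le> 1 / e m" if "cmod a \<le> 1 / e m" "cmod b \<le> 1" "cmod c \<le> 1" for a b c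
    proof -
      have "cmod a * cmod b * cmod c \<le> (1 / e m) * 1 * 1"
        using that by (intro mult_mono) (auto simp: e_def)
      then show ?thesis by (simp add: norm_mult)
    qed
    note d0 = norm_damping_factor[OF R(1) e, of m] and d1 = norm_damping_factor[OF R(2) e, of m] and d2 = norm_damping_factor[OF R(3) e, of m]
    show "cmod (\<phi> m z * k0 z) \<le> 1 / e m" using prod_le[OF d0(2) d1(1) d2(1)] by (simp add: \<phi>_def mult_ac)
    show "cmod (\<phi> m z * k1 z) \<le> 1 / e m" using prod_le[OF d1(2) d0(1) d2(1)] by (simp add: \<phi>_def mult_ac)
    show "cmod (\<phi> m z * k2 z) \<le> 1 / e m" using prod_le[OF d2(2) d0(1) d1(1)] by (simp add: \<phi>_def mult_ac)
  qed
  have bdd: "cmod (G m z) \<le> 2 / e m" "cmod (H m z) \<le> 2 / e m" if z: "cmod z < 1" for m z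
  proof -
    have four: "cmod (((a - b) - \<i> * (c - b)) / 2) \<le> 2 / e m" "cmod (((a - b) + \<i> * (c - b)) / 2) \<le> 2 / e m"
      if "cmod a \<le> 1 / e m" "cmod b \<le> 1 / e m" "cmod c \<le> 1 / e m" for a b c
    proof -
      have "cmod (a - b) \<le> 2 / e m" "cmod (\<i> * (c - b)) \<le> 2 / e m"
        using norm_triangle_ineq4[of a b] norm_triangle_ineq4[of c b] that by (auto simp: norm_mult)
      then show "cmod (((a - b) - \<i> * (c - b)) / 2) \<le> 2 / e m" "cmod (((a - b) + \<i> * (c - b)) / 2) \<le> 2 / e m"
        using norm_triangle_ineq4[of "a - b" "\<i> * (c - b)"] norm_triangle_ineq[of "a - b" "\<i> * (c - b)"]
        by (simp_all add: norm_divide)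
    qed
    have eqs: "\<phi> m z * g z = ((\<phi> m z * k1 z - \<phi> m z * k0 z) - \<i> * (\<phi> m z * k2 z - \<phi> m z * k0 z)) / 2"
      "\<phi> m z * h z = ((\<phi> m z * k1 z - \<phi> m z * k0 z) + \<i> * (\<phi> m z * k2 z - \<phi> m z * k0 z)) / 2"
      unfolding g_eq h_eq by (simp_all add: algebra_simps)
    have "cmod (\<phi> m z * g z) \<le> 2 / e m" "cmod (\<phi> m z * h z) \<le> 2 / e m"
      unfolding eqs by (intro four k\<phi> z)+
    then show "cmod (G m z) \<le> 2 / e m" "cmod (H m z) \<le> 2 / e m"
      by (simp_all add: G_def H_def norm_mult \<gamma>1)
  qed
  have sign: "Re (G m 0 * H m 0) \<le> 0" for m
  proof -
    have "\<gamma> m * \<phi> m 0 = of_real (cmod (\<phi> m 0))" unfolding \<gamma>_def by (rule cnj_sgn_mult)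
    then have "G m 0 * H m 0 = of_real ((cmod (\<phi> m 0))\<^sup>2) * (g 0 * h 0)"
      by (simp add: G_def H_def power2_eq_square)
    then have "Re (G m 0 * H m 0) = (cmod (\<phi> m 0))\<^sup>2 * Re (g 0 * h 0)"
      by (simp only: Re_complex_of_real Im_complex_of_real times_complex.sel mult_zero_left diff_zero)
    then show ?thesis using 0 by (simp add: mult_nonneg_nonpos)
  qed
  have e0: "e \<longlonglongrightarrow> 0" unfolding e_def[abs_def] by (rule LIMSEQ_inverse_real_of_nat)
  have \<gamma>_lim: "\<gamma> \<longlonglongrightarrow> 1"
  proof -
    have "(\<lambda>m. \<phi> m 0) \<longlonglongrightarrow> inverse (1 + of_real 0 * k0 0) * inverse (1 + of_real 0 * k1 0) * inverse (1 + of_real 0 * k2 0)"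
      unfolding \<phi>_def by (intro tendsto_intros e0) auto
    then have "(\<lambda>m. \<phi> m 0) \<longlonglongrightarrow> 1" by simp
    then have "(\<lambda>m. cnj (sgn (\<phi> m 0))) \<longlonglongrightarrow> cnj (sgn 1)" by (intro tendsto_intros) auto
    then show ?thesis by (simp add: \<gamma>_def[abs_def])
  qed
  have ae0: "AE \<zeta> in circle_measure. \<exists>l. ((\<lambda>r. k0 (of_real r * \<zeta>)) \<longlongrightarrow> l) (at_left 1)"
    by (intro radial_limit_ae_Re_ge_1 k0 Re_k)
  have ae1: "AE \<zeta> in circle_measure. \<exists>l. ((\<lambda>r. k1 (of_real r * \<zeta>)) \<longlongrightarrow> l) (at_left 1)"
    by (intro radial_limit_ae_Re_ge_1 k_hol Re_k)
  have ae2: "AE \<zeta> in circle_measure. \<exists>l. ((\<lambda>r. k2 (of_real r * \<zeta>)) \<longlongrightarrow> l) (at_left 1)"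
    by (intro radial_limit_ae_Re_ge_1 k_hol Re_k)
  \<comment> \<open>The damped boundary values are at most the original ones in modulus, which
    bounds the right side for every \<open>m\<close>; and they converge to them, which is what
    Fatou's lemma needs on the left.\<close>
  have ae: "AE \<zeta> in circle_measure. radial_limit g \<zeta> = seq_limit g \<zeta> \<and> radial_limit h \<zeta> = seq_limit h \<zeta> \<and>
      (\<forall>m. v (seq_limit (G m) \<zeta>) (seq_limit (H m) \<zeta>) \<le> v (seq_limit g \<zeta>) (seq_limit h \<zeta>)) \<and>
      (\<lambda>m. u (seq_limit (G m) \<zeta>) (seq_limit (H m) \<zeta>)) \<longlonglongrightarrow> u (seq_limit g \<zeta>) (seq_limit h \<zeta>)"
    using ae0 ae1 ae2 AE_space
  proof eventually_elim
    case (elim \<zeta>)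
    then obtain l0 l1 l2 where l: "((\<lambda>r. k0 (of_real r * \<zeta>)) \<longlongrightarrow> l0) (at_left 1)"
      "((\<lambda>r. k1 (of_real r * \<zeta>)) \<longlongrightarrow> l1) (at_left 1)" "((\<lambda>r. k2 (of_real r * \<zeta>)) \<longlongrightarrow> l2) (at_left 1)" by blast
    have z: "cmod \<zeta> = 1" using elim by simp
    have ev: "\<forall>\<^sub>F r in at_left (1::real). cmod (of_real r * \<zeta>) < 1"
      using eventually_at_left_real[of 0 1] by (auto elim!: eventually_mono simp: norm_mult z)
    have Re_l: "0 \<le> Re l0" "0 \<le> Re l1" "0 \<le> Re l2"
      by (rule tendsto_lowerbound[OF tendsto_Re[OF l(1)]] tendsto_lowerbound[OF tendsto_Re[OF l(2)]] tendsto_lowerbound[OF tendsto_Re[OF l(3)]];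
        (use ev Re_k in \<open>auto elim!: eventually_mono intro: order_trans[OF zero_le_one]\<close>)?)+
    define \<gamma>' where "\<gamma>' = ((l1 - l0) - \<i> * (l2 - l0)) / 2"
    define \<eta>' where "\<eta>' = ((l1 - l0) + \<i> * (l2 - l0)) / 2"
    have lg: "((\<lambda>r. g (of_real r * \<zeta>)) \<longlongrightarrow> \<gamma>') (at_left 1)" and lh: "((\<lambda>r. h (of_real r * \<zeta>)) \<longlongrightarrow> \<eta>') (at_left 1)"
      unfolding g_eq h_eq \<gamma>'_def \<eta>'_def by (intro tendsto_intros l; simp)+
    define \<Phi> where "\<Phi> m = inverse (1 + of_real (e m) * l0) * inverse (1 + of_real (e m) * l1) * inverse (1 + of_real (e m) * l2)" for m
    have l\<phi>: "((\<lambda>r. \<phi> m (of_real r * \<zeta>)) \<longlongrightarrow> \<Phi> m) (at_left 1)" for m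
      unfolding \<phi>_def \<Phi>_def by (intro tendsto_intros l norm_damping_factor(3) Re_l e)
    have "((\<lambda>r. G m (of_real r * \<zeta>)) \<longlongrightarrow> \<gamma> m * \<Phi> m * \<gamma>') (at_left 1)" "((\<lambda>r. H m (of_real r * \<zeta>)) \<longlongrightarrow> \<gamma> m * \<Phi> m * \<eta>') (at_left 1)" for m
      unfolding G_def H_def by (intro tendsto_intros l\<phi> lg lh)+
    note GH = radial_tendsto_imp(2)[OF this(1)] radial_tendsto_imp(2)[OF this(2)]
    note gh = radial_tendsto_imp(2,3)[OF lg] radial_tendsto_imp(2,3)[OF lh]
    have \<Phi>1: "cmod (\<gamma> m * \<Phi> m) \<le> 1" for m
    proof -
      have "cmod (\<Phi> m) \<le> 1 * 1 * 1"
        unfolding \<Phi>_def norm_mult by (intro mult_mono norm_damping_factor(1) Re_l e mult_nonneg_nonneg norm_ge_zero) auto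
      then show ?thesis by (simp add: norm_mult \<gamma>1)
    qed
    have mono: "(cmod (\<gamma> m * \<Phi> m * x))\<^sup>2 \<le> (cmod x)\<^sup>2" for m x
      unfolding norm_mult[of _ x] using \<Phi>1[of m] by (intro power_mono mult_left_le_one_le) auto
    have "v (\<gamma> m * \<Phi> m * \<gamma>') (\<gamma> m * \<Phi> m * \<eta>') \<le> v \<gamma>' \<eta>'" for m
      unfolding v_def using b p mono by (intro powr_mono2 add_mono mult_left_mono add_nonneg_nonneg) auto
    moreover have "(\<lambda>m. u (\<gamma> m * \<Phi> m * \<gamma>') (\<gamma> m * \<Phi> m * \<eta>')) \<longlonglongrightarrow> u \<gamma>' \<eta>'"
    proof -
      have "\<Phi> \<longlonglongrightarrow> inverse (1 + of_real 0 * l0) * inverse (1 + of_real 0 * l1) * inverse (1 + of_real 0 * l2)"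
        unfolding \<Phi>_def by (intro tendsto_intros e0) auto
      then have "(\<lambda>m. u (\<gamma> m * \<Phi> m * \<gamma>') (\<gamma> m * \<Phi> m * \<eta>')) \<longlonglongrightarrow>
          u (1 * (inverse (1 + of_real 0 * l0) * inverse (1 + of_real 0 * l1) * inverse (1 + of_real 0 * l2)) * \<gamma>')
            (1 * (inverse (1 + of_real 0 * l0) * inverse (1 + of_real 0 * l1) * inverse (1 + of_real 0 * l2)) * \<eta>')"
        unfolding u_def by (intro tendsto_powr' tendsto_intros \<gamma>_lim) (use p in auto)
      then show ?thesis by simp
    qed
    ultimately show ?case unfolding GH gh by simp
  qed
  have meas: "seq_limit F \<in> borel_measurable circle_measure" if "F holomorphic_on ball 0 1" for F
    by (intro borel_measurable_seq_limit holomorphic_on_imp_continuous_on that)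
  have mu: "(\<lambda>\<zeta>. ennreal (u (seq_limit (G m) \<zeta>) (seq_limit (H m) \<zeta>))) \<in> borel_measurable circle_measure" for m
    unfolding u_def by (intro measurable_compose[OF _ measurable_ennreal] borel_measurable_cmod_add_cnj_powr meas hol)
  define V where "V = (\<integral>\<^sup>+\<zeta>. ennreal (v (seq_limit g \<zeta>) (seq_limit h \<zeta>)) \<partial>circle_measure)"
  have each: "(\<integral>\<^sup>+\<zeta>. ennreal (u (seq_limit (G m) \<zeta>) (seq_limit (H m) \<zeta>)) \<partial>circle_measure) \<le> ennreal (A_const p b powr p) * V" for m
  proof -
    have "(\<integral>\<^sup>+\<zeta>. ennreal (u (seq_limit (G m) \<zeta>) (seq_limit (H m) \<zeta>)) \<partial>circle_measure) \<le>
      ennreal (A_const p b powr p) * (\<integral>\<^sup>+\<zeta>. ennreal (v (seq_limit (G m) \<zeta>) (seq_limit (H m) \<zeta>)) \<partial>circle_measure)"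
      unfolding u_def v_def by (intro bounded_inequality[where M = "2 / e m"] p b hol bdd sign)
    also have "\<dots> \<le> ennreal (A_const p b powr p) * V"
    proof -
      have "AE \<zeta> in circle_measure. ennreal (v (seq_limit (G m) \<zeta>) (seq_limit (H m) \<zeta>)) \<le> ennreal (v (seq_limit g \<zeta>) (seq_limit h \<zeta>))"
        using ae by eventually_elim (auto intro: ennreal_leI)
      then show ?thesis unfolding V_def by (intro mult_left_mono nn_integral_mono_AE) auto
    qed
    finally show ?thesis .
  qed
  have "(\<integral>\<^sup>+\<zeta>. ennreal (u (radial_limit g \<zeta>) (radial_limit h \<zeta>)) \<partial>circle_measure) =
    (\<integral>\<^sup>+\<zeta>. liminf (\<lambda>m. ennreal (u (seq_limit (G m) \<zeta>) (seq_limit (H m) \<zeta>))) \<partial>circle_measure)"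
    using ae
  proof (intro nn_integral_cong_AE, eventually_elim)
    case (elim \<zeta>)
    then have "(\<lambda>m. ennreal (u (seq_limit (G m) \<zeta>) (seq_limit (H m) \<zeta>))) \<longlonglongrightarrow> ennreal (u (seq_limit g \<zeta>) (seq_limit h \<zeta>))"
      by (intro tendsto_ennrealI) auto
    from lim_imp_Liminf[OF sequentially_bot this] elim show ?case by simp
  qed
  also have "\<dots> \<le> liminf (\<lambda>m. \<integral>\<^sup>+\<zeta>. ennreal (u (seq_limit (G m) \<zeta>) (seq_limit (H m) \<zeta>)) \<partial>circle_measure)"
    by (intro nn_integral_liminf mu)
  also have "\<dots> \<le> ennreal (A_const p b powr p) * V"
    using each by (intro Liminf_le) (auto simp: frequently_def intro!: always_eventually)
  also have "V = (\<integral>\<^sup>+\<zeta>. ennreal (v (radial_limit g \<zeta>) (radial_limit h \<zeta>)) \<partial>circle_measure)"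
    unfolding V_def using ae by (intro nn_integral_cong_AE, eventually_elim) auto
  finally show ?thesis unfolding u_def v_def .
qed

section \<open>From integrals to norms\<close>

lemma ennpowr_mono: "x \<le> y \<Longrightarrow> 0 \<le> a \<Longrightarrow> ennpowr x a \<le> ennpowr y a"
  by (auto simp: ennpowr_def top_unique intro!: ennreal_leI powr_mono2 enn2real_mono simp: less_top)

lemma ennpowr_ennreal: "0 \<le> x \<Longrightarrow> ennpowr (ennreal x) a = ennreal (x powr a)"
  by (simp add: ennpowr_def)

lemma ennpowr_cmult: "0 < c \<Longrightarrow> ennpowr (ennreal c * x) a = ennreal (c powr a) * ennpowr x a"
proof (cases x)
  case (real r)
  assume "0 < c"
  then have "ennpowr (ennreal c * x) a = ennreal ((c * r) powr a)"
    using real by (simp add: ennpowr_ennreal ennreal_mult'[symmetric])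
  also have "(c * r) powr a = c powr a * r powr a" by (rule powr_mult)
  finally show ?thesis using real by (simp add: ennpowr_ennreal ennreal_mult')
qed (simp add: ennpowr_def ennreal_mult_top)

text \<open>The holomorphic majorant needs bounded L^1 means; t <= 1 + t^p derives them from the L^p
  means.\<close>

lemma harmonic_hardy_mean_bounded:
  assumes p: "1 \<le> p" and f: "f \<in> harmonic_hardy p" and d: "harmonic_decomp f g h"
  obtains K where "\<And>r. 0 < r \<Longrightarrow> r < 1 \<Longrightarrow> (\<integral>\<zeta>. cmod (g (of_real r * \<zeta>) + cnj (h (of_real r * \<zeta>))) \<partial>circle_measure) \<le> K"
proof -
  define S where "S = (SUP r\<in>{0<..<1::real}. ennpowr (\<integral>\<^sup>+\<zeta>. ennreal (cmod (f (of_real r * \<zeta>)) powr p) \<partial>circle_measure) (1 / p))"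
  have "S < \<infinity>" using f by (simp add: harmonic_hardy_def S_def)
  then obtain s where s: "S = ennreal s" "0 \<le> s" by (cases S) auto
  have g: "g holomorphic_on ball 0 1" "h holomorphic_on ball 0 1" and fz: "\<And>z. z \<in> ball 0 1 \<Longrightarrow> f z = g z + cnj (h z)"
    using d by (auto simp: harmonic_decomp_def)
  have "(\<integral>\<zeta>. cmod (g (of_real r * \<zeta>) + cnj (h (of_real r * \<zeta>))) \<partial>circle_measure) \<le> 1 + s powr p" if r: "0 < r" "r < 1" for r
  proof -
    define u where "u \<zeta> = cmod (g (of_real r * \<zeta>) + cnj (h (of_real r * \<zeta>)))" for \<zeta>
    have "continuous_on (sphere 0 1) (\<lambda>\<zeta>. G (of_real r * \<zeta>))" if "G holomorphic_on ball 0 1" for G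
      by (rule continuous_on_compose2[OF holomorphic_on_imp_continuous_on[OF that]])
        (use r in \<open>auto intro!: continuous_intros simp: norm_mult\<close>)
    from this[OF g(1)] this[OF g(2)] have cu: "continuous_on (sphere 0 1) u"
      unfolding u_def by (intro continuous_intros)
    then have cup: "continuous_on (sphere 0 1) (\<lambda>\<zeta>. u \<zeta> powr p)"
      using p by (intro continuous_on_powr' continuous_intros) (auto simp: u_def)
    have iu: "integrable circle_measure u" "integrable circle_measure (\<lambda>\<zeta>. u \<zeta> powr p)"
      by (intro integrable_circle_continuous cu cup)+
    define I where "I = (\<integral>\<zeta>. u \<zeta> powr p \<partial>circle_measure)"
    have I0: "0 \<le> I" unfolding I_def by simp
    have "(\<integral>\<^sup>+\<zeta>. ennreal (cmod (f (of_real r * \<zeta>)) powr p) \<partial>circle_measure) = (\<integral>\<^sup>+\<zeta>. ennreal (u \<zeta> powr p) \<partial>circle_measure)"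
      unfolding u_def using fz scale_in_ball[OF r] by (intro nn_integral_cong) (simp del: mem_ball)
    also have "\<dots> = ennreal I" unfolding I_def by (intro nn_integral_eq_integral iu) auto
    finally have "ennpowr (ennreal I) (1 / p) \<le> S"
      unfolding S_def using r by (intro SUP_upper2[of r]) auto
    then have "I powr (1 / p) \<le> s" using s I0 by (simp add: ennpowr_ennreal)
    then have "(I powr (1 / p)) powr p \<le> s powr p" using p by (intro powr_mono2) auto
    then have Is: "I \<le> s powr p" using p I0 by (simp add: powr_powr)
    have "(\<integral>\<zeta>. u \<zeta> \<partial>circle_measure) \<le> (\<integral>\<zeta>. 1 + u \<zeta> powr p \<partial>circle_measure)"
    proof (rule integral_mono)
      show "u \<zeta> \<le> 1 + u \<zeta> powr p" for \<zeta>
      proof (cases "u \<zeta> \<le> 1")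
        case False
        then have "u \<zeta> powr 1 \<le> u \<zeta> powr p" using p by (intro powr_mono) auto
        then show ?thesis using False by simp
      qed (simp add: add_increasing2)
    qed (use iu in auto)
    also have "\<dots> = 1 + I" using iu by (simp add: I_def)
    finally show ?thesis using Is by (simp add: u_def)
  qed
  then show ?thesis by (rule that)
qed

lemma norm_inequality:
  assumes p: "1 \<le> p" "p \<le> 2" and b: "0 < b" and f: "admissible p f g h"
  shows "lhs_norm p g h \<le> ennreal (A_const p b) * rhs_norm p b g h"
proof -
  have A: "0 < A_const p b" by (rule A_const_sq(2)[OF b])
  obtain K where K: "\<And>r. 0 < r \<Longrightarrow> r < 1 \<Longrightarrow> (\<integral>\<zeta>. cmod (g (of_real r * \<zeta>) + cnj (h (of_real r * \<zeta>))) \<partial>circle_measure) \<le> K"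
    using harmonic_hardy_mean_bounded[OF p(1)] f unfolding admissible_def by blast
  have "lhs_norm p g h \<le> ennpowr (ennreal (A_const p b powr p) *
      (\<integral>\<^sup>+\<zeta>. ennreal (((cmod (radial_limit g \<zeta>))\<^sup>2 + b * (cmod (radial_limit h \<zeta>))\<^sup>2) powr (p / 2)) \<partial>circle_measure)) (1 / p)"
    unfolding lhs_norm_def using f p
    by (intro ennpowr_mono main_inequality[OF p b _ _ _ K]) (auto simp: admissible_def harmonic_decomp_def)
  also have "\<dots> = ennreal ((A_const p b powr p) powr (1 / p)) * rhs_norm p b g h"
    unfolding rhs_norm_def using A by (intro ennpowr_cmult) auto
  also have "(A_const p b powr p) powr (1 / p) = A_const p b" using A p by (simp add: powr_powr)
  finally show ?thesis .
qed


subsection \<open>The extremal functions\<close>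

lemma Re_cayley_pos:
  assumes "cmod z < 1"
  shows "0 < Re ((1 + z) / (1 - z))"
proof -
  have "(cmod z)\<^sup>2 < 1" using assms by (simp add: power_less_one_iff)
  then have "0 < 1 - (Re z)\<^sup>2 - (Im z)\<^sup>2" by (simp add: cmod_power2)
  moreover have "0 < (1 - Re z)\<^sup>2 + (Im z)\<^sup>2"
  proof -
    have "Re z < 1" using assms complex_Re_le_cmod[of z] by simp
    then show ?thesis by (simp add: add_pos_nonneg)
  qed
  moreover have "Re ((1 + z) / (1 - z)) = (1 - (Re z)\<^sup>2 - (Im z)\<^sup>2) / ((1 - Re z)\<^sup>2 + (Im z)\<^sup>2)"
    by (simp add: Re_divide power2_eq_square algebra_simps)
  ultimately show ?thesis by simp
qed

lemma cayley_not_nonpos: "cmod z < 1 \<Longrightarrow> (1 + z) / (1 - z) \<notin> \<real>\<^sub>\<le>\<^sub>0"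
  using Re_cayley_pos by (fastforce simp: complex_nonpos_Reals_iff)

lemma cayley_pow_holomorphic: "cayley_pow c holomorphic_on ball 0 1"
  unfolding cayley_pow_def[abs_def]
  using cayley_not_nonpos by (intro holomorphic_intros) auto

lemma cayley_pow_0 [simp]: "cayley_pow c 0 = 1"
  by (simp add: cayley_pow_def)

lemma cayley_pow_cnj:
  assumes "cmod z < 1"
  shows "cayley_pow c (cnj z) = cnj (cayley_pow c z)"
proof -
  have "cnj (((1 + z) / (1 - z)) powr of_real c) = cnj ((1 + z) / (1 - z)) powr cnj (of_real c)"
    using Re_cayley_pos[OF assms] by (intro cnj_powr) auto
  then show ?thesis by (simp add: cayley_pow_def)
qed

lemma norm_cayley_pow: "cmod (cayley_pow c z) = cmod ((1 + z) / (1 - z)) powr c"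
  by (simp add: cayley_pow_def norm_powr_real_powr')

lemma norm_cayley_pow_powr: "cmod (cayley_pow c z) powr p = cmod (cayley_pow (c * p) z)"
  by (simp only: norm_cayley_pow powr_powr)

lemma Re_cayley_pow_ge:
  assumes "cmod z < 1" "0 \<le> a" "a < 1"
  shows "cos (a * (pi / 2)) * cmod (cayley_pow a z) \<le> Re (cayley_pow a z)"
proof -
  define X where "X = (1 + z) / (1 - z)"
  have X: "0 < Re X" using Re_cayley_pos[OF assms(1)] by (simp add: X_def)
  then have "X \<noteq> 0" by auto
  have arg: "\<bar>Im (Ln X)\<bar> < pi / 2" using Re_Ln_pos_lt[OF \<open>X \<noteq> 0\<close>] X by simp
  have "a * \<bar>Im (Ln X)\<bar> \<le> a * (pi / 2)" using arg assms by (intro mult_left_mono) auto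
  moreover have "a * (pi / 2) \<le> pi" using assms pi_gt_zero mult_right_mono[of a 1 "pi / 2"] by simp
  ultimately have "cos (a * (pi / 2)) \<le> cos (a * \<bar>Im (Ln X)\<bar>)"
    using assms by (intro cos_monotone_0_pi_le) auto
  also have "\<dots> = cos (a * Im (Ln X))" by (cases "0 \<le> Im (Ln X)") auto
  finally have "cos (a * (pi / 2)) * cmod (X powr of_real a) \<le> cmod (X powr of_real a) * cos (a * Im (Ln X))"
    by (simp add: mult.commute mult_left_mono)
  also have "\<dots> = Re (X powr of_real a)"
    using \<open>X \<noteq> 0\<close> by (simp add: powr_def Re_exp)
  finally show ?thesis by (simp add: cayley_pow_def X_def)
qed

text \<open>The values lie in the sector |arg| <= a pi / 2, where the modulus is at most the real
  part divided by cos (a pi / 2), and the mean of the real part is its value 1 at the origin. With a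
  = c p this bounds the p-th means of \<open>cayley_pow c\<close>, which is where c < 1 / p
  enters.\<close>

lemma cayley_pow_mean_le:
  assumes a: "0 \<le> a" "a < 1" and r: "0 < r" "r < 1"
  shows "(\<integral>\<^sup>+\<zeta>. ennreal (cmod (cayley_pow a (of_real r * \<zeta>))) \<partial>circle_measure) \<le> ennreal (1 / cos (a * (pi / 2)))"
proof -
  define F where "F z = cayley_pow a (of_real r * z)" for z
  have rz: "of_real r * z \<in> ball 0 1" if "cmod z \<le> 1" for z by (rule scale_in_ball[OF r that])
  have cos_pos: "0 < cos (a * (pi / 2))"
    using a mult_strict_right_mono[of a 1 "pi / 2"] by (intro cos_gt_zero_pi) (auto intro: less_le_trans[of _ 0])
  have cF: "continuous_on (cball 0 1) F"
    unfolding F_def by (rule continuous_on_compose2[OF holomorphic_on_imp_continuous_on[OF cayley_pow_holomorphic]])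
      (use rz in \<open>auto intro!: continuous_intros\<close>)
  have hF: "F holomorphic_on ball 0 1"
    unfolding F_def by (rule holomorphic_on_compose_gen[OF _ cayley_pow_holomorphic, unfolded o_def])
      (use rz in \<open>force intro!: holomorphic_intros\<close>)+
  have iF: "integrable circle_measure F" "integrable circle_measure (\<lambda>\<zeta>. cmod (F \<zeta>))" "integrable circle_measure (\<lambda>\<zeta>. Re (F \<zeta>))"
    by (intro integrable_circle_continuous continuous_intros continuous_on_subset[OF cF]; auto)+
  have "cos (a * (pi / 2)) * (\<integral>\<zeta>. cmod (F \<zeta>) \<partial>circle_measure) = (\<integral>\<zeta>. cos (a * (pi / 2)) * cmod (F \<zeta>) \<partial>circle_measure)"
    by simp
  also have "\<dots> \<le> (\<integral>\<zeta>. Re (F \<zeta>) \<partial>circle_measure)"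
    using Re_cayley_pow_ge[OF _ a] rz by (intro integral_mono integrable_mult_right iF) (auto simp: F_def)
  also have "\<dots> = Re (F 0)" using integral_Re[OF iF(1)] circle_mean_value[OF cF hF] by simp
  also have "\<dots> = 1" by (simp add: F_def)
  finally have "(\<integral>\<zeta>. cmod (F \<zeta>) \<partial>circle_measure) \<le> 1 / cos (a * (pi / 2))"
    using cos_pos by (simp add: field_simps)
  moreover have "(\<integral>\<^sup>+\<zeta>. ennreal (cmod (F \<zeta>)) \<partial>circle_measure) = ennreal (\<integral>\<zeta>. cmod (F \<zeta>) \<partial>circle_measure)"
    by (rule nn_integral_eq_integral[OF iF(2)]) simp
  ultimately show ?thesis by (simp add: F_def ennreal_leI)
qed

text \<open>This excludes 1 and -1, the pole and the zero of (1 + z) / (1 - z).\<close>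

lemma AE_circle_Im_nonzero: "AE \<zeta> in circle_measure. Im \<zeta> \<noteq> 0"
proof -
  have c: "continuous_on (sphere 0 1) Im" by (intro continuous_intros)
  have N: "{\<zeta>\<in>sphere 0 1. Im \<zeta> = 0} \<in> sets circle_measure"
  proof -
    have "Im -` {0} \<inter> space circle_measure \<in> sets circle_measure"
      by (rule measurable_sets[OF borel_measurable_circle_continuous[OF c]]) simp
    moreover have "Im -` {0} \<inter> space circle_measure = {\<zeta>\<in>sphere 0 1. Im \<zeta> = 0}" by auto
    ultimately show ?thesis by simp
  qed
  have "emeasure circle_measure {\<zeta>\<in>sphere 0 1. Im \<zeta> = 0} = (\<integral>\<^sup>+\<zeta>. indicator {\<zeta>\<in>sphere 0 1. Im \<zeta> = 0} \<zeta> \<partial>circle_measure)"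
    using N by simp
  also have "\<dots> = (\<integral>\<^sup>+t. indicator {\<zeta>\<in>sphere 0 1. Im \<zeta> = 0} (cis t) * indicator {0..2 * pi} t \<partial>lborel) / ennreal (2 * pi)"
    by (rule nn_integral_circle_measure) (use N sets_circle_measure in simp)
  also have "(\<integral>\<^sup>+t. indicator {\<zeta>\<in>sphere 0 1. Im \<zeta> = 0} (cis t) * indicator {0..2 * pi} t \<partial>lborel) = (\<integral>\<^sup>+(t::real). 0 \<partial>lborel)"
  proof (rule nn_integral_cong_AE)
    have "countable (range (\<lambda>i::int. of_int i * pi))" by auto
    from AE_not_in[OF countable_imp_null_set_lborel[OF this]]
    show "AE t in lborel. indicator {\<zeta>\<in>sphere 0 1. Im \<zeta> = 0} (cis t) * indicator {0..2 * pi} t = (0 :: ennreal)"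
      by eventually_elim (auto simp: sin_zero_iff_int2 split: split_indicator)
  qed
  finally have "emeasure circle_measure {\<zeta>\<in>sphere 0 1. Im \<zeta> = 0} = 0" by simp
  then have "{\<zeta>\<in>sphere 0 1. Im \<zeta> = 0} \<in> null_sets circle_measure" using N by auto
  from AE_not_in[OF this] AE_space show ?thesis by eventually_elim auto
qed

lemma cayley_on_circle:
  assumes "cmod \<zeta> = 1" "Im \<zeta> \<noteq> 0"
  shows "Re ((1 + \<zeta>) / (1 - \<zeta>)) = 0" "Im ((1 + \<zeta>) / (1 - \<zeta>)) \<noteq> 0"
proof -
  have 1: "(Re \<zeta>)\<^sup>2 + (Im \<zeta>)\<^sup>2 = 1" using assms(1) cmod_power2[of \<zeta>] by simp
  have den: "0 < (1 - Re \<zeta>)\<^sup>2 + (Im \<zeta>)\<^sup>2" using assms(2) by (simp add: add_nonneg_pos)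
  have "Re ((1 + \<zeta>) / (1 - \<zeta>)) = (1 - ((Re \<zeta>)\<^sup>2 + (Im \<zeta>)\<^sup>2)) / ((1 - Re \<zeta>)\<^sup>2 + (Im \<zeta>)\<^sup>2)"
    by (simp add: Re_divide power2_eq_square algebra_simps)
  then show "Re ((1 + \<zeta>) / (1 - \<zeta>)) = 0" using 1 by simp
  have "Im ((1 + \<zeta>) / (1 - \<zeta>)) = 2 * Im \<zeta> / ((1 - Re \<zeta>)\<^sup>2 + (Im \<zeta>)\<^sup>2)"
    by (simp add: Im_divide power2_eq_square algebra_simps)
  then show "Im ((1 + \<zeta>) / (1 - \<zeta>)) \<noteq> 0" using den assms(2) by simp
qed

lemma cayley_pow_radial_tendsto:
  assumes "cmod \<zeta> = 1" "Im \<zeta> \<noteq> 0"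
  shows "((\<lambda>r. cayley_pow c (of_real r * \<zeta>)) \<longlongrightarrow> cayley_pow c \<zeta>) (at_left 1)"
proof -
  have "\<zeta> \<noteq> 1" using assms(2) by auto
  have nn: "(1 + \<zeta>) / (1 - \<zeta>) \<notin> \<real>\<^sub>\<le>\<^sub>0"
    using cayley_on_circle(2)[OF assms] by (auto simp: complex_nonpos_Reals_iff)
  have "((\<lambda>r. (1 + of_real r * \<zeta>) / (1 - of_real r * \<zeta>)) \<longlongrightarrow> (1 + of_real 1 * \<zeta>) / (1 - of_real 1 * \<zeta>)) (at_left (1::real))"
    using \<open>\<zeta> \<noteq> 1\<close> by (intro tendsto_intros) auto
  then have "((\<lambda>r. (1 + of_real r * \<zeta>) / (1 - of_real r * \<zeta>)) \<longlongrightarrow> (1 + \<zeta>) / (1 - \<zeta>)) (at_left (1::real))" by simp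
  from tendsto_powr_complex[OF nn this tendsto_const] show ?thesis
    by (simp add: cayley_pow_def)
qed

text \<open>On the circle (1 + z) / (1 - z) has argument pi / 2 up to sign, so the square of its
  c-th power has argument pi c up to sign, and the cosine does not see the sign.\<close>

lemma Re_cayley_pow_square:
  assumes "cmod \<zeta> = 1" "Im \<zeta> \<noteq> 0"
  shows "Re ((cayley_pow c \<zeta>)\<^sup>2) = (cmod (cayley_pow c \<zeta>))\<^sup>2 * cos (pi * c)" "cayley_pow c \<zeta> \<noteq> 0"
proof -
  define X where "X = (1 + \<zeta>) / (1 - \<zeta>)"
  have X: "Re X = 0" "Im X \<noteq> 0" using cayley_on_circle[OF assms] by (auto simp: X_def)
  then have nz: "X \<noteq> 0" by auto
  have "\<bar>Im (Ln X)\<bar> = pi / 2"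
    using Re_Ln_pos_le[OF nz] Re_Ln_pos_lt[OF nz] X by simp
  then have "Im (Ln X) = pi / 2 \<or> Im (Ln X) = - (pi / 2)" by linarith
  then have "2 * c * Im (Ln X) = pi * c \<or> 2 * c * Im (Ln X) = - (pi * c)" by auto
  then have "cos (2 * c * Im (Ln X)) = cos (pi * c)" by (elim disjE) (simp_all only: cos_minus)
  moreover have "(X powr of_real c)\<^sup>2 = exp (of_real (2 * c) * Ln X)"
    using nz by (simp add: powr_def power2_eq_square mult_exp_exp algebra_simps)
  then have "Re ((X powr of_real c)\<^sup>2) = exp (2 * c * ln (cmod X)) * cos (2 * c * Im (Ln X))"
    using nz by (simp add: Re_exp)
  moreover have "(cmod (X powr of_real c))\<^sup>2 = exp (2 * c * ln (cmod X))"
    using nz by (simp add: powr_def power2_eq_square mult_exp_exp)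
  ultimately show "Re ((cayley_pow c \<zeta>)\<^sup>2) = (cmod (cayley_pow c \<zeta>))\<^sup>2 * cos (pi * c)"
    by (simp add: cayley_pow_def X_def)
  show "cayley_pow c \<zeta> \<noteq> 0" using nz by (simp add: cayley_pow_def X_def)
qed

text \<open>Finiteness and positivity allow this integral to be cancelled from a quotient in
  \<open>ennreal\<close>. The first comes from Fatou's lemma, the second from an integrand that
  vanishes almost nowhere.\<close>

lemma cayley_pow_boundary_integral:
  assumes p: "1 \<le> p" and c: "0 < c" "c < 1 / p"
  obtains x where "0 < x" "(\<integral>\<^sup>+\<zeta>. ennreal (cmod (cayley_pow c \<zeta>) powr p) \<partial>circle_measure) = ennreal x"
proof -
  have cp: "0 \<le> c * p" "c * p < 1" using p c by (auto simp: field_simps)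
  define u where "u n \<zeta> = ennreal (cmod (cayley_pow c (of_real (radius n) * \<zeta>)) powr p)" for n \<zeta>
  define U where "U \<zeta> = ennreal (cmod (cayley_pow c \<zeta>) powr p)" for \<zeta>
  note cont = holomorphic_on_imp_continuous_on[OF cayley_pow_holomorphic[of c]]
  have mu: "u n \<in> borel_measurable circle_measure" for n
    unfolding u_def using borel_measurable_radius_scaled[OF cont, of n] by measurable
  have ae: "AE \<zeta> in circle_measure. (\<lambda>n. u n \<zeta>) \<longlonglongrightarrow> U \<zeta> \<and> U \<zeta> \<noteq> 0"
    using AE_circle_Im_nonzero AE_space
  proof eventually_elim
    case (elim \<zeta>)
    then have z: "cmod \<zeta> = 1" "Im \<zeta> \<noteq> 0" by auto
    note nz = Re_cayley_pow_square(2)[OF z, of c]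
    have "(\<lambda>n. cayley_pow c (of_real (radius n) * \<zeta>)) \<longlonglongrightarrow> cayley_pow c \<zeta>"
      by (rule radial_tendsto_imp(1)[OF cayley_pow_radial_tendsto[OF z]])
    then have "(\<lambda>n. cmod (cayley_pow c (of_real (radius n) * \<zeta>)) powr p) \<longlonglongrightarrow> cmod (cayley_pow c \<zeta>) powr p"
      using nz by (intro tendsto_powr tendsto_norm tendsto_const) auto
    then show ?case using nz unfolding u_def U_def by (intro conjI tendsto_ennrealI) (auto simp: ennreal_eq_0_iff not_le)
  qed
  have liminf_eq: "AE \<zeta> in circle_measure. U \<zeta> = liminf (\<lambda>n. u n \<zeta>)"
    using ae by eventually_elim (metis lim_imp_Liminf sequentially_bot)
  have "(\<integral>\<^sup>+\<zeta>. U \<zeta> \<partial>circle_measure) = (\<integral>\<^sup>+\<zeta>. liminf (\<lambda>n. u n \<zeta>) \<partial>circle_measure)"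
    using liminf_eq by (rule nn_integral_cong_AE)
  also have "\<dots> \<le> liminf (\<lambda>n. \<integral>\<^sup>+\<zeta>. u n \<zeta> \<partial>circle_measure)"
    by (intro nn_integral_liminf mu)
  also have "\<dots> \<le> ennreal (1 / cos (c * p * (pi / 2)))"
    unfolding u_def norm_cayley_pow_powr using cayley_pow_mean_le[OF cp radius_bounds]
    by (intro Liminf_le always_eventually allI) auto
  also have "\<dots> < \<infinity>" by simp
  finally have fin: "(\<integral>\<^sup>+\<zeta>. U \<zeta> \<partial>circle_measure) < \<infinity>" .
  \<comment> \<open>The lower limit stands in for \<open>U\<close>: it agrees with \<open>U\<close>
    almost everywhere and is measurable as a limit of measurable functions.\<close>
  have "(\<integral>\<^sup>+\<zeta>. liminf (\<lambda>n. u n \<zeta>) \<partial>circle_measure) \<noteq> 0"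
  proof
    assume "(\<integral>\<^sup>+\<zeta>. liminf (\<lambda>n. u n \<zeta>) \<partial>circle_measure) = 0"
    moreover have "(\<lambda>\<zeta>. liminf (\<lambda>n. u n \<zeta>)) \<in> borel_measurable circle_measure"
      using mu by measurable
    ultimately have "AE \<zeta> in circle_measure. liminf (\<lambda>n. u n \<zeta>) = 0"
      by (simp add: nn_integral_0_iff_AE)
    with ae liminf_eq have "AE \<zeta> in circle_measure. False" by eventually_elim simp
    then obtain N where "{x \<in> space circle_measure. \<not> False} \<subseteq> N" and N: "emeasure circle_measure N = 0" "N \<in> sets circle_measure"
      by (rule AE_E)
    then have "sphere 0 1 \<subseteq> N" by (auto simp: subset_iff)
    from emeasure_mono[OF this N(2)] N(1) show False by (simp add: emeasure_circle_measure_space)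
  qed
  then have "(\<integral>\<^sup>+\<zeta>. U \<zeta> \<partial>circle_measure) \<noteq> 0" using nn_integral_cong_AE[OF liminf_eq] by simp
  then show ?thesis using fin that[of "enn2real (\<integral>\<^sup>+\<zeta>. U \<zeta> \<partial>circle_measure)"] unfolding U_def
    by (simp add: enn2real_positive_iff less_top zero_less_iff_neq_zero)
qed

text \<open>Almost everywhere on the circle both integrands are constants times the p-th power of
  the modulus of \<open>cayley_pow c\<close>. The common integral cancels, so the quotient is known
  exactly for each c.\<close>

lemma cayley_family_ratio:
  fixes \<alpha> \<beta> :: real
  assumes p: "1 \<le> p" and b: "0 < b" and c: "0 < c" "c < 1 / p" and pos: "0 < \<alpha>\<^sup>2 + b * \<beta>\<^sup>2"
  defines "g \<equiv> \<lambda>z. of_real \<alpha> * cayley_pow c z" and "h \<equiv> \<lambda>z. of_real \<beta> * cayley_pow c z"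
  shows "lhs_norm p g h / rhs_norm p b g h =
    ennreal (sqrt (\<alpha>\<^sup>2 + \<beta>\<^sup>2 + 2 * \<alpha> * \<beta> * cos (pi * c)) / sqrt (\<alpha>\<^sup>2 + b * \<beta>\<^sup>2))"
proof -
  define k where "k = sqrt (\<alpha>\<^sup>2 + \<beta>\<^sup>2 + 2 * \<alpha> * \<beta> * cos (pi * c))"
  define l where "l = sqrt (\<alpha>\<^sup>2 + b * \<beta>\<^sup>2)"
  define S where "S = cayley_pow c"
  have l: "0 < l" using pos by (simp add: l_def)
  obtain x where x: "0 < x" "(\<integral>\<^sup>+\<zeta>. ennreal (cmod (S \<zeta>) powr p) \<partial>circle_measure) = ennreal x"
    using cayley_pow_boundary_integral[OF p c] unfolding S_def by blast
  have rad0: "0 \<le> \<alpha>\<^sup>2 + \<beta>\<^sup>2 + 2 * \<alpha> * \<beta> * cos (pi * c)"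
  proof -
    have "\<bar>2 * \<alpha> * \<beta> * cos (pi * c)\<bar> \<le> \<bar>2 * \<alpha> * \<beta>\<bar> * 1"
      unfolding abs_mult[of _ "cos _"] by (intro mult_left_mono) auto
    moreover have "\<bar>2 * \<alpha> * \<beta>\<bar> \<le> \<alpha>\<^sup>2 + \<beta>\<^sup>2"
      using zero_le_power2[of "\<alpha> - \<beta>"] zero_le_power2[of "\<alpha> + \<beta>"] by (simp add: power2_diff power2_sum abs_le_iff)
    ultimately show ?thesis by linarith
  qed
  have ae: "AE \<zeta> in circle_measure. cmod (radial_limit g \<zeta> + cnj (radial_limit h \<zeta>)) = k * cmod (S \<zeta>) \<and>
      (cmod (radial_limit g \<zeta>))\<^sup>2 + b * (cmod (radial_limit h \<zeta>))\<^sup>2 = (l * cmod (S \<zeta>))\<^sup>2"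
    using AE_circle_Im_nonzero AE_space
  proof eventually_elim
    case (elim \<zeta>)
    then have z: "cmod \<zeta> = 1" "Im \<zeta> \<noteq> 0" by auto
    have "((\<lambda>r. g (of_real r * \<zeta>)) \<longlongrightarrow> of_real \<alpha> * S \<zeta>) (at_left 1)" "((\<lambda>r. h (of_real r * \<zeta>)) \<longlongrightarrow> of_real \<beta> * S \<zeta>) (at_left 1)"
      unfolding g_def h_def S_def by (intro tendsto_intros cayley_pow_radial_tendsto z)+
    note gh = radial_tendsto_imp(3)[OF this(1)] radial_tendsto_imp(3)[OF this(2)]
    have "(cmod (of_real \<alpha> * S \<zeta> + cnj (of_real \<beta> * S \<zeta>)))\<^sup>2 = \<alpha>\<^sup>2 * (cmod (S \<zeta>))\<^sup>2 + \<beta>\<^sup>2 * (cmod (S \<zeta>))\<^sup>2 + 2 * \<alpha> * \<beta> * Re ((S \<zeta>)\<^sup>2)"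
    proof -
      have "of_real \<alpha> * S \<zeta> * (of_real \<beta> * S \<zeta>) = of_real (\<alpha> * \<beta>) * (S \<zeta>)\<^sup>2"
        by (simp add: power2_eq_square)
      then have "Re (of_real \<alpha> * S \<zeta> * (of_real \<beta> * S \<zeta>)) = \<alpha> * \<beta> * Re ((S \<zeta>)\<^sup>2)"
        by (simp only: Re_complex_of_real Im_complex_of_real times_complex.sel(1) mult_zero_left diff_zero)
      then show ?thesis
        by (simp only: cmod_add_cnj_sq norm_mult power_mult_distrib norm_of_real power2_abs mult.assoc)
    qed
    also have "\<dots> = (\<alpha>\<^sup>2 + \<beta>\<^sup>2 + 2 * \<alpha> * \<beta> * cos (pi * c)) * (cmod (S \<zeta>))\<^sup>2"
      unfolding S_def Re_cayley_pow_square(1)[OF z] by (simp add: algebra_simps)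
    also have "\<dots> = (k * cmod (S \<zeta>))\<^sup>2" using rad0 by (simp add: k_def power_mult_distrib)
    finally have "cmod (of_real \<alpha> * S \<zeta> + cnj (of_real \<beta> * S \<zeta>)) = k * cmod (S \<zeta>)"
      using rad0 by (simp add: power2_eq_iff_nonneg k_def)
    moreover have "(cmod (of_real \<alpha> * S \<zeta>))\<^sup>2 + b * (cmod (of_real \<beta> * S \<zeta>))\<^sup>2 = (l * cmod (S \<zeta>))\<^sup>2"
      using pos by (simp add: norm_mult power_mult_distrib l_def algebra_simps)
    ultimately show ?case unfolding gh by blast
  qed
  have m: "(\<lambda>\<zeta>. ennreal (y powr p) * ennreal (cmod (S \<zeta>) powr p)) = (\<lambda>\<zeta>. ennreal ((y * cmod (S \<zeta>)) powr p))" if "0 \<le> y" for y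
    using that by (auto simp: powr_mult ennreal_mult')
  have meas: "(\<integral>\<^sup>+\<zeta>. ennreal ((y * cmod (S \<zeta>)) powr p) \<partial>circle_measure) = ennreal (y powr p * x)" if "0 \<le> y" for y
  proof -
    \<comment> \<open>\<open>seq_limit S\<close> supplies the measurability required for pulling the
      constant out of the integral.\<close>
    have "AE \<zeta> in circle_measure. seq_limit S \<zeta> = S \<zeta>"
      using AE_circle_Im_nonzero AE_space
    proof eventually_elim
      case (elim \<zeta>)
      then show ?case unfolding S_def using radial_tendsto_imp(2)[OF cayley_pow_radial_tendsto[of \<zeta> c]] by simp
    qed
    then have eq: "AE \<zeta> in circle_measure. F (S \<zeta>) = F (seq_limit S \<zeta>)" for F :: "complex \<Rightarrow> ennreal"
      by eventually_elim simp
    have ms: "(\<lambda>\<zeta>. ennreal (cmod (seq_limit S \<zeta>) powr p)) \<in> borel_measurable circle_measure"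
      using borel_measurable_seq_limit[OF holomorphic_on_imp_continuous_on[OF cayley_pow_holomorphic[of c]]]
      unfolding S_def by measurable
    have "(\<integral>\<^sup>+\<zeta>. ennreal ((y * cmod (S \<zeta>)) powr p) \<partial>circle_measure) =
      (\<integral>\<^sup>+\<zeta>. ennreal (y powr p) * ennreal (cmod (seq_limit S \<zeta>) powr p) \<partial>circle_measure)"
      unfolding m[OF that, symmetric] by (intro nn_integral_cong_AE eq)
    also have "\<dots> = ennreal (y powr p) * (\<integral>\<^sup>+\<zeta>. ennreal (cmod (seq_limit S \<zeta>) powr p) \<partial>circle_measure)"
      by (rule nn_integral_cmult[OF ms])
    also have "(\<integral>\<^sup>+\<zeta>. ennreal (cmod (seq_limit S \<zeta>) powr p) \<partial>circle_measure) = ennreal x"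
      unfolding x(2)[symmetric] by (rule nn_integral_cong_AE[OF eq[of "\<lambda>w. ennreal (cmod w powr p)", THEN AE_mp[OF _ AE_I2]]]) simp
    finally show ?thesis by (simp add: ennreal_mult')
  qed
  have k0: "0 \<le> k" using rad0 by (simp add: k_def)
  have root: "(y powr p * x) powr (1 / p) = y * x powr (1 / p)" if "0 \<le> y" for y
    using that p by (simp add: powr_mult powr_powr)
  have "lhs_norm p g h = ennpowr (\<integral>\<^sup>+\<zeta>. ennreal ((k * cmod (S \<zeta>)) powr p) \<partial>circle_measure) (1 / p)"
    unfolding lhs_norm_def by (rule arg_cong[of _ _ "\<lambda>I. ennpowr I (1 / p)"], rule nn_integral_cong_AE)
      (use ae in eventually_elim, simp)
  also have "\<dots> = ennreal (k * x powr (1 / p))"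
    using x k0 by (simp add: meas ennpowr_ennreal root)
  finally have lhs: "lhs_norm p g h = ennreal (k * x powr (1 / p))" .
  have pow_sq: "(y\<^sup>2) powr (p / 2) = y powr p" if "0 \<le> y" for y :: real
    using that by (cases "y = 0") (simp_all add: powr_powr flip: powr_numeral)
  have sq: "((l * cmod (S \<zeta>))\<^sup>2) powr (p / 2) = (l * cmod (S \<zeta>)) powr p" for \<zeta>
    by (rule pow_sq) (use l in simp)
  have "rhs_norm p b g h = ennpowr (\<integral>\<^sup>+\<zeta>. ennreal ((l * cmod (S \<zeta>)) powr p) \<partial>circle_measure) (1 / p)"
    unfolding rhs_norm_def by (rule arg_cong[of _ _ "\<lambda>I. ennpowr I (1 / p)"], rule nn_integral_cong_AE)
      (use ae in eventually_elim, simp add: sq)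
  also have "\<dots> = ennreal (l * x powr (1 / p))"
    using x l by (simp add: meas ennpowr_ennreal root)
  finally have rhs: "rhs_norm p b g h = ennreal (l * x powr (1 / p))" .
  have "ennreal (k * x powr (1 / p)) / ennreal (l * x powr (1 / p)) = ennreal (k * x powr (1 / p) / (l * x powr (1 / p)))"
    using x l k0 by (intro divide_ennreal) auto
  then show ?thesis unfolding lhs rhs using x by (simp add: k_def l_def)
qed

lemma cayley_family_admissible:
  fixes \<alpha> \<beta> :: real
  assumes p: "1 \<le> p" and c: "0 < c" "c < 1 / p" and sign: "\<alpha> * \<beta> \<le> 0"
  shows "admissible p (\<lambda>z. of_real \<alpha> * cayley_pow c z + of_real \<beta> * cayley_pow c (cnj z))
    (\<lambda>z. of_real \<alpha> * cayley_pow c z) (\<lambda>z. of_real \<beta> * cayley_pow c z)"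
proof -
  define f where "f z = of_real \<alpha> * cayley_pow c z + of_real \<beta> * cayley_pow c (cnj z)" for z
  have cp: "0 \<le> c * p" "c * p < 1" using p c by (auto simp: field_simps)
  have d: "harmonic_decomp f (\<lambda>z. of_real \<alpha> * cayley_pow c z) (\<lambda>z. of_real \<beta> * cayley_pow c z)"
    unfolding harmonic_decomp_def f_def
    by (auto intro!: holomorphic_intros cayley_pow_holomorphic simp: cayley_pow_cnj)
  define C where "C = (\<bar>\<alpha>\<bar> + \<bar>\<beta>\<bar>) powr p"
  define B where "B = ennpowr (ennreal C * ennreal (1 / cos (c * p * (pi / 2)))) (1 / p)"
  have "ennpowr (\<integral>\<^sup>+\<zeta>. ennreal (cmod (f (of_real r * \<zeta>)) powr p) \<partial>circle_measure) (1 / p) \<le> B" if r: "r \<in> {0<..<1}" for r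
  proof -
    have "(\<integral>\<^sup>+\<zeta>. ennreal (cmod (f (of_real r * \<zeta>)) powr p) \<partial>circle_measure) \<le>
      (\<integral>\<^sup>+\<zeta>. ennreal C * ennreal (cmod (cayley_pow (c * p) (of_real r * \<zeta>))) \<partial>circle_measure)"
    proof (intro nn_integral_mono)
      fix \<zeta> assume "\<zeta> \<in> space circle_measure"
      then have z: "cmod (of_real r * \<zeta>) < 1" using r by (simp add: norm_mult)
      have "cmod (f (of_real r * \<zeta>)) \<le> \<bar>\<alpha>\<bar> * cmod (cayley_pow c (of_real r * \<zeta>)) + \<bar>\<beta>\<bar> * cmod (cayley_pow c (of_real r * \<zeta>))"
        unfolding f_def cayley_pow_cnj[OF z] by (intro norm_triangle_le) (simp add: norm_mult)
      then have "cmod (f (of_real r * \<zeta>)) powr p \<le> ((\<bar>\<alpha>\<bar> + \<bar>\<beta>\<bar>) * cmod (cayley_pow c (of_real r * \<zeta>))) powr p"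
        using p by (intro powr_mono2) (auto simp: algebra_simps)
      also have "\<dots> = C * cmod (cayley_pow (c * p) (of_real r * \<zeta>))"
        by (simp add: powr_mult C_def norm_cayley_pow_powr)
      finally show "ennreal (cmod (f (of_real r * \<zeta>)) powr p) \<le> ennreal C * ennreal (cmod (cayley_pow (c * p) (of_real r * \<zeta>)))"
        by (simp add: C_def ennreal_mult'[symmetric] ennreal_leI)
    qed
    also have "\<dots> = ennreal C * (\<integral>\<^sup>+\<zeta>. ennreal (cmod (cayley_pow (c * p) (of_real r * \<zeta>))) \<partial>circle_measure)"
    proof (rule nn_integral_cmult)
      have "continuous_on (sphere 0 1) (\<lambda>\<zeta>. cayley_pow (c * p) (of_real r * \<zeta>))"
        by (rule continuous_on_compose2[OF holomorphic_on_imp_continuous_on[OF cayley_pow_holomorphic]])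
          (use r in \<open>auto intro!: continuous_intros simp: norm_mult\<close>)
      from borel_measurable_circle_continuous[OF this]
      show "(\<lambda>\<zeta>. ennreal (cmod (cayley_pow (c * p) (of_real r * \<zeta>)))) \<in> borel_measurable circle_measure" by measurable
    qed
    also have "\<dots> \<le> ennreal C * ennreal (1 / cos (c * p * (pi / 2)))"
      using r by (intro mult_left_mono cayley_pow_mean_le cp) auto
    finally show ?thesis unfolding B_def using p by (intro ennpowr_mono) auto
  qed
  then have "(SUP r\<in>{0<..<1::real}. ennpowr (\<integral>\<^sup>+\<zeta>. ennreal (cmod (f (of_real r * \<zeta>)) powr p) \<partial>circle_measure) (1 / p)) \<le> B"
    by (intro SUP_least)
  also have "B < \<infinity>" by (simp add: B_def ennpowr_def ennreal_mult_eq_top_iff)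
  finally have "f \<in> harmonic_hardy p" using d unfolding harmonic_hardy_def by blast
  then show ?thesis using d sign unfolding admissible_def f_def by simp
qed

text \<open>Assumption \<open>A\<close> says that the quotient formula, evaluated at c = 1 / p,
  gives \<open>A_const p b\<close>; continuity in c does the rest. The three families of the theorem
  have (\<alpha>, \<beta>) equal to (1, - r), (0, 1) and (1, 0).\<close>

lemma cayley_extremal_family:
  fixes \<alpha> \<beta> :: real
  assumes p: "1 \<le> p" and b: "0 < b" and sign: "\<alpha> * \<beta> \<le> 0" and pos: "0 < \<alpha>\<^sup>2 + b * \<beta>\<^sup>2"
    and A: "\<alpha>\<^sup>2 + \<beta>\<^sup>2 + 2 * \<alpha> * \<beta> * cos (pi / p) = (A_const p b)\<^sup>2 * (\<alpha>\<^sup>2 + b * \<beta>\<^sup>2)"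
  shows "extremal_family p b (\<lambda>c z. of_real \<alpha> * cayley_pow c z + of_real \<beta> * cayley_pow c (cnj z))
    (\<lambda>c z. of_real \<alpha> * cayley_pow c z) (\<lambda>c z. of_real \<beta> * cayley_pow c z)"
  unfolding extremal_family_def
proof (intro conjI allI impI)
  fix c assume "0 < c \<and> c < 1 / p"
  then show "admissible p (\<lambda>z. of_real \<alpha> * cayley_pow c z + of_real \<beta> * cayley_pow c (cnj z))
    (\<lambda>z. of_real \<alpha> * cayley_pow c z) (\<lambda>z. of_real \<beta> * cayley_pow c z)"
    by (intro cayley_family_admissible p sign) auto
next
  define R where "R c = sqrt (\<alpha>\<^sup>2 + \<beta>\<^sup>2 + 2 * \<alpha> * \<beta> * cos (pi * c)) / sqrt (\<alpha>\<^sup>2 + b * \<beta>\<^sup>2)" for c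
  have "(R \<longlongrightarrow> R (1 / p)) (at_left (1 / p))"
    unfolding R_def using pos by (intro tendsto_intros) auto
  moreover have "R (1 / p) = A_const p b"
    using A pos A_const_sq(2)[OF b, of p] by (simp add: R_def real_sqrt_mult)
  ultimately have "((\<lambda>c. ennreal (R c)) \<longlongrightarrow> ennreal (A_const p b)) (at_left (1 / p))"
    by (intro tendsto_ennrealI) simp
  moreover have "\<forall>\<^sub>F c in at_left (1 / p). 0 < c \<and> c < 1 / p"
    using eventually_at_left_real[of 0 "1 / p"] p by simp
  then have "\<forall>\<^sub>F c in at_left (1 / p). ennreal (R c) =
    lhs_norm p (\<lambda>z. of_real \<alpha> * cayley_pow c z) (\<lambda>z. of_real \<beta> * cayley_pow c z) /
    rhs_norm p b (\<lambda>z. of_real \<alpha> * cayley_pow c z) (\<lambda>z. of_real \<beta> * cayley_pow c z)"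
    by eventually_elim (simp add: R_def cayley_family_ratio[OF p b _ _ pos])
  ultimately show "((\<lambda>c. lhs_norm p (\<lambda>z. of_real \<alpha> * cayley_pow c z) (\<lambda>z. of_real \<beta> * cayley_pow c z) /
    rhs_norm p b (\<lambda>z. of_real \<alpha> * cayley_pow c z) (\<lambda>z. of_real \<beta> * cayley_pow c z)) \<longlongrightarrow> ennreal (A_const p b)) (at_left (1 / p))"
    by (rule Lim_transform_eventually)
qed

lemma extremal_family_imp_sharp:
  assumes p: "0 < p" and b: "0 < b" and ext: "extremal_family p b f g h"
    and C: "\<And>f g h. admissible p f g h \<Longrightarrow> lhs_norm p g h \<le> ennreal C * rhs_norm p b g h"
  shows "A_const p b \<le> C"
proof -
  \<comment> \<open>For y = 0 the hypothesis gives x = 0, and 0 / 0 = 0 in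
    \<open>ennreal\<close>.\<close>
  have le: "x / y \<le> ennreal C" if "x \<le> ennreal C * y" for x y
  proof (cases "y = 0")
    case False
    then show ?thesis using that by (intro divide_le_posI_ennreal) (auto simp: mult.commute zero_less_iff_neq_zero)
  qed (use that in simp)
  have "\<forall>\<^sub>F c in at_left (1 / p). 0 < c \<and> c < 1 / p"
    using eventually_at_left_real[of 0 "1 / p"] p by simp
  then have "\<forall>\<^sub>F c in at_left (1 / p). lhs_norm p (g c) (h c) / rhs_norm p b (g c) (h c) \<le> ennreal C"
  proof eventually_elim
    case (elim c)
    then have "admissible p (f c) (g c) (h c)" using ext by (simp add: extremal_family_def)
    then show ?case by (intro le C)
  qed
  then have "ennreal (A_const p b) \<le> ennreal C"
    using ext by (intro tendsto_upperbound) (auto simp: extremal_family_def)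
  \<comment> \<open>\<open>ennreal\<close> sends a negative \<open>C\<close> to 0, which the
    positivity of \<open>A_const\<close> rules out.\<close>
  then show ?thesis using A_const_sq(2)[OF b, of p] by (auto simp: ennreal_le_iff2)
qed

theorem theorem2p1:
  fixes p b :: real
  assumes "1 \<le> p" "p \<le> 2" "b > 0"
  shows "(\<forall>f g h. admissible p f g h \<longrightarrow>
            lhs_norm p g h \<le> ennreal (A_const p b) * rhs_norm p b g h)
     \<and> (\<forall>C::real. (\<forall>f g h. admissible p f g h \<longrightarrow>
            lhs_norm p g h \<le> ennreal C * rhs_norm p b g h) \<longrightarrow> A_const p b \<le> C)
     \<and> (p < 2 \<longrightarrow> extremal_family p b
            (\<lambda>c z. cayley_pow c z - of_real (r_const p b) * cayley_pow c (cnj z))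
            (\<lambda>c z. cayley_pow c z)
            (\<lambda>c z. - of_real (r_const p b) * cayley_pow c z))
     \<and> (p = 2 \<and> b \<le> 1 \<longrightarrow> extremal_family p b
            (\<lambda>c z. cayley_pow c (cnj z)) (\<lambda>c z. 0) (\<lambda>c z. cayley_pow c z))
     \<and> (p = 2 \<and> b > 1 \<longrightarrow> extremal_family p b
            (\<lambda>c z. cayley_pow c z) (\<lambda>c z. cayley_pow c z) (\<lambda>c z. 0))"
proof -
  have i: "extremal_family p b
            (\<lambda>c z. cayley_pow c z - of_real (r_const p b) * cayley_pow c (cnj z))
            (\<lambda>c z. cayley_pow c z)
            (\<lambda>c z. - of_real (r_const p b) * cayley_pow c z)" if "p < 2"
  proof -
    define r where "r = r_const p b"
    define c where "c = - cos (pi / p)"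
    note eig = A_const_eigen[OF assms(1) that assms(3), folded r_def c_def]
    \<comment> \<open>The two eigenvalue equations, weighted with 1 and r^2, add up to the required
      identity.\<close>
    have "(A_const p b)\<^sup>2 * (1 + b * r\<^sup>2) = (A_const p b)\<^sup>2 + (A_const p b)\<^sup>2 * b * r\<^sup>2"
      by (simp add: algebra_simps)
    also have "\<dots> = 1 + r * c + (1 + c / r) * r\<^sup>2" unfolding eig(4) unfolding eig(3) ..
    also have "\<dots> = 1 + r\<^sup>2 + 2 * r * c" using eig(2) by (simp add: power2_eq_square field_simps)
    finally have "1\<^sup>2 + (- r)\<^sup>2 + 2 * 1 * (- r) * cos (pi / p) = (A_const p b)\<^sup>2 * (1\<^sup>2 + b * (- r)\<^sup>2)"
      by (simp add: c_def)
    moreover have "0 < 1\<^sup>2 + b * (- r)\<^sup>2" using assms by (simp add: add_pos_nonneg)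
    ultimately show ?thesis
      using cayley_extremal_family[OF assms(1,3), of 1 "- r"] eig(2) by (simp add: r_def)
  qed
  \<comment> \<open>At p = 2 the cosine vanishes and the square of \<open>A_const\<close> is the
    maximum of 1 and 1 / b. So the quotient is attained with h alone if b <= 1 and with g alone if b
    > 1.\<close>
  have ii: "extremal_family p b (\<lambda>c z. cayley_pow c (cnj z)) (\<lambda>c z. 0) (\<lambda>c z. cayley_pow c z)" if "p = 2" "b \<le> 1"
    using cayley_extremal_family[OF assms(1,3), of 0 1] A_const_sq(1)[OF assms(3), of p] that assms(3) by simp
  have iii: "extremal_family p b (\<lambda>c z. cayley_pow c z) (\<lambda>c z. cayley_pow c z) (\<lambda>c z. 0)" if "p = 2" "b > 1"
    using cayley_extremal_family[OF assms(1,3), of 1 0] A_const_sq(1)[OF assms(3), of p] that by simp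
  have ex: "\<exists>f g h. extremal_family p b f g h"
    using i ii iii assms(2) by (cases "p < 2"; cases "b \<le> 1") (force simp: not_less)+
  have sharp: "A_const p b \<le> C" if "\<forall>f g h. admissible p f g h \<longrightarrow> lhs_norm p g h \<le> ennreal C * rhs_norm p b g h" for C
    using ex extremal_family_imp_sharp[of p b _ _ _ C] that assms by auto
  show ?thesis using i ii iii sharp norm_inequality[OF assms] by blast
qed

end
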